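(* For all positive integers $r,d$, the family of $r$-range Schr\"odinger operators on the boxes $[N]^d$, $N\ge1$, has asymptotically dense delocalization; that is, for all $\lambda,\varepsilon,\delta>0$ there is $N_0=N_0(r,d,\lambda,\varepsilon,\delta)$ such that for every $N$ with $N^d>N_0$ and every potential $V:[N]^d\to[-\lambda,\lambda]$ there is a potential $W:[N]^d\to[-\lambda,\lambda]$ with $\|V-W\|_\infty<\delta$ such that, for at least $(1-\delta)N^d$ sites $\mathbf{n}\in[N]^d$, the spectral measure of $H_{W,r}$ at $\delta_{\mathbf{n}}$ has no atom of weight larger than $\varepsilon$.
   Context: $[N]^d=\{1,\dots,N\}^d$ is the box graph, with edges between nearest neighbours of $\mathbb{Z}^d$ (distance exactly $1$); $\mathrm{d}$ denotes its graph (shortest path) distance. For a potential $V:[N]^d\to[-\lambda,\lambda]$ the $r$-range Schr\"odinger operator $H_{V,r}$ on $\ell^2([N]^d)$ is $(H_{V,r}\phi)(v)=\sum_{\mathrm{d}(v',v)\le r}[\phi(v')-\phi(v)]+V(v)\phi(v)$; equivalently it is the ordinary Schr\"odinger operator on the graph with vertex set $[N]^d$ where distinct vertices are adjacent iff their distance is at most $r$. The spectral measure $\sigma$ of a self-adjoint $H$ at $\delta_{\mathbf{n}}$ is defined by $\langle\delta_{\mathbf{n}},g(H)\delta_{\mathbf{n}}\rangle=\int g\,d\sigma$. *)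

theory Defs
  imports "HOL-Analysis.Analysis" "HOL-Library.Extended_Nat"
begin

text \<open>Graphs are given by their (symmetric) edge relation.  Shortest-path distance;
  it is \<open>\<infinity>\<close> between different components (infimum of the empty set).\<close>

definition graph_dist :: "('a \<times> 'a) set \<Rightarrow> 'a \<Rightarrow> 'a \<Rightarrow> enat" where
  "graph_dist E u v = (INF n\<in>{n. (u, v) \<in> E ^^ n}. enat n)"

text \<open>Points of \<open>\<int>\<^sup>d\<close> are functions on the index set \<open>{..<d}\<close>, made unique as HOL functions
  by extensionality (\<open>PiE\<close>).\<close>

definition lattice_box :: "nat \<Rightarrow> nat \<Rightarrow> (nat \<Rightarrow> int) set" where
  "lattice_box d N = (\<Pi>\<^sub>E i\<in>{..<d}. {1..int N})"

definition lattice_box_edges :: "nat \<Rightarrow> nat \<Rightarrow> ((nat \<Rightarrow> int) \<times> (nat \<Rightarrow> int)) set" where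
  "lattice_box_edges d N = {(u, v). u \<in> lattice_box d N \<and> v \<in> lattice_box d N \<and>
      L2_set (\<lambda>i. real_of_int (u i - v i)) {..<d} = 1}"

text \<open>For a finite set \<open>X\<close>, the Hilbert space \<open>\<ell>\<^sup>2(X)\<close> is represented by the complex functions
  that vanish outside \<open>X\<close>; the inner product is conjugate linear in its first argument.\<close>

definition ell2 :: "'a set \<Rightarrow> ('a \<Rightarrow> complex) set" where
  "ell2 X = {\<phi>. \<forall>v. v \<notin> X \<longrightarrow> \<phi> v = 0}"

definition ell2_inner :: "'a set \<Rightarrow> ('a \<Rightarrow> complex) \<Rightarrow> ('a \<Rightarrow> complex) \<Rightarrow> complex" where
  "ell2_inner X \<phi> \<psi> = (\<Sum>v\<in>X. cnj (\<phi> v) * \<psi> v)"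

definition schrodinger :: "'a set \<Rightarrow> ('a \<times> 'a) set \<Rightarrow> nat \<Rightarrow> ('a \<Rightarrow> real)
    \<Rightarrow> ('a \<Rightarrow> complex) \<Rightarrow> ('a \<Rightarrow> complex)" where
  "schrodinger X E r V \<phi> = (\<lambda>v. if v \<in> X
      then (\<Sum>v'\<in>{v' \<in> X. graph_dist E v' v \<le> enat r}. \<phi> v' - \<phi> v) + complex_of_real (V v) * \<phi> v
      else 0)"

text \<open>Functional calculus \<open>g(H) = \<Sum>\<^sub>t g(t) P\<^sub>t\<close> of a self-adjoint operator \<open>H\<close> on the
  finite-dimensional space \<open>\<ell>\<^sup>2(X)\<close>, where \<open>t\<close> runs over the (finite, real) spectrum of \<open>H\<close> and
  \<open>P\<^sub>t\<close> is the orthogonal projection onto the eigenspace of \<open>t\<close>.\<close>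

definition eigenspace ::
    "'a set \<Rightarrow> (('a \<Rightarrow> complex) \<Rightarrow> ('a \<Rightarrow> complex)) \<Rightarrow> real \<Rightarrow> ('a \<Rightarrow> complex) set" where
  "eigenspace X H t = {\<phi> \<in> ell2 X. H \<phi> = (\<lambda>v. complex_of_real t * \<phi> v)}"

definition spectrum :: "'a set \<Rightarrow> (('a \<Rightarrow> complex) \<Rightarrow> ('a \<Rightarrow> complex)) \<Rightarrow> real set" where
  "spectrum X H = {t. \<exists>\<phi>\<in>eigenspace X H t. \<phi> \<noteq> (\<lambda>_. 0)}"

definition eigenprojection :: "'a set \<Rightarrow> (('a \<Rightarrow> complex) \<Rightarrow> ('a \<Rightarrow> complex)) \<Rightarrow> real
    \<Rightarrow> ('a \<Rightarrow> complex) \<Rightarrow> ('a \<Rightarrow> complex)" where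
  "eigenprojection X H t \<phi> = (THE \<psi>. \<psi> \<in> eigenspace X H t \<and>
      (\<forall>\<theta>\<in>eigenspace X H t. ell2_inner X \<theta> (\<lambda>v. \<phi> v - \<psi> v) = 0))"

definition fun_calc :: "'a set \<Rightarrow> (('a \<Rightarrow> complex) \<Rightarrow> ('a \<Rightarrow> complex)) \<Rightarrow> (real \<Rightarrow> complex)
    \<Rightarrow> ('a \<Rightarrow> complex) \<Rightarrow> ('a \<Rightarrow> complex)" where
  "fun_calc X H g \<phi> = (\<lambda>v. \<Sum>t\<in>spectrum X H. g t * eigenprojection X H t \<phi> v)"

text \<open>The spectral measure of \<open>H\<close> at \<open>\<delta>\<^sub>x\<close> (written \<open>indicator {x}\<close>): the finite Borel measure
  \<open>\<sigma>\<close> with \<open>\<langle>\<delta>\<^sub>x, g(H) \<delta>\<^sub>x\<rangle> = \<integral> g d\<sigma>\<close> for all bounded Borel functions \<open>g\<close>.\<close>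

definition is_spectral_measure :: "'a set \<Rightarrow> (('a \<Rightarrow> complex) \<Rightarrow> ('a \<Rightarrow> complex)) \<Rightarrow> 'a
    \<Rightarrow> real measure \<Rightarrow> bool" where
  "is_spectral_measure X H x \<sigma> \<longleftrightarrow> finite_measure \<sigma> \<and> sets \<sigma> = sets borel \<and>
     (\<forall>g :: real \<Rightarrow> complex. g \<in> borel_measurable borel \<and> bounded (range g) \<longrightarrow>
        ell2_inner X (indicator {x}) (fun_calc X H g (indicator {x})) = (\<integral>t. g t \<partial>\<sigma>))"

definition spectral_measure :: "'a set \<Rightarrow> (('a \<Rightarrow> complex) \<Rightarrow> ('a \<Rightarrow> complex)) \<Rightarrow> 'a
    \<Rightarrow> real measure" where
  "spectral_measure X H x = (THE \<sigma>. is_spectral_measure X H x \<sigma>)"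

end

theory Submission
  imports Defs
begin

text \<open>
  Write \<open>H\<^sub>W = A + diag W\<close>. For \<open>h\<close> of class \<open>C\<^sup>1\<^sup>,\<^sup>1\<close> the function \<open>W \<mapsto> Tr h(H\<^sub>W)\<close> has partial
  derivatives \<open>\<langle>\<delta>\<^sub>n, h'(H\<^sub>W) \<delta>\<^sub>n\<rangle> = \<integral> h' d\<sigma>\<^sub>n\<close>, and it is bounded by \<open>sup |h|\<close> times the number of sites.
  So if \<open>h\<close> is tiny while \<open>h'\<close> is not, then near any potential there is one at which
  \<open>\<integral> h' d\<sigma>\<^sub>n\<close> almost vanishes at most sites. Take \<open>h = u R\<close> where \<open>u\<close> is a window with values in
  \<open>[0, 1]\<close> and \<open>R\<close> is a small, rapidly oscillating function whose derivative \<open>r\<close> is close to \<open>\<plusminus>1\<close>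
  outside short intervals. Then \<open>\<integral> u r d\<sigma>\<^sub>n \<approx> 0\<close>, that is, the two windows \<open>u (1 \<plusminus> r) / 2\<close> receive
  about half of the mass of \<open>u\<close> each. The condition persists under perturbations that are small
  compared with the scale of \<open>r\<close>, so all windows can be split successively, on finer and finer
  scales, until each carries little mass. An atom then sits either at an energy where some window
  is not small, so that it has small weight, or in one of the short intervals. The latter contain
  few eigenvalues, because an approximate eigenfunction on the box is controlled by its values on
  sparse layers orthogonal to the first coordinate axis; this is the only place where the
  geometry of the graph enters.
\<close>

section \<open>Spectral theorem for symmetric kernels\<close>

text \<open>The order of choices shapes the argument. Windows and oscillating functions are fixed
  before the potential, so every estimate has to be uniform in \<open>N\<close>, in the potential
  and in the energy. Moreover the number of short intervals must be known before their length, since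
  the length is dictated by how few eigenvalues they may contain in total. This is why
  \<open>R\<close> is a triangle wave with rounded corners: its size alone fixes its period, hence
  the number of corners in a bounded range of energies, and the corners can afterwards be rounded as
  tightly as desired without moving. Some rounding is unavoidable, because the second-order estimate
  for the trace needs a Lipschitz derivative.

  One splitting multiplies the mass bound for a window by 3/5 (one half plus errors), but the level
  at which energies are detected only by 4/5. At a good site an atom heavier than \<epsilon> at a
  detected energy would give some window mass above (4/5)^J \<epsilon>, which is impossible once
  (3/4)^J < \<epsilon>. Perturbations are measured in the Hilbert-Schmidt norm, which for diagonal
  changes is a plain sum over sites and therefore suits statements about most sites.\<close>

definition inner_on :: "'a set \<Rightarrow> ('a \<Rightarrow> real) \<Rightarrow> ('a \<Rightarrow> real) \<Rightarrow> real" where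
  "inner_on X f g = (\<Sum>v\<in>X. f v * g v)"

text \<open>The value 0 outside \<open>X\<close> makes an eigenvalue equation an equality of
  functions when the eigenfunction is supported in \<open>X\<close>.\<close>

definition kernel_op :: "'a set \<Rightarrow> ('a \<Rightarrow> 'a \<Rightarrow> real) \<Rightarrow> ('a \<Rightarrow> real) \<Rightarrow> 'a \<Rightarrow> real" where
  "kernel_op X K f v = (if v \<in> X then \<Sum>w\<in>X. K v w * f w else 0)"

definition orthonormal_on :: "'a set \<Rightarrow> ('a \<Rightarrow> real) set \<Rightarrow> bool" where
  "orthonormal_on X B \<longleftrightarrow> finite B \<and>
     (\<forall>\<phi>\<in>B. \<forall>\<psi>\<in>B. inner_on X \<phi> \<psi> = of_bool (\<phi> = \<psi>))"

text \<open>Completeness is encoded as the resolution of the identity. Since \<open>B\<close> is a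
  set of functions and \<open>e\<close> assigns their eigenvalues, cardinalities of subsets of
  \<open>B\<close> count eigenvalues with multiplicity.\<close>

definition eigenbasis ::
    "'a set \<Rightarrow> ('a \<Rightarrow> 'a \<Rightarrow> real) \<Rightarrow> ('a \<Rightarrow> real) set \<Rightarrow> (('a \<Rightarrow> real) \<Rightarrow> real) \<Rightarrow> bool" where
  "eigenbasis X K B e \<longleftrightarrow> orthonormal_on X B \<and>
     (\<forall>\<phi>\<in>B. \<forall>v. v \<notin> X \<longrightarrow> \<phi> v = 0) \<and>
     (\<forall>v\<in>X. \<forall>w\<in>X. (\<Sum>\<phi>\<in>B. \<phi> v * \<phi> w) = of_bool (v = w)) \<and>
     (\<forall>\<phi>\<in>B. kernel_op X K \<phi> = (\<lambda>v. e \<phi> * \<phi> v))"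

lemma inner_on_commute: "inner_on X f g = inner_on X g f"
  by (simp add: inner_on_def mult.commute)

lemma inner_on_simps:
  "inner_on X (\<lambda>v. f v + g v) h = inner_on X f h + inner_on X g h"
  "inner_on X h (\<lambda>v. f v + g v) = inner_on X h f + inner_on X h g"
  "inner_on X (\<lambda>v. f v - g v) h = inner_on X f h - inner_on X g h"
  "inner_on X h (\<lambda>v. f v - g v) = inner_on X h f - inner_on X h g"
  "inner_on X (\<lambda>v. c * f v) h = c * inner_on X f h"
  "inner_on X h (\<lambda>v. c * f v) = c * inner_on X h f"
  by (simp_all add: inner_on_def algebra_simps sum.distrib sum_subtractf sum_distrib_left)

lemma inner_on_sum:
  "inner_on X (\<lambda>v. \<Sum>i\<in>I. f i v) h = (\<Sum>i\<in>I. inner_on X (f i) h)"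
  "inner_on X h (\<lambda>v. \<Sum>i\<in>I. f i v) = (\<Sum>i\<in>I. inner_on X h (f i))"
  by (simp_all add: inner_on_def sum_distrib_right sum_distrib_left) (rule sum.swap)+

lemma inner_on_delta:
  assumes "finite X" "n \<in> X"
  shows "inner_on X f (\<lambda>v. of_bool (v = n)) = f n" "inner_on X (\<lambda>v. of_bool (v = n)) f = f n"
proof -
  show "inner_on X f (\<lambda>v. of_bool (v = n)) = f n"
    using assms by (simp add: inner_on_def of_bool_def if_distrib cong: if_cong)
  then show "inner_on X (\<lambda>v. of_bool (v = n)) f = f n"
    by (simp add: inner_on_commute)
qed

lemma inner_on_self_nonneg: "inner_on X f f \<ge> 0"
  by (simp add: inner_on_def sum_nonneg)

lemma inner_on_self_eq_0_iff:
  assumes "finite X"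
  shows "inner_on X f f = 0 \<longleftrightarrow> (\<forall>v\<in>X. f v = 0)"
  using assms by (simp add: inner_on_def sum_nonneg_eq_0_iff)

lemma kernel_op_simps:
  "kernel_op X K (\<lambda>v. f v + g v) = (\<lambda>v. kernel_op X K f v + kernel_op X K g v)"
  "kernel_op X K (\<lambda>v. c * f v) = (\<lambda>v. c * kernel_op X K f v)"
  by (auto simp: kernel_op_def algebra_simps sum.distrib sum_distrib_left)

lemma kernel_op_symmetric:
  assumes "\<And>v w. v \<in> X \<Longrightarrow> w \<in> X \<Longrightarrow> K v w = K w v"
  shows "inner_on X f (kernel_op X K g) = inner_on X (kernel_op X K f) g"
proof -
  have "inner_on X f (kernel_op X K g) = (\<Sum>v\<in>X. \<Sum>w\<in>X. f v * (K v w * g w))"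
    by (simp add: inner_on_def kernel_op_def sum_distrib_left)
  also have "\<dots> = (\<Sum>w\<in>X. \<Sum>v\<in>X. f v * (K v w * g w))" by (rule sum.swap)
  also have "\<dots> = (\<Sum>w\<in>X. \<Sum>v\<in>X. K w v * f v * g w)"
    using assms by (intro sum.cong refl) (simp add: algebra_simps)
  also have "\<dots> = inner_on X (kernel_op X K f) g"
    by (simp add: inner_on_def kernel_op_def sum_distrib_right)
  finally show ?thesis .
qed

text \<open>The squared norm of the delta function at \<open>n\<close> minus its projection
  \<open>g\<close> to the span of \<open>B\<close> is nonnegative.\<close>

lemma orthonormal_on_bessel:
  assumes X: "finite X" and B: "orthonormal_on X B" and n: "n \<in> X"
  shows "(\<Sum>\<phi>\<in>B. (\<phi> n)\<^sup>2) \<le> 1"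
proof -
  have fin: "finite B" using B by (simp add: orthonormal_on_def)
  define g where "g v = (\<Sum>\<phi>\<in>B. \<phi> n * \<phi> v)" for v
  note \<delta> = inner_on_delta(1)[OF X n]
  have gg: "inner_on X g g = (\<Sum>\<phi>\<in>B. (\<phi> n)\<^sup>2)"
  proof -
    have "inner_on X g g = (\<Sum>\<phi>\<in>B. \<Sum>\<psi>\<in>B. \<phi> n * (\<psi> n * inner_on X \<phi> \<psi>))"
      unfolding g_def by (simp add: inner_on_sum inner_on_simps sum_distrib_left mult.left_commute)
    also have "\<dots> = (\<Sum>\<phi>\<in>B. \<Sum>\<psi>\<in>B. if \<psi> = \<phi> then \<phi> n * \<phi> n else 0)"
      using B by (intro sum.cong refl) (auto simp: orthonormal_on_def)
    also have "\<dots> = (\<Sum>\<phi>\<in>B. (\<phi> n)\<^sup>2)"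
      using fin by (simp add: power2_eq_square)
    finally show ?thesis .
  qed
  have "0 \<le> inner_on X (\<lambda>v. of_bool (v = n) - g v) (\<lambda>v. of_bool (v = n) - g v)"
    by (rule inner_on_self_nonneg)
  also have "\<dots> = 1 - 2 * g n + inner_on X g g"
    using \<delta>[of g] \<delta>[of "\<lambda>v. of_bool (v = n)"]
    by (simp add: inner_on_simps inner_on_commute[of X "\<lambda>v. of_bool (v = n)" g])
  also have "g n = (\<Sum>\<phi>\<in>B. (\<phi> n)\<^sup>2)" by (simp add: g_def power2_eq_square)
  finally show ?thesis using gg by simp
qed

text \<open>Bessel's inequality summed over all sites: the trace of the projection to the span of
  \<open>B\<close> is at most that of the identity.\<close>

lemma orthonormal_on_card_le:
  assumes X: "finite X" and B: "orthonormal_on X B"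
  shows "card B \<le> card X"
proof -
  have fin: "finite B" using B by (simp add: orthonormal_on_def)
  have "real (card B) = (\<Sum>\<phi>\<in>B. inner_on X \<phi> \<phi>)"
    using B by (simp add: orthonormal_on_def)
  also have "\<dots> = (\<Sum>n\<in>X. \<Sum>\<phi>\<in>B. (\<phi> n)\<^sup>2)"
    unfolding inner_on_def power2_eq_square by (rule sum.swap)
  also have "\<dots> \<le> (\<Sum>n\<in>X. 1)"
    using orthonormal_on_bessel[OF X B] by (rule sum_mono)
  finally show ?thesis by simp
qed

section \<open>Orthonormal eigenbases from the variational principle\<close>

lemma compact_box_functions:
  fixes S :: "'a \<Rightarrow> real set"
  assumes "\<And>v. compact (S v)"
  shows "compact {f. \<forall>v. f v \<in> S v}"
proof -
  have "compactin (product_topology (\<lambda>v. euclidean) UNIV) (PiE UNIV S)"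
    unfolding compactin_PiE using assms by auto
  moreover have "PiE UNIV S = {f. \<forall>v. f v \<in> S v}" by auto
  ultimately show ?thesis by (simp add: euclidean_product_topology)
qed

text \<open>A maximiser of the quadratic form \<open>q\<close> on the unit sphere of
  \<open>C\<close> is an eigenvector. The invariant subspace \<open>C\<close> will be the orthogonal
  complement of eigenvectors already found; it enters only through its closure properties.\<close>

lemma kernel_op_eigenvector_exists:
  assumes X: "finite X" and K: "\<And>v w. v \<in> X \<Longrightarrow> w \<in> X \<Longrightarrow> K v w = K w v"
    and C_supp: "\<And>\<theta> v. \<theta> \<in> C \<Longrightarrow> v \<notin> X \<Longrightarrow> \<theta> v = 0"
    and C_add: "\<And>\<theta> \<eta> c. \<theta> \<in> C \<Longrightarrow> \<eta> \<in> C \<Longrightarrow> (\<lambda>v. \<theta> v + c * \<eta> v) \<in> C"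
    and C_op: "\<And>\<theta>. \<theta> \<in> C \<Longrightarrow> kernel_op X K \<theta> \<in> C"
    and C_closed: "closed C"
    and ne: "\<theta>0 \<in> C" "\<theta>0 \<noteq> (\<lambda>_. 0)"
  shows "\<exists>\<phi>\<in>C. inner_on X \<phi> \<phi> = 1 \<and> (\<exists>\<mu>. kernel_op X K \<phi> = (\<lambda>v. \<mu> * \<phi> v))"
proof -
  define T where "T = {\<theta>\<in>C. inner_on X \<theta> \<theta> = 1}"
  define q where "q \<theta> = inner_on X \<theta> (kernel_op X K \<theta>)" for \<theta>
  have C_0: "(\<lambda>v. c * \<theta> v) \<in> C" if "\<theta> \<in> C" for \<theta> c
  proof -
    have "(\<lambda>v. \<theta> v + (c - 1) * \<theta> v) \<in> C" by (intro C_add that)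
    then show ?thesis by (simp add: algebra_simps)
  qed
  have pos: "inner_on X \<theta> \<theta> > 0" if "\<theta> \<in> C" "\<theta> \<noteq> (\<lambda>_. 0)" for \<theta>
    using that C_supp inner_on_self_eq_0_iff[OF X, of \<theta>] inner_on_self_nonneg[of X \<theta>]
    by (metis ext order_less_le)
  have cont_inner: "continuous_on UNIV (\<lambda>\<theta>. inner_on X \<theta> \<theta>)"
    unfolding inner_on_def by (intro continuous_intros continuous_on_product_coordinates)
  have cont_q: "continuous_on UNIV q"
    unfolding q_def inner_on_def kernel_op_def
    by (intro continuous_intros continuous_on_product_coordinates) (auto intro!: continuous_intros continuous_on_product_coordinates)
  have "T = C \<inter> ((\<lambda>\<theta>. inner_on X \<theta> \<theta>) -` {1})" by (auto simp: T_def)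
  moreover have "closed ((\<lambda>\<theta>. inner_on X \<theta> \<theta>) -` {1})"
    by (intro closed_vimage cont_inner) auto
  ultimately have "closed T" using C_closed by auto
  \<comment> \<open>The sphere sits in a product of compact sets, with the factor {0} outside
    \<open>X\<close>, so Tychonoff's theorem gives compactness even over an infinite type.\<close>
  moreover have "T \<subseteq> {f. \<forall>v. f v \<in> (if v \<in> X then {-1..1} else {0})}"
  proof
    fix \<theta> assume \<theta>: "\<theta> \<in> T"
    have "(\<theta> v)\<^sup>2 \<le> 1" if v: "v \<in> X" for v
    proof -
      have "(\<theta> v)\<^sup>2 \<le> (\<Sum>v\<in>X. (\<theta> v)\<^sup>2)" using X v by (intro member_le_sum) auto
      then show ?thesis using \<theta> by (simp add: T_def inner_on_def power2_eq_square)
    qed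
    then have "\<theta> v \<in> {-1..1}" if "v \<in> X" for v
      using that by (force simp: abs_square_le_1 abs_le_iff)
    moreover have "\<theta> v = 0" if "v \<notin> X" for v using \<theta> C_supp that by (auto simp: T_def)
    ultimately show "\<theta> \<in> {f. \<forall>v. f v \<in> (if v \<in> X then {-1..1} else {0})}" by auto
  qed
  moreover have "compact {f :: 'a \<Rightarrow> real. \<forall>v. f v \<in> (if v \<in> X then {-1..1} else {0})}"
    by (rule compact_box_functions) auto
  ultimately have "compact T"
    using compact_Int_closed[of "{f. \<forall>v. f v \<in> (if v \<in> X then {-1..1} else {0})}" T]
    by (simp only: Int_absorb1)
  moreover have "(\<lambda>v. (1 / sqrt (inner_on X \<theta>0 \<theta>0)) * \<theta>0 v) \<in> T"
    unfolding T_def mem_Collect_eq inner_on_simps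
    using pos[OF ne] C_0[OF ne(1), of "1 / sqrt (inner_on X \<theta>0 \<theta>0)"] by simp
  then have "T \<noteq> {}" by (metis empty_iff)
  moreover have "continuous_on T q" using cont_q by (rule continuous_on_subset) simp
  ultimately have "\<exists>\<phi>\<in>T. \<forall>\<theta>\<in>T. q \<theta> \<le> q \<phi>" by (rule continuous_attains_sup)
  then obtain \<phi> where \<phi>: "\<phi> \<in> T" and max: "\<And>\<theta>. \<theta> \<in> T \<Longrightarrow> q \<theta> \<le> q \<phi>" by blast
  define \<mu> where "\<mu> = q \<phi>"
  have \<phi>C: "\<phi> \<in> C" and \<phi>1: "inner_on X \<phi> \<phi> = 1" using \<phi> by (auto simp: T_def)
  have le: "q \<theta> \<le> \<mu> * inner_on X \<theta> \<theta>" if \<theta>: "\<theta> \<in> C" for \<theta>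
  proof (cases "\<theta> = (\<lambda>_. 0)")
    case True
    then show ?thesis by (simp add: q_def inner_on_def)
  next
    case False
    define s where "s = 1 / sqrt (inner_on X \<theta> \<theta>)"
    have s2: "s * s * inner_on X \<theta> \<theta> = 1" using pos[OF \<theta> False] by (simp add: s_def field_simps)
    have "(\<lambda>v. s * \<theta> v) \<in> T"
      unfolding T_def mem_Collect_eq inner_on_simps using s2 C_0[OF \<theta>, of s] by (simp add: mult.assoc)
    from max[OF this] have "s * s * q \<theta> \<le> \<mu>"
      by (simp add: q_def \<mu>_def inner_on_simps kernel_op_simps mult.assoc)
    then have "s * s * q \<theta> * inner_on X \<theta> \<theta> \<le> \<mu> * inner_on X \<theta> \<theta>"
      using inner_on_self_nonneg by (rule mult_right_mono)
    moreover have "s * s * q \<theta> * inner_on X \<theta> \<theta> = q \<theta>"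
      using s2 by (metis mult.assoc mult.commute mult.right_neutral)
    ultimately show ?thesis by simp
  qed
  \<comment> \<open>The residual of the eigenvalue equation. It lies in \<open>C\<close>, so
    \<open>\<phi> + s * \<xi>\<close> is an admissible variation, whose first-order gain is
    \<open>2 * s * b\<close> with \<open>b\<close> the squared norm of \<open>\<xi>\<close>.\<close>
  define \<xi> where "\<xi> v = kernel_op X K \<phi> v + (- \<mu>) * \<phi> v" for v
  have \<xi>C: "\<xi> \<in> C"
    unfolding \<xi>_def by (intro C_add C_op \<phi>C)
  define b where "b = inner_on X \<xi> \<xi>"
  define a where "a = q \<xi> - \<mu> * b"
  have quad: "2 * s * b + s\<^sup>2 * a \<le> 0" for s
  proof -
    have C: "(\<lambda>v. \<phi> v + s * \<xi> v) \<in> C" by (intro C_add \<phi>C \<xi>C)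
    have 1: "inner_on X \<phi> (kernel_op X K \<xi>) = inner_on X \<xi> (kernel_op X K \<phi>)"
      using kernel_op_symmetric[OF K, where f = \<phi> and g = \<xi>] by (simp add: inner_on_commute)
    have 2: "inner_on X \<xi> (kernel_op X K \<phi>) = b + \<mu> * inner_on X \<xi> \<phi>"
    proof -
      have "b = inner_on X \<xi> (\<lambda>v. kernel_op X K \<phi> v + (- \<mu>) * \<phi> v)"
        unfolding b_def by (rule arg_cong[where f = "inner_on X \<xi>"]) (simp add: \<xi>_def fun_eq_iff)
      then show ?thesis unfolding inner_on_simps by simp
    qed
    have "q (\<lambda>v. \<phi> v + s * \<xi> v) = \<mu> + s * inner_on X \<phi> (kernel_op X K \<xi>)
        + s * inner_on X \<xi> (kernel_op X K \<phi>) + s\<^sup>2 * q \<xi>"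
      unfolding q_def kernel_op_simps inner_on_simps \<mu>_def by (simp add: power2_eq_square algebra_simps)
    moreover have "inner_on X (\<lambda>v. \<phi> v + s * \<xi> v) (\<lambda>v. \<phi> v + s * \<xi> v) = 1 + 2 * s * inner_on X \<xi> \<phi> + s\<^sup>2 * b"
      unfolding inner_on_simps \<phi>1 b_def inner_on_commute[of X \<phi> \<xi>]
      by (simp add: power2_eq_square algebra_simps)
    ultimately have "\<mu> + 2 * s * (b + \<mu> * inner_on X \<xi> \<phi>) + s\<^sup>2 * q \<xi>
        \<le> \<mu> * (1 + 2 * s * inner_on X \<xi> \<phi> + s\<^sup>2 * b)"
      using le[OF C] 1 2 by simp
    then show ?thesis unfolding a_def by (simp add: algebra_simps)
  qed
  have "b = 0"
  proof (rule ccontr)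
    assume "b \<noteq> 0"
    then have b: "b > 0" using inner_on_self_nonneg[of X \<xi>] by (simp add: b_def)
    \<comment> \<open>Small enough that the quadratic term \<open>s * a\<close> cannot cancel the
      linear gain \<open>2 * b\<close>.\<close>
    define s where "s = b / (1 + \<bar>a\<bar>)"
    have s: "s > 0" using b by (simp add: s_def)
    have "s * (2 * b + s * a) \<le> 0" using quad[of s] by (simp add: power2_eq_square algebra_simps)
    then have "2 * b + s * a \<le> 0" using s by (simp add: mult_le_0_iff)
    moreover have "s * \<bar>a\<bar> \<le> b" using b by (simp add: s_def field_simps)
    moreover have "- (s * a) \<le> s * \<bar>a\<bar>" using s by (metis abs_ge_minus_self abs_mult abs_of_pos)
    ultimately show False using b by linarith
  qed
  then have "\<forall>v\<in>X. \<xi> v = 0" using X by (simp add: b_def inner_on_self_eq_0_iff)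
  then have "kernel_op X K \<phi> = (\<lambda>v. \<mu> * \<phi> v)"
    using C_supp[OF \<phi>C] by (auto simp: \<xi>_def kernel_op_def fun_eq_iff)
  then show ?thesis using \<phi>C \<phi>1 by blast
qed

text \<open>Take an orthonormal set of eigenvectors of greatest cardinality. Its orthogonal
  complement is invariant by symmetry, and a nonzero element there would yield one more
  eigenvector.\<close>

lemma eigenbasis_exists:
  fixes X :: "'a set"
  assumes X: "finite X" and K: "\<And>v w. v \<in> X \<Longrightarrow> w \<in> X \<Longrightarrow> K v w = K w v"
  obtains B e where "eigenbasis X K B e"
proof -
  define OE where "OE B \<longleftrightarrow> orthonormal_on X B \<and> (\<forall>\<phi>\<in>B. \<forall>v. v \<notin> X \<longrightarrow> \<phi> v = 0) \<and>
     (\<forall>\<phi>\<in>B. \<exists>\<mu>. kernel_op X K \<phi> = (\<lambda>v. \<mu> * \<phi> v))" for B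
  have "OE {}" by (simp add: OE_def orthonormal_on_def)
  moreover have "\<forall>B. OE B \<longrightarrow> card B < card X + 1"
    using orthonormal_on_card_le[OF X] by (auto simp: OE_def less_Suc_eq_le)
  ultimately obtain B where B: "OE B" and max: "\<And>B'. OE B' \<Longrightarrow> card B' \<le> card B"
    using ex_has_greatest_nat[of OE "{}" card "card X + 1"] by (metis less_imp_le)
  have on: "orthonormal_on X B" and supp: "\<And>\<phi> v. \<phi> \<in> B \<Longrightarrow> v \<notin> X \<Longrightarrow> \<phi> v = 0"
    and "\<forall>\<phi>\<in>B. \<exists>\<mu>. kernel_op X K \<phi> = (\<lambda>v. \<mu> * \<phi> v)"
    using B by (auto simp: OE_def)
  then obtain e where e: "\<And>\<phi>. \<phi> \<in> B \<Longrightarrow> kernel_op X K \<phi> = (\<lambda>v. e \<phi> * \<phi> v)" by metis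
  have fin: "finite B" using on by (simp add: orthonormal_on_def)
  define C where "C = {\<theta>. (\<forall>v. v \<notin> X \<longrightarrow> \<theta> v = 0) \<and> (\<forall>\<phi>\<in>B. inner_on X \<phi> \<theta> = 0)}"
  have C_0: "\<theta> = (\<lambda>_. 0)" if \<theta>: "\<theta> \<in> C" for \<theta>
  proof (rule ccontr)
    assume ne: "\<theta> \<noteq> (\<lambda>_. 0)"
    have C_closed: "closed C"
    proof -
      have "closed {\<theta> :: 'a \<Rightarrow> real. \<theta> v = 0}" for v
        using closed_vimage[of "{0}" "\<lambda>\<theta> :: 'a \<Rightarrow> real. \<theta> v"] continuous_on_product_coordinates
        by (simp add: vimage_def)
      moreover have "closed {\<theta>. inner_on X \<phi> \<theta> = 0}" for \<phi>
      proof -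
        have "continuous_on UNIV (\<lambda>\<theta>. inner_on X \<phi> \<theta>)"
          unfolding inner_on_def by (intro continuous_intros continuous_on_product_coordinates)
        from closed_vimage[OF _ this, of "{0}"] show ?thesis by (simp add: vimage_def)
      qed
      moreover have "C = (\<Inter>v\<in>-X. {\<theta>. \<theta> v = 0}) \<inter> (\<Inter>\<phi>\<in>B. {\<theta>. inner_on X \<phi> \<theta> = 0})"
        by (auto simp: C_def)
      ultimately show ?thesis by (metis (no_types, lifting) closed_INT closed_Int)
    qed
    have sym: "inner_on X f (kernel_op X K g) = inner_on X (kernel_op X K f) g" for f g
      by (rule kernel_op_symmetric[OF K])
    have C_op: "kernel_op X K \<eta> \<in> C" if "\<eta> \<in> C" for \<eta>
      using that e by (auto simp: C_def inner_on_simps sym) (simp add: kernel_op_def)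
    obtain \<phi> \<mu> where \<phi>: "\<phi> \<in> C" "inner_on X \<phi> \<phi> = 1" "kernel_op X K \<phi> = (\<lambda>v. \<mu> * \<phi> v)"
    proof -
      have "\<exists>\<phi>\<in>C. inner_on X \<phi> \<phi> = 1 \<and> (\<exists>\<mu>. kernel_op X K \<phi> = (\<lambda>v. \<mu> * \<phi> v))"
        using X K _ _ C_op C_closed \<theta> ne
        by (rule kernel_op_eigenvector_exists) (auto simp: C_def inner_on_simps)
      then show thesis using that by blast
    qed
    have orth: "inner_on X \<psi> \<phi> = 0" "inner_on X \<phi> \<psi> = 0" if "\<psi> \<in> B" for \<psi>
      using \<phi>(1) that by (auto simp: C_def inner_on_commute[of X \<phi> \<psi>])
    have "\<phi> \<notin> B" using orth(1)[of \<phi>] \<phi>(2) by auto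
    moreover have "orthonormal_on X (insert \<phi> B)"
      using on \<phi>(2) orth \<open>\<phi> \<notin> B\<close> unfolding orthonormal_on_def by auto
    then have "OE (insert \<phi> B)"
      using B \<phi>(1,3) unfolding OE_def C_def by blast
    ultimately show False using max[of "insert \<phi> B"] fin by simp
  qed
  have compl: "(\<Sum>\<phi>\<in>B. \<phi> n * \<phi> w) = of_bool (n = w)" if n: "n \<in> X" and w: "w \<in> X" for n w
  proof -
    \<comment> \<open>The component of the delta function at \<open>n\<close> orthogonal to
      \<open>B\<close>; that it vanishes is exactly completeness.\<close>
    define \<theta> where "\<theta> v = of_bool (v = n) - (\<Sum>\<phi>\<in>B. \<phi> n * \<phi> v)" for v
    have "inner_on X \<psi> \<theta> = 0" if \<psi>: "\<psi> \<in> B" for \<psi>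
    proof -
      have "inner_on X \<psi> \<theta> = \<psi> n - (\<Sum>\<phi>\<in>B. \<phi> n * inner_on X \<psi> \<phi>)"
        unfolding \<theta>_def by (simp add: inner_on_simps inner_on_sum inner_on_delta[OF X n])
      also have "(\<Sum>\<phi>\<in>B. \<phi> n * inner_on X \<psi> \<phi>) = (\<Sum>\<phi>\<in>B. if \<phi> = \<psi> then \<psi> n else 0)"
        using on \<psi> by (intro sum.cong refl) (auto simp: orthonormal_on_def)
      finally show ?thesis using fin \<psi> by simp
    qed
    moreover have "\<theta> v = 0" if "v \<notin> X" for v
      using that n supp by (auto simp: \<theta>_def intro!: sum.neutral)
    ultimately have "\<theta> \<in> C" by (auto simp: C_def)
    from C_0[OF this] have "\<theta> w = 0" by simp
    then show ?thesis by (auto simp: \<theta>_def)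
  qed
  have "eigenbasis X K B e"
    unfolding eigenbasis_def using on supp e compl by blast
  then show thesis by (rule that)
qed

section \<open>Comparing two potentials\<close>

definition add_diag :: "('a \<Rightarrow> 'a \<Rightarrow> real) \<Rightarrow> ('a \<Rightarrow> real) \<Rightarrow> 'a \<Rightarrow> 'a \<Rightarrow> real" where
  "add_diag A W v w = A v w + of_bool (v = w) * W v"

text \<open>The diagonal entry of f(H) at \<open>n\<close>, that is, the integral of
  \<open>f\<close> against the spectral measure at \<open>n\<close>, written in an
  eigenbasis.\<close>

definition spectral_sum ::
    "('a \<Rightarrow> real) set \<Rightarrow> (('a \<Rightarrow> real) \<Rightarrow> real) \<Rightarrow> (real \<Rightarrow> real) \<Rightarrow> 'a \<Rightarrow> real" where
  "spectral_sum B e f n = (\<Sum>\<phi>\<in>B. f (e \<phi>) * (\<phi> n)\<^sup>2)"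

lemma kernel_op_add_diag:
  assumes "finite X"
  shows "kernel_op X (add_diag A W) f v = kernel_op X A f v + of_bool (v \<in> X) * (W v * f v)"
  using assms
  by (simp add: kernel_op_def add_diag_def distrib_right sum.distrib of_bool_def
      if_distrib[where f = "\<lambda>x. x * _"] cong: if_cong)

lemma eigenbasis_finite: "eigenbasis X K B e \<Longrightarrow> finite B"
  by (simp add: eigenbasis_def orthonormal_on_def)

lemma eigenbasis_inner:
  "eigenbasis X K B e \<Longrightarrow> \<phi> \<in> B \<Longrightarrow> \<psi> \<in> B \<Longrightarrow> inner_on X \<phi> \<psi> = of_bool (\<phi> = \<psi>)"
  by (simp add: eigenbasis_def orthonormal_on_def)

lemma eigenbasis_complete:
  "eigenbasis X K B e \<Longrightarrow> v \<in> X \<Longrightarrow> w \<in> X \<Longrightarrow> (\<Sum>\<phi>\<in>B. \<phi> v * \<phi> w) = of_bool (v = w)"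
  by (simp add: eigenbasis_def)

lemma eigenbasis_sum_squares:
  "eigenbasis X K B e \<Longrightarrow> v \<in> X \<Longrightarrow> (\<Sum>\<phi>\<in>B. (\<phi> v)\<^sup>2) = 1"
  using eigenbasis_complete[of X K B e v v] by (simp add: power2_eq_square)

lemma eigenbasis_norm:
  "eigenbasis X K B e \<Longrightarrow> \<phi> \<in> B \<Longrightarrow> (\<Sum>v\<in>X. (\<phi> v)\<^sup>2) = 1"
  using eigenbasis_inner[of X K B e \<phi> \<phi>] by (simp add: inner_on_def power2_eq_square)

lemma eigenbasis_parseval:
  assumes X: "finite X" and B: "eigenbasis X K B e"
  shows "(\<Sum>\<phi>\<in>B. inner_on X f \<phi> * inner_on X \<phi> g) = inner_on X f g"
proof -
  have "(\<Sum>\<phi>\<in>B. inner_on X f \<phi> * inner_on X \<phi> g)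
      = (\<Sum>\<phi>\<in>B. \<Sum>v\<in>X. \<Sum>w\<in>X. f v * g w * (\<phi> v * \<phi> w))"
    by (simp add: inner_on_def sum_product algebra_simps)
  also have "\<dots> = (\<Sum>v\<in>X. \<Sum>\<phi>\<in>B. \<Sum>w\<in>X. f v * g w * (\<phi> v * \<phi> w))" by (rule sum.swap)
  also have "\<dots> = (\<Sum>v\<in>X. \<Sum>w\<in>X. \<Sum>\<phi>\<in>B. f v * g w * (\<phi> v * \<phi> w))"
    by (intro sum.cong refl sum.swap)
  also have "\<dots> = (\<Sum>v\<in>X. \<Sum>w\<in>X. if w = v then f v * g v else 0)"
  proof (intro sum.cong refl)
    fix v w assume "v \<in> X" "w \<in> X"
    then have "(\<Sum>\<phi>\<in>B. \<phi> v * \<phi> w) = of_bool (v = w)" by (rule eigenbasis_complete[OF B])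
    then show "(\<Sum>\<phi>\<in>B. f v * g w * (\<phi> v * \<phi> w)) = (if w = v then f v * g v else 0)"
      by (simp add: sum_distrib_left[symmetric])
  qed
  also have "\<dots> = inner_on X f g" using X by (simp add: inner_on_def)
  finally show ?thesis .
qed

text \<open>The trace of f(H), computed in the basis of sites and in the eigenbasis.\<close>

lemma sum_spectral_sum:
  assumes "eigenbasis X K B e"
  shows "(\<Sum>n\<in>X. spectral_sum B e f n) = (\<Sum>\<phi>\<in>B. f (e \<phi>))"
proof -
  have "(\<Sum>n\<in>X. spectral_sum B e f n) = (\<Sum>\<phi>\<in>B. \<Sum>n\<in>X. f (e \<phi>) * (\<phi> n)\<^sup>2)"
    unfolding spectral_sum_def by (rule sum.swap)
  also have "\<dots> = (\<Sum>\<phi>\<in>B. f (e \<phi>))"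
    using eigenbasis_norm[OF assms] by (simp add: sum_distrib_left[symmetric])
  finally show ?thesis .
qed

lemma eigenbasis_card:
  assumes "eigenbasis X K B e"
  shows "card B = card X"
proof -
  have "real (card X) = (\<Sum>n\<in>X. spectral_sum B e (\<lambda>_. 1) n)"
    using eigenbasis_sum_squares[OF assms] by (simp add: spectral_sum_def)
  also have "\<dots> = real (card B)" by (subst sum_spectral_sum[OF assms]) simp
  finally show ?thesis by simp
qed

text \<open>The two operators are compared through the squared overlaps of their eigenbases, which
  form a doubly stochastic matrix. This avoids differentiating eigenvalues or eigenvectors, which is
  delicate at degenerate eigenvalues.\<close>

locale two_eigenbases =
  fixes X :: "'a set" and A :: "'a \<Rightarrow> 'a \<Rightarrow> real" and W W' :: "'a \<Rightarrow> real"
    and B B' :: "('a \<Rightarrow> real) set" and e e' :: "('a \<Rightarrow> real) \<Rightarrow> real"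
  assumes fin: "finite X"
    and sym: "\<And>v w. v \<in> X \<Longrightarrow> w \<in> X \<Longrightarrow> A v w = A w v"
    and B: "eigenbasis X (add_diag A W) B e"
    and B': "eigenbasis X (add_diag A W') B' e'"
begin

text \<open>Both sides are the matrix element of the difference of the two operators between
  \<open>\<phi>\<close> and \<open>\<phi>'\<close>; \<open>A\<close> cancels by symmetry.\<close>

lemma overlap_commutator:
  assumes \<phi>: "\<phi> \<in> B" and \<phi>': "\<phi>' \<in> B'"
  shows "(e' \<phi>' - e \<phi>) * inner_on X \<phi> \<phi>' = inner_on X (\<lambda>v. (W' v - W v) * \<phi> v) \<phi>'"
proof -
  have "e \<phi> * inner_on X \<phi> \<phi>' = inner_on X (kernel_op X (add_diag A W) \<phi>) \<phi>'"
    using B \<phi> by (simp add: eigenbasis_def inner_on_simps)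
  also have "\<dots> = inner_on X (kernel_op X A \<phi>) \<phi>' + inner_on X (\<lambda>v. W v * \<phi> v) \<phi>'"
    by (simp add: kernel_op_add_diag[OF fin] inner_on_def algebra_simps sum.distrib)
  finally have 1: "e \<phi> * inner_on X \<phi> \<phi>' = inner_on X (kernel_op X A \<phi>) \<phi>' + inner_on X (\<lambda>v. W v * \<phi> v) \<phi>'" .
  have "e' \<phi>' * inner_on X \<phi> \<phi>' = inner_on X \<phi> (kernel_op X (add_diag A W') \<phi>')"
    using B' \<phi>' by (simp add: eigenbasis_def inner_on_simps)
  also have "\<dots> = inner_on X \<phi> (kernel_op X A \<phi>') + inner_on X (\<lambda>v. W' v * \<phi> v) \<phi>'"
    by (simp add: kernel_op_add_diag[OF fin] inner_on_def algebra_simps sum.distrib)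
  also have "inner_on X \<phi> (kernel_op X A \<phi>') = inner_on X (kernel_op X A \<phi>) \<phi>'"
    by (rule kernel_op_symmetric[OF sym])
  finally show ?thesis using 1
    by (simp add: inner_on_def algebra_simps sum_subtractf)
qed

lemma sum_overlap_right: "\<phi> \<in> B \<Longrightarrow> (\<Sum>\<phi>'\<in>B'. (inner_on X \<phi> \<phi>')\<^sup>2) = 1"
  using eigenbasis_parseval[OF fin B', of \<phi> \<phi>] eigenbasis_inner[OF B, of \<phi> \<phi>]
  by (simp add: power2_eq_square inner_on_commute)

lemma sum_overlap_left: "\<phi>' \<in> B' \<Longrightarrow> (\<Sum>\<phi>\<in>B. (inner_on X \<phi> \<phi>')\<^sup>2) = 1"
  using eigenbasis_parseval[OF fin B, of \<phi>' \<phi>'] eigenbasis_inner[OF B', of \<phi>' \<phi>']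
  by (simp add: power2_eq_square inner_on_commute)

text \<open>The squared Hilbert-Schmidt norm of the diagonal operator \<open>W' - W\<close>,
  computed once with mixed matrix elements between the two eigenbases and once in the basis of
  sites.\<close>

lemma sum_overlap_eigenvalue_diff:
  "(\<Sum>\<phi>\<in>B. \<Sum>\<phi>'\<in>B'. (inner_on X \<phi> \<phi>')\<^sup>2 * (e' \<phi>' - e \<phi>)\<^sup>2) = (\<Sum>v\<in>X. (W' v - W v)\<^sup>2)"
proof -
  define g where "g \<phi> v = (W' v - W v) * \<phi> v" for \<phi> :: "'a \<Rightarrow> real" and v
  have "(\<Sum>\<phi>\<in>B. \<Sum>\<phi>'\<in>B'. (inner_on X \<phi> \<phi>')\<^sup>2 * (e' \<phi>' - e \<phi>)\<^sup>2)
      = (\<Sum>\<phi>\<in>B. \<Sum>\<phi>'\<in>B'. inner_on X (g \<phi>) \<phi>' * inner_on X \<phi>' (g \<phi>))"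
  proof (intro sum.cong refl)
    fix \<phi> \<phi>' assume "\<phi> \<in> B" "\<phi>' \<in> B'"
    from overlap_commutator[OF this]
    have "inner_on X (g \<phi>) \<phi>' = (e' \<phi>' - e \<phi>) * inner_on X \<phi> \<phi>'" by (simp add: g_def[abs_def])
    then show "(inner_on X \<phi> \<phi>')\<^sup>2 * (e' \<phi>' - e \<phi>)\<^sup>2 = inner_on X (g \<phi>) \<phi>' * inner_on X \<phi>' (g \<phi>)"
      by (simp add: power2_eq_square inner_on_commute[of X \<phi>' "g \<phi>"])
  qed
  also have "\<dots> = (\<Sum>\<phi>\<in>B. \<Sum>v\<in>X. (W' v - W v)\<^sup>2 * (\<phi> v)\<^sup>2)"
    unfolding eigenbasis_parseval[OF fin B']
    by (simp add: inner_on_def g_def power2_eq_square algebra_simps)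
  also have "\<dots> = (\<Sum>v\<in>X. \<Sum>\<phi>\<in>B. (W' v - W v)\<^sup>2 * (\<phi> v)\<^sup>2)" by (rule sum.swap)
  also have "\<dots> = (\<Sum>v\<in>X. (W' v - W v)\<^sup>2)"
    using eigenbasis_sum_squares[OF B] by (simp add: sum_distrib_left[symmetric])
  finally show ?thesis .
qed

text \<open>Inserting the doubly stochastic overlaps turns both traces into one double sum over
  pairs of eigenvalues, where the scalar Taylor estimate applies termwise. The error sums to the
  Hilbert-Schmidt norm.\<close>

lemma trace_taylor:
  assumes h: "\<And>x y. \<bar>h y - h x - h' x * (y - x)\<bar> \<le> C * (y - x)\<^sup>2"
  shows "\<bar>(\<Sum>\<phi>'\<in>B'. h (e' \<phi>')) - (\<Sum>\<phi>\<in>B. h (e \<phi>)) - (\<Sum>v\<in>X. (W' v - W v) * spectral_sum B e h' v)\<bar>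
      \<le> C * (\<Sum>v\<in>X. (W' v - W v)\<^sup>2)"
proof -
  let ?S = "\<lambda>\<phi> \<phi>'. (inner_on X \<phi> \<phi>')\<^sup>2"
  have "(\<Sum>\<phi>'\<in>B'. h (e' \<phi>')) = (\<Sum>\<phi>'\<in>B'. \<Sum>\<phi>\<in>B. ?S \<phi> \<phi>' * h (e' \<phi>'))"
    using sum_overlap_left by (simp add: sum_distrib_right[symmetric])
  also have "\<dots> = (\<Sum>\<phi>\<in>B. \<Sum>\<phi>'\<in>B'. ?S \<phi> \<phi>' * h (e' \<phi>'))" by (rule sum.swap)
  finally have 1: "(\<Sum>\<phi>'\<in>B'. h (e' \<phi>')) = (\<Sum>\<phi>\<in>B. \<Sum>\<phi>'\<in>B'. ?S \<phi> \<phi>' * h (e' \<phi>'))" .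
  have 2: "(\<Sum>\<phi>\<in>B. h (e \<phi>)) = (\<Sum>\<phi>\<in>B. \<Sum>\<phi>'\<in>B'. ?S \<phi> \<phi>' * h (e \<phi>))"
    using sum_overlap_right by (simp add: sum_distrib_right[symmetric])
  \<comment> \<open>One overlap times the eigenvalue gap is a matrix element of
    \<open>W' - W\<close>; Parseval in \<open>B'\<close> then collapses the inner sum.\<close>
  have 3: "(\<Sum>v\<in>X. (W' v - W v) * spectral_sum B e h' v)
      = (\<Sum>\<phi>\<in>B. \<Sum>\<phi>'\<in>B'. ?S \<phi> \<phi>' * (h' (e \<phi>) * (e' \<phi>' - e \<phi>)))"
  proof -
    have "(\<Sum>\<phi>\<in>B. \<Sum>\<phi>'\<in>B'. ?S \<phi> \<phi>' * (h' (e \<phi>) * (e' \<phi>' - e \<phi>)))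
        = (\<Sum>\<phi>\<in>B. h' (e \<phi>) * (\<Sum>\<phi>'\<in>B'. inner_on X (\<lambda>v. (W' v - W v) * \<phi> v) \<phi>' * inner_on X \<phi>' \<phi>))"
      unfolding sum_distrib_left
    proof (intro sum.cong refl)
      fix \<phi> \<phi>' assume "\<phi> \<in> B" "\<phi>' \<in> B'"
      from overlap_commutator[OF this, symmetric]
      show "?S \<phi> \<phi>' * (h' (e \<phi>) * (e' \<phi>' - e \<phi>))
          = h' (e \<phi>) * (inner_on X (\<lambda>v. (W' v - W v) * \<phi> v) \<phi>' * inner_on X \<phi>' \<phi>)"
        unfolding inner_on_commute[of X \<phi>' \<phi>]
        by (simp add: power2_eq_square)
    qed
    also have "\<dots> = (\<Sum>\<phi>\<in>B. \<Sum>v\<in>X. (W' v - W v) * (h' (e \<phi>) * (\<phi> v)\<^sup>2))"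
      unfolding eigenbasis_parseval[OF fin B']
      by (simp add: inner_on_def power2_eq_square sum_distrib_left algebra_simps)
    also have "\<dots> = (\<Sum>v\<in>X. (W' v - W v) * spectral_sum B e h' v)"
      unfolding spectral_sum_def sum_distrib_left by (rule sum.swap)
    finally show ?thesis by simp
  qed
  have 4: "(\<Sum>\<phi>'\<in>B'. h (e' \<phi>')) - (\<Sum>\<phi>\<in>B. h (e \<phi>)) - (\<Sum>v\<in>X. (W' v - W v) * spectral_sum B e h' v)
      = (\<Sum>\<phi>\<in>B. \<Sum>\<phi>'\<in>B'. ?S \<phi> \<phi>' * (h (e' \<phi>') - h (e \<phi>) - h' (e \<phi>) * (e' \<phi>' - e \<phi>)))"
    unfolding 1 2 3 sum_subtractf[symmetric] right_diff_distrib ..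
  have "\<bar>(\<Sum>\<phi>\<in>B. \<Sum>\<phi>'\<in>B'. ?S \<phi> \<phi>' * (h (e' \<phi>') - h (e \<phi>) - h' (e \<phi>) * (e' \<phi>' - e \<phi>)))\<bar>
      \<le> (\<Sum>\<phi>\<in>B. \<Sum>\<phi>'\<in>B'. \<bar>?S \<phi> \<phi>' * (h (e' \<phi>') - h (e \<phi>) - h' (e \<phi>) * (e' \<phi>' - e \<phi>))\<bar>)"
    by (rule order.trans[OF sum_abs sum_mono[OF sum_abs]])
  also have "\<dots> \<le> (\<Sum>\<phi>\<in>B. \<Sum>\<phi>'\<in>B'. ?S \<phi> \<phi>' * (C * (e' \<phi>' - e \<phi>)\<^sup>2))"
  proof (intro sum_mono)
    fix \<phi> \<phi>'
    show "\<bar>?S \<phi> \<phi>' * (h (e' \<phi>') - h (e \<phi>) - h' (e \<phi>) * (e' \<phi>' - e \<phi>))\<bar> \<le> ?S \<phi> \<phi>' * (C * (e' \<phi>' - e \<phi>)\<^sup>2)"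
      using mult_left_mono[OF h[of "e' \<phi>'" "e \<phi>"], of "?S \<phi> \<phi>'"] by (simp add: abs_mult)
  qed
  also have "\<dots> = C * (\<Sum>\<phi>\<in>B. \<Sum>\<phi>'\<in>B'. ?S \<phi> \<phi>' * (e' \<phi>' - e \<phi>)\<^sup>2)"
    by (simp only: sum_distrib_left mult.left_commute)
  finally show ?thesis unfolding 4 sum_overlap_eigenvalue_diff .
qed

text \<open>A scalar Lipschitz function is Lipschitz for the Hilbert-Schmidt norm with the same
  constant: the mixed matrix elements of f(H') - f(H) are overlaps times differences of values of
  \<open>f\<close>. Diagonal entries are then controlled by Cauchy-Schwarz.\<close>

lemma sum_spectral_sum_diff_squares:
  assumes f: "\<And>x y. \<bar>f y - f x\<bar> \<le> L * \<bar>y - x\<bar>"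
  shows "(\<Sum>n\<in>X. (spectral_sum B' e' f n - spectral_sum B e f n)\<^sup>2) \<le> L\<^sup>2 * (\<Sum>v\<in>X. (W' v - W v)\<^sup>2)"
proof -
  define c where "c \<phi> \<phi>' = inner_on X \<phi> \<phi>' * (f (e' \<phi>') - f (e \<phi>))" for \<phi> \<phi>'
  \<comment> \<open>\<open>G \<phi>\<close> is f(H') - f(H) applied to \<open>\<phi>\<close>, and
    \<open>c \<phi>\<close> lists its coefficients in \<open>B'\<close>.\<close>
  define G where "G \<phi> n = (\<Sum>\<phi>'\<in>B'. c \<phi> \<phi>' * \<phi>' n)" for \<phi> n
  note \<delta> = inner_on_delta[OF fin]
  have exp: "(\<Sum>\<phi>'\<in>B'. inner_on X \<phi> \<phi>' * \<phi>' n) = \<phi> n" if "n \<in> X" for \<phi> n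
    using eigenbasis_parseval[OF fin B', of \<phi> "\<lambda>v. of_bool (v = n)"] by (simp add: \<delta>[OF that])
  have exp': "(\<Sum>\<phi>\<in>B. inner_on X \<phi> \<phi>' * \<phi> n) = \<phi>' n" if "n \<in> X" for \<phi>' n
    using eigenbasis_parseval[OF fin B, of \<phi>' "\<lambda>v. of_bool (v = n)"]
    by (simp add: \<delta>[OF that] inner_on_commute)
  have diff: "spectral_sum B' e' f n - spectral_sum B e f n = (\<Sum>\<phi>\<in>B. \<phi> n * G \<phi> n)" if n: "n \<in> X" for n
  proof -
    have "spectral_sum B e f n = (\<Sum>\<phi>\<in>B. f (e \<phi>) * \<phi> n * (\<Sum>\<phi>'\<in>B'. inner_on X \<phi> \<phi>' * \<phi>' n))"
      by (simp add: spectral_sum_def exp[OF n] power2_eq_square mult.assoc)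
    moreover have "spectral_sum B' e' f n = (\<Sum>\<phi>'\<in>B'. f (e' \<phi>') * \<phi>' n * (\<Sum>\<phi>\<in>B. inner_on X \<phi> \<phi>' * \<phi> n))"
      by (simp add: spectral_sum_def exp'[OF n] power2_eq_square mult.assoc)
    then have "spectral_sum B' e' f n = (\<Sum>\<phi>\<in>B. \<Sum>\<phi>'\<in>B'. f (e' \<phi>') * \<phi>' n * (inner_on X \<phi> \<phi>' * \<phi> n))"
      unfolding sum_distrib_left by (subst sum.swap)
    moreover have "f (e' \<phi>') * \<phi>' n * (inner_on X \<phi> \<phi>' * \<phi> n) - f (e \<phi>) * \<phi> n * (inner_on X \<phi> \<phi>' * \<phi>' n)
        = \<phi> n * (c \<phi> \<phi>' * \<phi>' n)" for \<phi> \<phi>'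
      by (simp add: c_def algebra_simps)
    ultimately show ?thesis
      unfolding G_def sum_distrib_left by (simp only: sum_subtractf[symmetric])
  qed
  have "(\<Sum>n\<in>X. (spectral_sum B' e' f n - spectral_sum B e f n)\<^sup>2) \<le> (\<Sum>n\<in>X. \<Sum>\<phi>\<in>B. (G \<phi> n)\<^sup>2)"
  proof (rule sum_mono)
    fix n assume n: "n \<in> X"
    have "(\<Sum>\<phi>\<in>B. \<phi> n * G \<phi> n)\<^sup>2 \<le> (\<Sum>\<phi>\<in>B. (\<phi> n)\<^sup>2) * (\<Sum>\<phi>\<in>B. (G \<phi> n)\<^sup>2)"
      by (rule Cauchy_Schwarz_ineq_sum)
    then show "(spectral_sum B' e' f n - spectral_sum B e f n)\<^sup>2 \<le> (\<Sum>\<phi>\<in>B. (G \<phi> n)\<^sup>2)"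
      using eigenbasis_sum_squares[OF B n] by (simp add: diff[OF n])
  qed
  also have "\<dots> = (\<Sum>\<phi>\<in>B. \<Sum>n\<in>X. (G \<phi> n)\<^sup>2)" by (rule sum.swap)
  also have "\<dots> = (\<Sum>\<phi>\<in>B. \<Sum>\<phi>'\<in>B'. (c \<phi> \<phi>')\<^sup>2)"
  proof (intro sum.cong refl)
    fix \<phi> assume "\<phi> \<in> B"
    have "(\<Sum>n\<in>X. (G \<phi> n)\<^sup>2) = inner_on X (G \<phi>) (G \<phi>)" by (simp add: inner_on_def power2_eq_square)
    also have "\<dots> = (\<Sum>\<phi>'\<in>B'. \<Sum>\<psi>'\<in>B'. c \<phi> \<phi>' * (c \<phi> \<psi>' * inner_on X \<phi>' \<psi>'))"
      unfolding G_def by (simp add: inner_on_sum inner_on_simps sum_distrib_left mult.left_commute)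
    also have "\<dots> = (\<Sum>\<phi>'\<in>B'. \<Sum>\<psi>'\<in>B'. if \<psi>' = \<phi>' then (c \<phi> \<phi>')\<^sup>2 else 0)"
      using eigenbasis_inner[OF B'] by (intro sum.cong refl) (auto simp: power2_eq_square)
    also have "\<dots> = (\<Sum>\<phi>'\<in>B'. (c \<phi> \<phi>')\<^sup>2)" using eigenbasis_finite[OF B'] by simp
    finally show "(\<Sum>n\<in>X. (G \<phi> n)\<^sup>2) = (\<Sum>\<phi>'\<in>B'. (c \<phi> \<phi>')\<^sup>2)" .
  qed
  also have "\<dots> \<le> (\<Sum>\<phi>\<in>B. \<Sum>\<phi>'\<in>B'. L\<^sup>2 * ((inner_on X \<phi> \<phi>')\<^sup>2 * (e' \<phi>' - e \<phi>)\<^sup>2))"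
  proof (intro sum_mono)
    fix \<phi> \<phi>'
    have "(f (e' \<phi>') - f (e \<phi>))\<^sup>2 \<le> (L * \<bar>e' \<phi>' - e \<phi>\<bar>)\<^sup>2"
      using power_mono[OF f[of "e' \<phi>'" "e \<phi>"] abs_ge_zero, of 2] by simp
    then have "(f (e' \<phi>') - f (e \<phi>))\<^sup>2 \<le> L\<^sup>2 * (e' \<phi>' - e \<phi>)\<^sup>2" by (simp add: power_mult_distrib)
    then have "(inner_on X \<phi> \<phi>')\<^sup>2 * (f (e' \<phi>') - f (e \<phi>))\<^sup>2 \<le> (inner_on X \<phi> \<phi>')\<^sup>2 * (L\<^sup>2 * (e' \<phi>' - e \<phi>)\<^sup>2)"
      by (rule mult_left_mono) simp
    then show "(c \<phi> \<phi>')\<^sup>2 \<le> L\<^sup>2 * ((inner_on X \<phi> \<phi>')\<^sup>2 * (e' \<phi>' - e \<phi>)\<^sup>2)"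
      unfolding c_def power_mult_distrib by (simp add: mult.left_commute)
  qed
  also have "\<dots> = L\<^sup>2 * (\<Sum>v\<in>X. (W' v - W v)\<^sup>2)"
    unfolding sum_overlap_eigenvalue_diff[symmetric] sum_distrib_left ..
  finally show ?thesis .
qed

end

section \<open>Flattening one test function\<close>

locale symmetric_kernel =
  fixes X :: "'a set" and A :: "'a \<Rightarrow> 'a \<Rightarrow> real"
  assumes fin: "finite X"
    and sym: "\<And>v w. v \<in> X \<Longrightarrow> w \<in> X \<Longrightarrow> A v w = A w v"
begin

text \<open>\<open>modes\<close> and \<open>energy\<close> are components of the same chosen pair,
  so they fit together.\<close>

definition modes :: "('a \<Rightarrow> real) \<Rightarrow> ('a \<Rightarrow> real) set" where
  "modes W = fst (SOME p. eigenbasis X (add_diag A W) (fst p) (snd p))"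

definition energy :: "('a \<Rightarrow> real) \<Rightarrow> ('a \<Rightarrow> real) \<Rightarrow> real" where
  "energy W = snd (SOME p. eigenbasis X (add_diag A W) (fst p) (snd p))"

abbreviation local_sum :: "('a \<Rightarrow> real) \<Rightarrow> (real \<Rightarrow> real) \<Rightarrow> 'a \<Rightarrow> real" where
  "local_sum W \<equiv> spectral_sum (modes W) (energy W)"

lemma eigenbasis_modes: "eigenbasis X (add_diag A W) (modes W) (energy W)"
proof -
  obtain B e where "eigenbasis X (add_diag A W) B e"
  proof (rule eigenbasis_exists[OF fin])
    show "add_diag A W v w = add_diag A W w v" if "v \<in> X" "w \<in> X" for v w
      using sym[OF that] by (auto simp: add_diag_def)
  qed auto
  then have "\<exists>p. eigenbasis X (add_diag A W) (fst p) (snd p)"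
    by (intro exI[of _ "(B, e)"]) simp
  from someI_ex[OF this] show ?thesis unfolding modes_def energy_def .
qed

lemma two_eigenbases_modes:
  "two_eigenbases X A W W' (modes W) (modes W') (energy W) (energy W')"
  using fin sym eigenbasis_modes by unfold_locales auto

text \<open>Chebyshev's inequality for the Hilbert-Schmidt estimate. The bound is a fraction of the
  sites that does not depend on the size of \<open>X\<close>.\<close>

lemma card_local_sum_unstable:
  assumes f: "\<And>x y. \<bar>f y - f x\<bar> \<le> L * \<bar>y - x\<bar>" and a: "a > 0"
    and W: "\<And>v. v \<in> X \<Longrightarrow> \<bar>W' v - W v\<bar> \<le> \<eta>"
  shows "real (card {n\<in>X. \<bar>local_sum W' f n - local_sum W f n\<bar> > a}) * a\<^sup>2 \<le> L\<^sup>2 * \<eta>\<^sup>2 * card X"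
proof -
  let ?S = "{n\<in>X. \<bar>local_sum W' f n - local_sum W f n\<bar> > a}"
  have "real (card ?S) * a\<^sup>2 = (\<Sum>n\<in>?S. a\<^sup>2)" by simp
  also have "\<dots> \<le> (\<Sum>n\<in>?S. (local_sum W' f n - local_sum W f n)\<^sup>2)"
  proof (rule sum_mono)
    fix n assume "n \<in> ?S"
    then have "a \<le> \<bar>local_sum W' f n - local_sum W f n\<bar>" by simp
    from power_mono[OF this, of 2] a show "a\<^sup>2 \<le> (local_sum W' f n - local_sum W f n)\<^sup>2" by simp
  qed
  also have "\<dots> \<le> (\<Sum>n\<in>X. (local_sum W' f n - local_sum W f n)\<^sup>2)"
    using fin by (intro sum_mono2) auto
  also have "\<dots> \<le> L\<^sup>2 * (\<Sum>v\<in>X. (W' v - W v)\<^sup>2)"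
    by (rule two_eigenbases.sum_spectral_sum_diff_squares[OF two_eigenbases_modes f])
  also have "\<dots> \<le> L\<^sup>2 * (\<Sum>v\<in>X. \<eta>\<^sup>2)"
  proof (intro mult_left_mono sum_mono)
    fix v assume "v \<in> X"
    from power_mono[OF W[OF this], of 2] show "(W' v - W v)\<^sup>2 \<le> \<eta>\<^sup>2" by simp
  qed simp
  finally show ?thesis by (simp add: mult_ac)
qed

text \<open>A near-maximiser of \<open>\<Sum> h (energy) - \<rho> \<Sum> (W - V)\<^sup>2\<close> over the cube stays far from the
  boundary at most sites since \<open>h\<close> is tiny, and there the partial derivatives nearly vanish.\<close>

lemma local_sum_derivative_small:
  assumes h: "\<And>x. \<bar>h x\<bar> \<le> \<gamma>\<^sup>2 * \<delta> / 24"
    and taylor: "\<And>x y. \<bar>h y - h x - h' x * (y - x)\<bar> \<le> C * (y - x)\<^sup>2"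
    and \<gamma>: "\<gamma> > 0" and \<delta>: "\<delta> > 0"
  shows "\<exists>W. (\<forall>v\<in>X. \<bar>W v - V v\<bar> \<le> \<delta>) \<and>
    real (card {n\<in>X. \<bar>local_sum W h' n\<bar> > \<gamma>}) \<le> \<gamma> * card X"
proof (cases "X = {}")
  case True
  then show ?thesis by simp
next
  case False
  define M where "M = real (card X)"
  have M: "M \<ge> 1" using False fin card_gt_0_iff[of X] by (simp add: M_def)
  \<comment> \<open>With this \<open>\<rho>\<close> the penalty contributes at most
    \<open>\<gamma> / 2\<close> to a partial derivative at sites moved by at most
    \<open>\<delta> / 2\<close>. The sites moved further number at most
    \<open>12 * \<kappa> * M / (\<rho> * \<delta>\<^sup>2)\<close>, and \<open>\<kappa>\<close>
    makes this equal to \<open>\<gamma> * M\<close>.\<close>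
  define \<kappa> where "\<kappa> = \<gamma>\<^sup>2 * \<delta> / 24"
  define \<rho> where "\<rho> = \<gamma> / (2 * \<delta>)"
  have \<kappa>: "\<kappa> > 0" and \<rho>: "\<rho> > 0" using \<gamma> \<delta> by (simp_all add: \<kappa>_def \<rho>_def)
  have C: "C \<ge> 0" using taylor[of 1 0] by simp
  define Q where "Q = {W. \<forall>v\<in>X. \<bar>W v - V v\<bar> \<le> \<delta>}"
  define T where "T W = (\<Sum>\<phi>\<in>modes W. h (energy W \<phi>))" for W
  define G where "G W = T W - \<rho> * (\<Sum>v\<in>X. (W v - V v)\<^sup>2)" for W
  have T: "\<bar>T W\<bar> \<le> \<kappa> * M" for W
  proof -
    have "\<bar>T W\<bar> \<le> (\<Sum>\<phi>\<in>modes W. \<kappa>)"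
      unfolding T_def \<kappa>_def using h by (intro order.trans[OF sum_abs] sum_mono) auto
    then show ?thesis using eigenbasis_card[OF eigenbasis_modes] by (simp add: M_def mult.commute)
  qed
  have GT: "G W \<le> T W" for W using \<rho> by (simp add: G_def sum_nonneg)
  have bdd: "bdd_above (G ` Q)"
    using GT T by (intro bdd_aboveI2[where M = "\<kappa> * M"]) (meson abs_le_D1 order_trans)
  \<comment> \<open>The length of a trial move at one site: it must keep the site inside the cube,
    its square must be at most \<open>\<kappa>\<close>, and all second-order terms divided by
    \<open>\<tau>\<close> must stay below \<open>\<gamma> / 2\<close>.\<close>
  define \<tau> where "\<tau> = min (min (\<delta> / 2) (sqrt \<kappa>)) (\<gamma> / (2 * (1 + C + \<rho>)))"
  have "\<tau> > 0" using \<delta> \<kappa> \<gamma> C \<rho> by (simp add: \<tau>_def)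
  moreover have "\<tau> \<le> \<delta> / 2" "\<tau> \<le> sqrt \<kappa>" "\<tau> \<le> \<gamma> / (2 * (1 + C + \<rho>))"
    unfolding \<tau>_def by linarith+
  ultimately have \<tau>: "\<tau> > 0" "\<tau> \<le> \<delta> / 2" "\<tau> \<le> sqrt \<kappa>" "\<tau> \<le> \<gamma> / (2 * (1 + C + \<rho>))"
    by auto
  have \<tau>2: "\<tau>\<^sup>2 \<le> \<kappa>" using power_mono[OF \<tau>(3), of 2] \<tau>(1) \<kappa> by simp
  have \<tau>3: "(1 + C + \<rho>) * \<tau> \<le> \<gamma> / 2" using \<tau>(4) C \<rho> by (simp add: field_simps)
  have V: "V \<in> Q" using \<delta> by (simp add: Q_def)
  \<comment> \<open>Maximality up to \<open>\<tau>\<^sup>2\<close>, the order of the other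
    second-order errors, is enough and requires only boundedness of \<open>G\<close>, not its
    continuity.\<close>
  have "\<exists>y\<in>G ` Q. Sup (G ` Q) - \<tau>\<^sup>2 < y"
    using V \<tau>(1) bdd by (intro less_cSupD) auto
  then obtain W where W: "W \<in> Q" and near: "Sup (G ` Q) - \<tau>\<^sup>2 < G W" by blast
  have max: "G W'' \<le> G W + \<tau>\<^sup>2" if "W'' \<in> Q" for W''
    using cSup_upper[OF imageI[OF that] bdd] near by linarith
  have dist: "\<rho> * (\<Sum>v\<in>X. (W v - V v)\<^sup>2) \<le> 3 * \<kappa> * M"
  proof -
    have "G V = T V" by (simp add: G_def)
    then have "T V \<le> T W - \<rho> * (\<Sum>v\<in>X. (W v - V v)\<^sup>2) + \<tau>\<^sup>2" using max[OF V] by (simp add: G_def)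
    moreover have "\<tau>\<^sup>2 \<le> \<kappa> * M" using \<tau>2 M \<kappa> by (metis mult.right_neutral mult_left_mono order_trans less_imp_le)
    ultimately show ?thesis using T[of V] T[of W] by linarith
  qed
  have interior: "\<bar>local_sum W h' n\<bar> \<le> \<gamma>" if n: "n \<in> X" and near_n: "\<bar>W n - V n\<bar> \<le> \<delta> / 2" for n
  proof -
    \<comment> \<open>Moving one site in the direction in which the trace increases: a large
      derivative would gain more than near-maximality allows.\<close>
    define s where "s = (if local_sum W h' n \<ge> 0 then \<tau> else - \<tau>)"
    have s: "\<bar>s\<bar> = \<tau>" "s\<^sup>2 = \<tau>\<^sup>2" "s * local_sum W h' n = \<tau> * \<bar>local_sum W h' n\<bar>"
      using \<tau>(1) by (auto simp: s_def)
    define W' where "W' = W(n := W n + s)"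
    have "\<bar>W n + s - V n\<bar> \<le> \<delta>" using near_n s(1) \<tau>(2) by linarith
    then have "W' \<in> Q" using W by (auto simp: Q_def W'_def)
    then have "G W' \<le> G W + \<tau>\<^sup>2" by (rule max)
    moreover have "G W' = T W' - \<rho> * (\<Sum>v\<in>X. (W v - V v)\<^sup>2) - \<rho> * (2 * s * (W n - V n) + \<tau>\<^sup>2)"
    proof -
      have "(\<Sum>v\<in>X. (W' v - V v)\<^sup>2) - (\<Sum>v\<in>X. (W v - V v)\<^sup>2) = (\<Sum>v\<in>X. if v = n then 2 * s * (W n - V n) + \<tau>\<^sup>2 else 0)"
        unfolding sum_subtractf[symmetric]
        unfolding s(2)[symmetric]
        by (intro sum.cong refl) (auto simp: W'_def power2_eq_square algebra_simps)
      then have "(\<Sum>v\<in>X. (W' v - V v)\<^sup>2) = (\<Sum>v\<in>X. (W v - V v)\<^sup>2) + (2 * s * (W n - V n) + \<tau>\<^sup>2)"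
        using fin n by simp
      then show ?thesis unfolding G_def by (simp add: distrib_left)
    qed
    moreover have "T W + s * local_sum W h' n - C * \<tau>\<^sup>2 \<le> T W'"
    proof -
      have "(\<Sum>v\<in>X. (W' v - W v) * local_sum W h' v) = (\<Sum>v\<in>X. if v = n then s * local_sum W h' n else 0)"
        by (intro sum.cong refl) (auto simp: W'_def)
      also have "\<dots> = s * local_sum W h' n" using fin n by simp
      finally have 1: "(\<Sum>v\<in>X. (W' v - W v) * local_sum W h' v) = s * local_sum W h' n" .
      have "(\<Sum>v\<in>X. (W' v - W v)\<^sup>2) = (\<Sum>v\<in>X. if v = n then \<tau>\<^sup>2 else 0)"
        by (intro sum.cong refl) (auto simp: W'_def s(2))
      also have "\<dots> = \<tau>\<^sup>2" using fin n by simp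
      finally have 2: "(\<Sum>v\<in>X. (W' v - W v)\<^sup>2) = \<tau>\<^sup>2" .
      from two_eigenbases.trace_taylor[OF two_eigenbases_modes taylor, of W' W]
      show ?thesis unfolding 1 2 T_def[symmetric] by linarith
    qed
    moreover have "\<rho> * (2 * s * (W n - V n) + \<tau>\<^sup>2) \<le> \<tau> * \<gamma> / 2 + \<rho> * \<tau>\<^sup>2"
    proof -
      have "s * (W n - V n) \<le> \<tau> * (\<delta> / 2)"
        using mult_left_mono[OF near_n abs_ge_zero[of s]] abs_ge_self[of "s * (W n - V n)"]
        unfolding abs_mult s(1) by linarith
      then have "\<rho> * (2 * (s * (W n - V n))) \<le> \<rho> * (2 * (\<tau> * (\<delta> / 2)))"
        using \<rho> by (intro mult_left_mono) auto
      also have "\<dots> = \<tau> * \<gamma> / 2" using \<delta> by (simp add: \<rho>_def field_simps)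
      finally show ?thesis by (simp add: algebra_simps)
    qed
    ultimately have "\<tau> * \<bar>local_sum W h' n\<bar> \<le> \<tau>\<^sup>2 + C * \<tau>\<^sup>2 + \<rho> * \<tau>\<^sup>2 + \<tau> * \<gamma> / 2"
      unfolding G_def s(3) by linarith
    also have "\<dots> = \<tau> * ((1 + C + \<rho>) * \<tau> + \<gamma> / 2)" by (simp add: power2_eq_square algebra_simps)
    finally have "\<bar>local_sum W h' n\<bar> \<le> (1 + C + \<rho>) * \<tau> + \<gamma> / 2" using \<tau>(1) by simp
    then show ?thesis using \<tau>3 by simp
  qed
  let ?S = "{n\<in>X. \<bar>local_sum W h' n\<bar> > \<gamma>}"
  have "real (card ?S) * (\<delta> / 2)\<^sup>2 = (\<Sum>n\<in>?S. (\<delta> / 2)\<^sup>2)" by simp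
  also have "\<dots> \<le> (\<Sum>n\<in>?S. (W n - V n)\<^sup>2)"
  proof (rule sum_mono)
    fix n assume "n \<in> ?S"
    then have "\<delta> / 2 \<le> \<bar>W n - V n\<bar>" using interior[of n] by force
    from power_mono[OF this, of 2] \<delta> show "(\<delta> / 2)\<^sup>2 \<le> (W n - V n)\<^sup>2" by simp
  qed
  also have "\<dots> \<le> (\<Sum>n\<in>X. (W n - V n)\<^sup>2)" using fin by (intro sum_mono2) auto
  finally have "real (card ?S) * (\<delta> / 2)\<^sup>2 * \<rho> \<le> 3 * \<kappa> * M"
    using dist mult_left_mono[of _ _ \<rho>] \<rho> by (smt (verit) mult.commute)
  then have "real (card ?S) * (\<gamma> * \<delta> / 8) \<le> \<gamma> * M * (\<gamma> * \<delta> / 8)"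
    using \<delta> by (simp add: \<rho>_def \<kappa>_def power2_eq_square field_simps)
  then have "real (card ?S) \<le> \<gamma> * M" using \<gamma> \<delta> by (simp add: mult.commute)
  then show ?thesis using W by (auto simp: Q_def M_def)
qed

end

section \<open>Oscillating functions\<close>

definition bounded_lipschitz :: "(real \<Rightarrow> real) \<Rightarrow> bool" where
  "bounded_lipschitz f \<longleftrightarrow> (\<exists>L\<ge>0. \<forall>x y. \<bar>f x\<bar> \<le> L \<and> \<bar>f y - f x\<bar> \<le> L * \<bar>y - x\<bar>)"

definition C11 :: "(real \<Rightarrow> real) \<Rightarrow> (real \<Rightarrow> real) \<Rightarrow> bool" where
  "C11 f f' \<longleftrightarrow> (\<forall>x. (f has_real_derivative f' x) (at x)) \<and> bounded_lipschitz f \<and> bounded_lipschitz f'"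

lemma bounded_lipschitzE:
  assumes "bounded_lipschitz f"
  obtains L where "L \<ge> 0" "\<And>x. \<bar>f x\<bar> \<le> L" "\<And>x y. \<bar>f y - f x\<bar> \<le> L * \<bar>y - x\<bar>"
  using assms unfolding bounded_lipschitz_def by blast

lemma lipschitz_of_derivative_bound:
  fixes f f' :: "real \<Rightarrow> real"
  assumes d: "\<And>x. (f has_real_derivative f' x) (at x)" and b: "\<And>x. \<bar>f' x\<bar> \<le> L"
  shows "\<bar>f y - f x\<bar> \<le> L * \<bar>y - x\<bar>"
  using field_differentiable_bound[of UNIV f f' L x y] d b by (auto simp: norm_minus_commute abs_minus_commute)

lemma bounded_lipschitz_derivative:
  assumes "\<And>x. (f has_real_derivative f' x) (at x)" "\<And>x. \<bar>f x\<bar> \<le> L" "\<And>x. \<bar>f' x\<bar> \<le> L"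
  shows "bounded_lipschitz f"
proof -
  have "L \<ge> 0" using assms(2)[of 0] by linarith
  then show ?thesis
    using assms(2) lipschitz_of_derivative_bound[OF assms(1,3)] unfolding bounded_lipschitz_def by blast
qed

lemma bounded_lipschitz_const: "bounded_lipschitz (\<lambda>_. c)"
  unfolding bounded_lipschitz_def by (intro exI[of _ "\<bar>c\<bar>"]) auto

lemma bounded_lipschitz_add:
  assumes "bounded_lipschitz f" "bounded_lipschitz g"
  shows "bounded_lipschitz (\<lambda>x. f x + g x)"
proof -
  obtain L where L: "L \<ge> 0" "\<And>x. \<bar>f x\<bar> \<le> L" "\<And>x y. \<bar>f y - f x\<bar> \<le> L * \<bar>y - x\<bar>"
    using assms(1) unfolding bounded_lipschitz_def by blast
  obtain M where M: "M \<ge> 0" "\<And>x. \<bar>g x\<bar> \<le> M" "\<And>x y. \<bar>g y - g x\<bar> \<le> M * \<bar>y - x\<bar>"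
    using assms(2) unfolding bounded_lipschitz_def by blast
  have "\<bar>f x + g x\<bar> \<le> L + M" for x using L(2)[of x] M(2)[of x] by linarith
  moreover have "\<bar>f y + g y - (f x + g x)\<bar> \<le> (L + M) * \<bar>y - x\<bar>" for x y
    using L(3)[of y x] M(3)[of y x] unfolding distrib_right by linarith
  ultimately show ?thesis using L(1) M(1) unfolding bounded_lipschitz_def by (intro exI[of _ "L + M"]) auto
qed

lemma bounded_lipschitz_mult:
  assumes "bounded_lipschitz f" "bounded_lipschitz g"
  shows "bounded_lipschitz (\<lambda>x. f x * g x)"
proof -
  obtain L where L: "L \<ge> 0" "\<And>x. \<bar>f x\<bar> \<le> L" "\<And>x y. \<bar>f y - f x\<bar> \<le> L * \<bar>y - x\<bar>"
    using assms(1) unfolding bounded_lipschitz_def by blast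
  obtain M where M: "M \<ge> 0" "\<And>x. \<bar>g x\<bar> \<le> M" "\<And>x y. \<bar>g y - g x\<bar> \<le> M * \<bar>y - x\<bar>"
    using assms(2) unfolding bounded_lipschitz_def by blast
  have "\<bar>f x * g x\<bar> \<le> 2 * L * M" for x
  proof -
    have "\<bar>f x * g x\<bar> \<le> L * M" unfolding abs_mult using L M by (intro mult_mono) auto
    moreover have "0 \<le> L * M" using L M by simp
    ultimately show ?thesis by linarith
  qed
  moreover have "\<bar>f y * g y - f x * g x\<bar> \<le> 2 * L * M * \<bar>y - x\<bar>" for x y
  proof -
    have "\<bar>f y * g y - f x * g x\<bar> = \<bar>f y * (g y - g x) + (f y - f x) * g x\<bar>" by (simp add: algebra_simps)
    also have "\<dots> \<le> \<bar>f y\<bar> * \<bar>g y - g x\<bar> + \<bar>f y - f x\<bar> * \<bar>g x\<bar>"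
      unfolding abs_mult[symmetric] by (rule abs_triangle_ineq)
    also have "\<dots> \<le> L * (M * \<bar>y - x\<bar>) + (L * \<bar>y - x\<bar>) * M"
      using L M by (intro add_mono mult_mono) auto
    finally show ?thesis by (simp add: algebra_simps)
  qed
  ultimately show ?thesis
    using L(1) M(1) unfolding bounded_lipschitz_def by (intro exI[of _ "2 * L * M"]) auto
qed

lemmas bounded_lipschitz_intros = bounded_lipschitz_const bounded_lipschitz_add bounded_lipschitz_mult

lemma C11_const: "C11 (\<lambda>_. c) (\<lambda>_. 0)"
  by (simp add: C11_def bounded_lipschitz_const)

lemma C11_mult:
  assumes "C11 f f'" "C11 g g'"
  shows "C11 (\<lambda>x. f x * g x) (\<lambda>x. f x * g' x + f' x * g x)"
  using assms by (auto simp: C11_def intro!: bounded_lipschitz_intros derivative_eq_intros)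

lemma C11_affine:
  assumes "C11 f f'"
  shows "C11 (\<lambda>x. a + b * f x) (\<lambda>x. b * f' x)"
  using assms by (auto simp: C11_def intro!: bounded_lipschitz_intros derivative_eq_intros)

text \<open>The mean value inequality for \<open>f z - f' x * z\<close> on the segment from
  \<open>x\<close> to \<open>y\<close>, whose derivative is at most
  \<open>L * \<bar>y - x\<bar>\<close> there.\<close>

lemma C11_taylor:
  assumes "C11 f f'"
  obtains C where "\<And>x y. \<bar>f y - f x - f' x * (y - x)\<bar> \<le> C * (y - x)\<^sup>2"
proof -
  have d: "\<And>x. (f has_real_derivative f' x) (at x)" and "bounded_lipschitz f'"
    using assms by (auto simp: C11_def)
  then obtain L where L: "L \<ge> 0" "\<And>x y. \<bar>f' y - f' x\<bar> \<le> L * \<bar>y - x\<bar>"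
    by (auto elim: bounded_lipschitzE)
  have "\<bar>f y - f x - f' x * (y - x)\<bar> \<le> L * (y - x)\<^sup>2" for x y
  proof -
    define S where "S = closed_segment x y"
    have "norm ((f y - f' x * y) - (f x - f' x * x)) \<le> L * \<bar>y - x\<bar> * norm (y - x)"
    proof (rule field_differentiable_bound[where S = S and f' = "\<lambda>z. f' z - f' x"])
      fix z assume "z \<in> S"
      show "((\<lambda>z. f z - f' x * z) has_field_derivative f' z - f' x) (at z within S)"
        using DERIV_subset[OF d[of z], of S] by (auto intro!: derivative_eq_intros)
      have "\<bar>z - x\<bar> \<le> \<bar>y - x\<bar>"
        using \<open>z \<in> S\<close> by (auto simp: S_def closed_segment_eq_real_ivl split: if_splits)
      then have "L * \<bar>z - x\<bar> \<le> L * \<bar>y - x\<bar>" using L(1) by (rule mult_left_mono)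
      then show "norm (f' z - f' x) \<le> L * \<bar>y - x\<bar>" using L(2)[of z x] by simp
    qed (auto simp: S_def)
    then show ?thesis by (simp add: power2_eq_square algebra_simps abs_mult)
  qed
  then show thesis by (rule that)
qed

text \<open>From \<open>\<bar>sin z - z\<bar> \<le> \<bar>z\<bar> ^ 3 / 6\<close>, since the square
  of \<open>z\<close> is below 3 in this range.\<close>

lemma half_abs_le_abs_sin:
  fixes z :: real
  assumes "\<bar>z\<bar> \<le> pi / 2"
  shows "\<bar>z\<bar> / 2 \<le> \<bar>sin z\<bar>"
proof -
  have "\<bar>sin z - (\<Sum>m<3. sin_coeff m * z ^ m)\<bar> \<le> inverse (fact 3) * \<bar>z\<bar> ^ 3"
    by (rule Maclaurin_sin_bound)
  then have 1: "\<bar>sin z - z\<bar> \<le> \<bar>z\<bar> ^ 3 / 6"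
    by (simp add: sin_coeff_def eval_nat_numeral field_simps)
  have "\<bar>z\<bar> \<le> 16 / 10" using assms pi_approx(2) by simp
  then have "\<bar>z\<bar> * \<bar>z\<bar> \<le> 16 / 10 * (16 / 10)" by (intro mult_mono) auto
  then have "\<bar>z\<bar> * (\<bar>z\<bar> * \<bar>z\<bar>) \<le> \<bar>z\<bar> * 3" by (intro mult_left_mono) auto
  then have "\<bar>z\<bar> ^ 3 \<le> 3 * \<bar>z\<bar>" by (simp add: power3_eq_cube mult_ac)
  then show ?thesis using 1 by linarith
qed

text \<open>For \<open>c = 1\<close> the function arcsin (c sin (\<Omega> x)) / \<Omega> is a
  triangle wave with slopes \<plusminus>1; \<open>c < 1\<close> rounds its corners. The corners
  \<open>P\<close> depend only on \<Omega>, so \<open>m\<close> is available before the tolerance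
  \<tau>.\<close>

lemma C11_oscillation:
  fixes \<kappa> K :: real
  assumes \<kappa>: "\<kappa> > 0"
  shows "\<exists>m::nat. \<forall>\<tau>>0. \<exists>R r r' P. C11 R r \<and> C11 r r' \<and> (\<forall>x. \<bar>R x\<bar> \<le> \<kappa>) \<and> (\<forall>x. \<bar>r x\<bar> \<le> 1) \<and>
    finite P \<and> card P \<le> m \<and> (\<forall>x. \<bar>x\<bar> \<le> K \<and> \<bar>r x\<bar> < 3/5 \<longrightarrow> (\<exists>p\<in>P. \<bar>x - p\<bar> \<le> \<tau>))"
proof -
  \<comment> \<open>The arcsine is bounded by 2 in absolute value, so \<open>R\<close> is bounded by
    \<open>2 / \<Omega> = \<kappa>\<close>.\<close>
  define \<Omega> where "\<Omega> = 2 / \<kappa>"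
  have \<Omega>: "\<Omega> > 0" using \<kappa> by (simp add: \<Omega>_def)
  define J where "J = \<lceil>\<Omega> * K\<rceil> + 2"
  define P where "P = (\<lambda>k::int. (of_int k + 1/2) * pi / \<Omega>) ` {-J..J}"
  have "\<exists>R r r'. C11 R r \<and> C11 r r' \<and> (\<forall>x. \<bar>R x\<bar> \<le> \<kappa>) \<and> (\<forall>x. \<bar>r x\<bar> \<le> 1) \<and>
    (\<forall>x. \<bar>x\<bar> \<le> K \<and> \<bar>r x\<bar> < 3/5 \<longrightarrow> (\<exists>p\<in>P. \<bar>x - p\<bar> \<le> \<tau>))" if \<tau>: "\<tau> > 0" for \<tau>
  proof -
    \<comment> \<open>Near a corner the argument yields
      \<open>4 * (cos (\<Omega> * x))\<^sup>2 \<le> 8 * \<theta>\<close>, which has to be at most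
      \<open>(\<Omega> * \<tau>)\<^sup>2\<close>; the bound 1/2 keeps \<open>c\<close>
      positive.\<close>
    define \<theta> where "\<theta> = min (1/2) (\<Omega>\<^sup>2 * \<tau>\<^sup>2 / 8)"
    have \<theta>: "0 < \<theta>" "\<theta> \<le> 1/2" "8 * \<theta> \<le> (\<Omega> * \<tau>)\<^sup>2"
      using \<Omega> \<tau> by (auto simp: \<theta>_def power_mult_distrib)
    define c where "c = sqrt (1 - \<theta>)"
    have c: "0 < c" "c < 1" and c2: "c\<^sup>2 = 1 - \<theta>" using \<theta> by (simp_all add: c_def)
    define q where "q x = 1 - c\<^sup>2 * (sin (\<Omega> * x))\<^sup>2" for x
    define D where "D x = 1 / sqrt (q x)" for x
    define R where "R x = arcsin (c * sin (\<Omega> * x)) / \<Omega>" for x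
    define r where "r x = c * (cos (\<Omega> * x) * D x)" for x
    define r' where "r' x = c * (cos (\<Omega> * x) * (\<Omega> * c\<^sup>2 * (sin (\<Omega> * x) * (cos (\<Omega> * x) * (D x * (D x * D x)))))
      + (- \<Omega> * sin (\<Omega> * x)) * D x)" for x
    have q: "q x = \<theta> + c\<^sup>2 * (cos (\<Omega> * x))\<^sup>2" "q x = (cos (\<Omega> * x))\<^sup>2 + \<theta> * (sin (\<Omega> * x))\<^sup>2" for x
      unfolding q_def c2 using sin_cos_squared_add[of "\<Omega> * x"] by (simp_all add: algebra_simps sin_squared_eq)
    have q\<theta>: "q x \<ge> \<theta>" for x
      unfolding q(1)[of x] using \<theta> by simp
    have qcos: "q x \<ge> (cos (\<Omega> * x))\<^sup>2" for x
      unfolding q(2)[of x] using \<theta> by simp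
    have qpos: "q x > 0" for x using q\<theta>[of x] \<theta> by linarith
    have D_pos: "D x > 0" for x using qpos by (simp add: D_def)
    have DD: "D x * D x * q x = 1" for x using qpos[of x] by (simp add: D_def)
    have D_le: "D x \<le> 1 / sqrt \<theta>" for x
      unfolding D_def using q\<theta>[of x] \<theta> qpos[of x] by (intro divide_left_mono) auto
    have sc: "bounded_lipschitz (\<lambda>x. sin (\<Omega> * x))" "bounded_lipschitz (\<lambda>x. cos (\<Omega> * x))"
    proof -
      have "\<bar>cos (\<Omega> * x) * \<Omega>\<bar> \<le> \<Omega> + 1" "\<bar>- (sin (\<Omega> * x) * \<Omega>)\<bar> \<le> \<Omega> + 1" "\<bar>sin (\<Omega> * x)\<bar> \<le> \<Omega> + 1"
        "\<bar>cos (\<Omega> * x)\<bar> \<le> \<Omega> + 1" for x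
        using mult_right_mono[OF abs_cos_le_one[of "\<Omega> * x"], of \<Omega>] mult_right_mono[OF abs_sin_le_one[of "\<Omega> * x"], of \<Omega>]
          \<Omega> abs_cos_le_one[of "\<Omega> * x"] abs_sin_le_one[of "\<Omega> * x"]
        unfolding abs_mult abs_minus_cancel abs_of_pos[OF \<Omega>] by linarith+
      note bounds = this
      show "bounded_lipschitz (\<lambda>x. sin (\<Omega> * x))"
        by (rule bounded_lipschitz_derivative[where f' = "\<lambda>x. cos (\<Omega> * x) * \<Omega>" and L = "\<Omega> + 1"])
          (auto intro!: derivative_eq_intros bounds)
      show "bounded_lipschitz (\<lambda>x. cos (\<Omega> * x))"
        by (rule bounded_lipschitz_derivative[where f' = "\<lambda>x. - (sin (\<Omega> * x) * \<Omega>)" and L = "\<Omega> + 1"])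
          (use bounds in \<open>auto intro!: derivative_eq_intros\<close>)
    qed
    define D' where "D' x = \<Omega> * c\<^sup>2 * (sin (\<Omega> * x) * (cos (\<Omega> * x) * (D x * (D x * D x))))" for x
    have D_deriv: "(D has_real_derivative D' x) (at x)" for x
    proof -
      have "((\<lambda>x. 1 / sqrt (1 - c\<^sup>2 * (sin (\<Omega> * x))\<^sup>2)) has_real_derivative
          - ((- (c\<^sup>2 * (2 * sin (\<Omega> * x) * (cos (\<Omega> * x) * \<Omega>)))) * (inverse (sqrt (q x)) / 2)) / (sqrt (q x))\<^sup>2) (at x)"
        using qpos[of x] unfolding q_def
        by (auto intro!: derivative_eq_intros simp: power2_eq_square)
      moreover have "- ((- (c\<^sup>2 * (2 * sin (\<Omega> * x) * (cos (\<Omega> * x) * \<Omega>)))) * (inverse (sqrt (q x)) / 2)) / (sqrt (q x))\<^sup>2 = D' x"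
        by (simp add: D'_def D_def power2_eq_square field_simps)
      ultimately show ?thesis unfolding D_def[abs_def] q_def by simp
    qed
    have D_bl: "bounded_lipschitz D"
    proof (rule bounded_lipschitz_derivative[OF D_deriv])
      let ?L = "1 / sqrt \<theta> + \<Omega> * c\<^sup>2 * (1 / sqrt \<theta> * (1 / sqrt \<theta> * (1 / sqrt \<theta>)))"
      have L: "0 \<le> \<Omega> * c\<^sup>2 * (1 / sqrt \<theta> * (1 / sqrt \<theta> * (1 / sqrt \<theta>)))" "0 \<le> 1 / sqrt \<theta>"
        using \<Omega> c \<theta> by auto
      show "\<bar>D x\<bar> \<le> ?L" for x using D_le[of x] D_pos[of x] L by linarith
      show "\<bar>D' x\<bar> \<le> ?L" for x
      proof -
        have "\<bar>sin (\<Omega> * x)\<bar> * (\<bar>cos (\<Omega> * x)\<bar> * (D x * (D x * D x))) \<le> 1 * (1 * (1 / sqrt \<theta> * (1 / sqrt \<theta> * (1 / sqrt \<theta>))))"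
          using D_le[of x] D_pos[of x] \<theta>(1) by (intro mult_mono) (auto simp: less_imp_le)
        then have "\<Omega> * c\<^sup>2 * (\<bar>sin (\<Omega> * x)\<bar> * (\<bar>cos (\<Omega> * x)\<bar> * (D x * (D x * D x))))
            \<le> \<Omega> * c\<^sup>2 * (1 * (1 * (1 / sqrt \<theta> * (1 / sqrt \<theta> * (1 / sqrt \<theta>)))))"
          by (rule mult_left_mono) (use \<Omega> in simp)
        moreover have "\<bar>D' x\<bar> = \<Omega> * c\<^sup>2 * (\<bar>sin (\<Omega> * x)\<bar> * (\<bar>cos (\<Omega> * x)\<bar> * (D x * (D x * D x))))"
          unfolding D'_def abs_mult using \<Omega> D_pos[of x] by simp
        ultimately have "\<bar>D' x\<bar> \<le> \<Omega> * c\<^sup>2 * (1 / sqrt \<theta> * (1 / sqrt \<theta> * (1 / sqrt \<theta>)))"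
          by simp
        then show ?thesis using L by linarith
      qed
    qed
    have D'_bl: "bounded_lipschitz D'"
      unfolding D'_def by (intro bounded_lipschitz_intros sc D_bl)
    have r_bl: "bounded_lipschitz r" unfolding r_def by (intro bounded_lipschitz_intros sc D_bl)
    have r'_bl: "bounded_lipschitz r'" unfolding r'_def by (intro bounded_lipschitz_intros sc D_bl)
    have r_deriv: "(r has_real_derivative r' x) (at x)" for x
      unfolding r_def[abs_def] r'_def
      by (rule derivative_eq_intros D_deriv refl | simp add: D'_def)+
    have cs: "\<bar>c * sin (\<Omega> * x)\<bar> < 1" for x
    proof -
      have "\<bar>c * sin (\<Omega> * x)\<bar> \<le> c * 1" unfolding abs_mult using c by (intro mult_mono) auto
      then show ?thesis using c by linarith
    qed
    have R_deriv: "(R has_real_derivative r x) (at x)" for x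
    proof -
      have "((\<lambda>x. arcsin (c * sin (\<Omega> * x)) / \<Omega>) has_real_derivative
          inverse (sqrt (1 - (c * sin (\<Omega> * x))\<^sup>2)) * (c * (cos (\<Omega> * x) * \<Omega>)) / \<Omega>) (at x)"
        using cs[of x] \<Omega> by (auto intro!: derivative_eq_intros simp: abs_less_iff)
      moreover have "inverse (sqrt (1 - (c * sin (\<Omega> * x))\<^sup>2)) * (c * (cos (\<Omega> * x) * \<Omega>)) / \<Omega> = r x"
        using \<Omega> by (simp add: r_def D_def q_def power_mult_distrib inverse_eq_divide)
      ultimately show ?thesis unfolding R_def[abs_def] by simp
    qed
    have R_le: "\<bar>R x\<bar> \<le> \<kappa>" for x
    proof -
      have "\<bar>arcsin (c * sin (\<Omega> * x))\<bar> \<le> 2"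
        using arcsin_bounded[of "c * sin (\<Omega> * x)"] cs[of x] pi_less_4 by (auto simp: abs_less_iff abs_le_iff)
      then show ?thesis using \<Omega> \<kappa> by (simp add: R_def \<Omega>_def abs_mult field_simps)
    qed
    \<comment> \<open>Equivalently, the square of \<open>r\<close> is
      \<open>1 - \<theta> / q\<close>: it is far from 1 only where \<open>q\<close> is comparable to
      its least possible size \<theta>, that is, where the cosine is small.\<close>
    have r2: "(r x)\<^sup>2 * q x = q x - \<theta>" for x
    proof -
      have "(r x)\<^sup>2 * q x = c\<^sup>2 * (cos (\<Omega> * x))\<^sup>2 * (D x * D x * q x)"
        by (simp add: r_def power2_eq_square)
      then show ?thesis unfolding DD using q(1)[of x] by linarith
    qed
    have r_le: "\<bar>r x\<bar> \<le> 1" for x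
    proof -
      have "(r x)\<^sup>2 * q x \<le> 1 * q x" using r2[of x] \<theta>(1) by simp
      then have "(r x)\<^sup>2 \<le> 1" using qpos[of x] by (rule mult_right_le_imp_le)
      then show ?thesis by (simp add: abs_square_le_1)
    qed
    have "\<bar>R x\<bar> \<le> \<kappa> + 1" "\<bar>r x\<bar> \<le> \<kappa> + 1" for x using R_le[of x] r_le[of x] \<kappa> by linarith+
    then have R_bl: "bounded_lipschitz R"
      by (rule bounded_lipschitz_derivative[OF R_deriv])
    have near: "\<exists>p\<in>P. \<bar>x - p\<bar> \<le> \<tau>" if x: "\<bar>x\<bar> \<le> K" and rx: "\<bar>r x\<bar> < 3/5" for x
    proof -
      \<comment> \<open>Since 9/25 is below 1/2, this forces
        \<open>q x \<le> 2 * \<theta>\<close>.\<close>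
      have "(r x)\<^sup>2 \<le> (3/5)\<^sup>2" using rx power_mono[of "\<bar>r x\<bar>" "3/5" 2] by simp
      then have "(r x)\<^sup>2 * q x \<le> (1/2) * q x"
        using qpos[of x] by (intro mult_right_mono) (auto simp: power2_eq_square)
      then have "q x \<le> 2 * \<theta>" using r2[of x] by linarith
      then have cos_le: "4 * (cos (\<Omega> * x))\<^sup>2 \<le> (\<Omega> * \<tau>)\<^sup>2" using qcos[of x] \<theta>(3) by linarith
      \<comment> \<open>The point \<open>(k + 1/2) * pi\<close> is the zero of the cosine in the
        half-period containing the phase \<open>\<Omega> * x\<close>, and \<open>z\<close> is the
        phase relative to it.\<close>
      define k where "k = \<lfloor>\<Omega> * x / pi\<rfloor>"
      define z where "z = \<Omega> * x - (of_int k + 1/2) * pi"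
      have "of_int k \<le> \<Omega> * x / pi" "\<Omega> * x / pi < of_int k + 1"
        unfolding k_def by linarith+
      then have k: "of_int k * pi \<le> \<Omega> * x" "\<Omega> * x < (of_int k + 1) * pi"
        by (simp_all add: field_simps)
      then have z: "\<bar>z\<bar> \<le> pi / 2" unfolding z_def distrib_right by linarith
      have "(cos (\<Omega> * x))\<^sup>2 = (sin z)\<^sup>2"
      proof -
        have s0: "sin (of_int k * pi) = 0" using sin_zero_iff_int2 by blast
        then have c1: "(cos (of_int k * pi))\<^sup>2 = 1" using sin_cos_squared_add[of "of_int k * pi"] by simp
        have "\<Omega> * x = z + of_int k * pi + pi / 2" by (simp add: z_def algebra_simps)
        then have "cos (\<Omega> * x) = - sin (z + of_int k * pi)" by (simp add: cos_add)
        also have "\<dots> = - (sin z * cos (of_int k * pi))" by (simp add: sin_add s0)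
        finally show ?thesis by (simp add: power_mult_distrib c1)
      qed
      moreover have "(\<bar>z\<bar> / 2)\<^sup>2 \<le> (sin z)\<^sup>2"
        using power_mono[OF half_abs_le_abs_sin[OF z], of 2] by simp
      ultimately have "z\<^sup>2 \<le> (\<Omega> * \<tau>)\<^sup>2" using cos_le by (simp add: power_divide)
      then have "\<bar>z\<bar> \<le> \<Omega> * \<tau>" using \<Omega> \<tau> by (simp add: power2_le_iff_abs_le)
      then have "\<bar>z\<bar> / \<Omega> \<le> \<tau>" using \<Omega> by (simp add: field_simps)
      moreover have "x - (of_int k + 1/2) * pi / \<Omega> = z / \<Omega>" using \<Omega> by (simp add: z_def field_simps)
      ultimately have "\<bar>x - (of_int k + 1/2) * pi / \<Omega>\<bar> \<le> \<tau>" using \<Omega> by simp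
      moreover have "k \<in> {-J..J}"
      proof -
        have "\<bar>\<Omega> * x / pi\<bar> \<le> \<Omega> * K"
        proof -
          have "\<bar>\<Omega> * x / pi\<bar> = \<Omega> * \<bar>x\<bar> / pi" using \<Omega> by (simp add: abs_mult)
          also have "\<dots> \<le> \<Omega> * K / 1"
            using \<Omega> x pi_ge_two by (intro frac_le mult_left_mono) auto
          finally show ?thesis by simp
        qed
        then have "- (\<Omega> * K) \<le> \<Omega> * x / pi" "\<Omega> * x / pi \<le> \<Omega> * K" by linarith+
        then show ?thesis unfolding k_def J_def atLeastAtMost_iff by linarith
      qed
      ultimately show ?thesis by (auto simp: P_def)
    qed
    have "C11 R r" "C11 r r'"
      using R_deriv R_bl r_bl r_deriv r'_bl by (auto simp: C11_def)
    then show ?thesis using R_le r_le near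
      by (intro exI[of _ R] exI[of _ r] exI[of _ r']) simp
  qed
  note ex = this
  have P: "finite P" by (simp add: P_def)
  show ?thesis
  proof (intro exI[of _ "card P"] allI impI)
    fix \<tau> :: real assume "\<tau> > 0"
    from ex[OF this] obtain R r r' where
      "C11 R r \<and> C11 r r' \<and> (\<forall>x. \<bar>R x\<bar> \<le> \<kappa>) \<and> (\<forall>x. \<bar>r x\<bar> \<le> 1) \<and>
        (\<forall>x. \<bar>x\<bar> \<le> K \<and> \<bar>r x\<bar> < 3/5 \<longrightarrow> (\<exists>p\<in>P. \<bar>x - p\<bar> \<le> \<tau>))"
      by (elim exE)
    then show "\<exists>R r r' P'. C11 R r \<and> C11 r r' \<and> (\<forall>x. \<bar>R x\<bar> \<le> \<kappa>) \<and> (\<forall>x. \<bar>r x\<bar> \<le> 1) \<and>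
        finite P' \<and> card P' \<le> card P \<and> (\<forall>x. \<bar>x\<bar> \<le> K \<and> \<bar>r x\<bar> < 3/5 \<longrightarrow> (\<exists>p\<in>P'. \<bar>x - p\<bar> \<le> \<tau>))"
      using P by (intro exI[of _ R] exI[of _ r] exI[of _ r'] exI[of _ P]) simp
  qed
qed

section \<open>Families with few energies in short intervals\<close>

lemma (in symmetric_kernel) abs_local_sum_le:
  assumes "n \<in> X" "\<And>x. \<bar>f x\<bar> \<le> b"
  shows "\<bar>local_sum W f n\<bar> \<le> b"
proof -
  have "\<bar>local_sum W f n\<bar> \<le> (\<Sum>\<phi>\<in>modes W. b * (\<phi> n)\<^sup>2)"
    unfolding spectral_sum_def
    using assms(2) by (intro order.trans[OF sum_abs] sum_mono) (auto simp: abs_mult intro!: mult_right_mono)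
  then show ?thesis
    using eigenbasis_sum_squares[OF eigenbasis_modes assms(1)] by (simp add: sum_distrib_left[symmetric])
qed

lemma spectral_sum_add:
  "spectral_sum B e (\<lambda>x. f x + g x) n = spectral_sum B e f n + spectral_sum B e g n"
  by (simp add: spectral_sum_def distrib_right sum.distrib)

lemma spectral_sum_cmult:
  "spectral_sum B e (\<lambda>x. c * f x) n = c * spectral_sum B e f n"
  by (simp add: spectral_sum_def sum_distrib_left mult.assoc)

lemma card_le_add3:
  assumes "S \<subseteq> A \<union> B \<union> C" "finite A" "finite B" "finite C"
    "real (card A) \<le> a" "real (card B) \<le> b" "real (card C) \<le> c"
  shows "real (card S) \<le> a + b + c"
proof -
  have "card S \<le> card (A \<union> B \<union> C)" using assms by (intro card_mono) auto
  also have "\<dots> \<le> card A + card B + card C"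
    by (meson add_le_mono card_Un_le le_refl order_trans)
  finally show ?thesis using assms(5-) by linarith
qed

lemma card_le_add2:
  assumes "S \<subseteq> A \<union> B" "finite A" "finite B" "real (card A) \<le> a" "real (card B) \<le> b"
  shows "real (card S) \<le> a + b"
  using card_le_add3[of S A B "{}" a b 0] assms by simp

text \<open>The last assumption says that no short energy interval holds a positive fraction of the
  eigenvalues. One \<tau> serves all large \<open>N\<close>, all admissible \<open>W\<close> and all
  \<open>t\<close>, as the oscillating functions are fixed before the potential.\<close>

locale kernel_family =
  fixes X :: "nat \<Rightarrow> 'a set" and A :: "nat \<Rightarrow> 'a \<Rightarrow> 'a \<Rightarrow> real" and \<Lambda> K :: real
  assumes kernel: "\<And>N. symmetric_kernel (X N) (A N)"
    and energy_bounded: "\<And>N W \<phi>. (\<And>v. v \<in> X N \<Longrightarrow> \<bar>W v\<bar> \<le> \<Lambda>) \<Longrightarrow>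
      \<phi> \<in> symmetric_kernel.modes (X N) (A N) W \<Longrightarrow> \<bar>symmetric_kernel.energy (X N) (A N) W \<phi>\<bar> \<le> K"
    and few_energies_nearby: "\<And>\<zeta> :: real. \<zeta> > 0 \<Longrightarrow> \<exists>\<tau>>0. \<exists>N0. \<forall>N\<ge>N0. \<forall>W t. (\<forall>v\<in>X N. \<bar>W v\<bar> \<le> \<Lambda>) \<longrightarrow>
      real (card {\<phi>\<in>symmetric_kernel.modes (X N) (A N) W.
        \<bar>symmetric_kernel.energy (X N) (A N) W \<phi> - t\<bar> \<le> \<tau>}) \<le> \<zeta> * real (card (X N))"
begin

abbreviation modes :: "nat \<Rightarrow> ('a \<Rightarrow> real) \<Rightarrow> ('a \<Rightarrow> real) set" where
  "modes N \<equiv> symmetric_kernel.modes (X N) (A N)"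

abbreviation energy :: "nat \<Rightarrow> ('a \<Rightarrow> real) \<Rightarrow> ('a \<Rightarrow> real) \<Rightarrow> real" where
  "energy N \<equiv> symmetric_kernel.energy (X N) (A N)"

abbreviation local_sum :: "nat \<Rightarrow> ('a \<Rightarrow> real) \<Rightarrow> (real \<Rightarrow> real) \<Rightarrow> 'a \<Rightarrow> real" where
  "local_sum N W \<equiv> spectral_sum (modes N W) (energy N W)"

abbreviation near :: "nat \<Rightarrow> real \<Rightarrow> ('a \<Rightarrow> real) \<Rightarrow> ('a \<Rightarrow> real) \<Rightarrow> bool" where
  "near N \<delta> V W \<equiv> \<forall>v\<in>X N. \<bar>W v - V v\<bar> \<le> \<delta>"

lemma finite_X [simp]: "finite (X N)"
  using kernel by (simp add: symmetric_kernel_def)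

lemma finite_modes [simp]: "finite (modes N W)"
  by (rule eigenbasis_finite[OF symmetric_kernel.eigenbasis_modes[OF kernel]])

lemma near_trans:
  assumes "near N a V W" "near N b W W'" "a + b \<le> \<delta>"
  shows "near N \<delta> V W'"
proof
  fix v assume "v \<in> X N"
  then have "\<bar>W v - V v\<bar> \<le> a" "\<bar>W' v - W v\<bar> \<le> b" using assms by auto
  then show "\<bar>W' v - V v\<bar> \<le> \<delta>" using assms(3) by linarith
qed

text \<open>Each function receives half of the remaining budget \<open>\<gamma>\<close>. The radius
  \<eta> works for all \<open>N\<close> and all potentials, so it can be fixed before the later,
  finer perturbations are chosen.\<close>

lemma local_sums_stable:
  assumes S: "finite S" "\<And>f. f \<in> S \<Longrightarrow> bounded_lipschitz f" and a: "a > 0" and \<gamma>: "\<gamma> > 0"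
  shows "\<exists>\<eta>>0. \<forall>N W W'. near N \<eta> W W' \<longrightarrow>
    real (card {n\<in>X N. \<exists>f\<in>S. \<bar>local_sum N W' f n - local_sum N W f n\<bar> > a}) \<le> \<gamma> * real (card (X N))"
  using S \<gamma>
proof (induction S arbitrary: \<gamma> rule: finite_induct)
  case empty
  then show ?case by (intro exI[of _ 1]) simp
next
  case (insert f S)
  have "\<gamma> / 2 > 0" using insert.prems by simp
  from insert.IH[OF _ this] insert.prems(1) obtain \<eta>1 where \<eta>1: "\<eta>1 > 0" "\<And>N W W'. near N \<eta>1 W W' \<Longrightarrow>
      real (card {n\<in>X N. \<exists>f\<in>S. \<bar>local_sum N W' f n - local_sum N W f n\<bar> > a}) \<le> \<gamma> / 2 * real (card (X N))"
    by auto
  obtain L where L: "L \<ge> 0" "\<And>x y. \<bar>f y - f x\<bar> \<le> L * \<bar>y - x\<bar>"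
    using insert.prems(1)[of f] by (auto simp: bounded_lipschitz_def)
  \<comment> \<open>Chosen so that the Chebyshev bound for \<open>f\<close> is at most
    \<open>\<gamma> / 2\<close>; the summand 1 guards against \<open>L = 0\<close>.\<close>
  define \<eta>2 where "\<eta>2 = sqrt (\<gamma> / 2) * a / (L + 1)"
  have \<eta>2: "\<eta>2 > 0" using \<open>\<gamma> > 0\<close> a L by (simp add: \<eta>2_def)
  have small: "L\<^sup>2 * \<eta>2\<^sup>2 \<le> \<gamma> / 2 * a\<^sup>2"
  proof -
    have "L * \<eta>2 \<le> sqrt (\<gamma> / 2) * a"
    proof -
      have "L * \<eta>2 \<le> (L + 1) * \<eta>2" using \<eta>2 by (intro mult_right_mono) auto
      also have "\<dots> = sqrt (\<gamma> / 2) * a" using L(1) by (simp add: \<eta>2_def)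
      finally show ?thesis .
    qed
    then have "(L * \<eta>2)\<^sup>2 \<le> (sqrt (\<gamma> / 2) * a)\<^sup>2" using L(1) \<eta>2 by (intro power_mono) auto
    then show ?thesis using \<open>\<gamma> > 0\<close> by (simp add: power_mult_distrib)
  qed
  show ?case
  proof (intro exI[of _ "min \<eta>1 \<eta>2"] conjI allI impI)
    show "min \<eta>1 \<eta>2 > 0" using \<eta>1(1) \<eta>2 by simp
    fix N W W' assume W: "near N (min \<eta>1 \<eta>2) W W'"
    have 1: "real (card {n\<in>X N. \<exists>f\<in>S. \<bar>local_sum N W' f n - local_sum N W f n\<bar> > a}) \<le> \<gamma> / 2 * real (card (X N))"
      using W by (intro \<eta>1(2)) auto
    let ?F = "{n\<in>X N. \<bar>local_sum N W' f n - local_sum N W f n\<bar> > a}"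
    have "real (card ?F) * a\<^sup>2 \<le> L\<^sup>2 * \<eta>2\<^sup>2 * real (card (X N))"
      using symmetric_kernel.card_local_sum_unstable[OF kernel L(2) a, of N W' W \<eta>2] W by auto
    also have "\<dots> \<le> \<gamma> / 2 * a\<^sup>2 * real (card (X N))" using small by (intro mult_right_mono) auto
    finally have "real (card ?F) * a\<^sup>2 \<le> (\<gamma> / 2 * real (card (X N))) * a\<^sup>2" by (simp add: mult_ac)
    then have 2: "real (card ?F) \<le> \<gamma> / 2 * real (card (X N))"
      by (rule mult_right_le_imp_le) (use a in simp)
    have "real (card {n\<in>X N. \<exists>f\<in>insert f S. \<bar>local_sum N W' f n - local_sum N W f n\<bar> > a})
        \<le> \<gamma> / 2 * real (card (X N)) + \<gamma> / 2 * real (card (X N))"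
      by (rule card_le_add2[OF _ _ _ 1 2]) auto
    then show "real (card {n\<in>X N. \<exists>f\<in>insert f S. \<bar>local_sum N W' f n - local_sum N W f n\<bar> > a}) \<le> \<gamma> * real (card (X N))"
      by simp
  qed
qed

section \<open>Splitting windows\<close>

definition oscillating :: "(real \<Rightarrow> real) \<Rightarrow> bool" where
  "oscillating r \<longleftrightarrow> (\<exists>r'. C11 r r') \<and> (\<forall>x. \<bar>r x\<bar> \<le> 1)"

definition window :: "(real \<Rightarrow> real) \<Rightarrow> bool" where
  "window u \<longleftrightarrow> (\<exists>u'. C11 u u') \<and> (\<forall>x. 0 \<le> u x \<and> u x \<le> 1)"

text \<open>The derivative of \<open>u * R\<close> is \<open>u * r + u' * R\<close>, and its last
  term is negligible because \<open>R\<close> is small. The choices run \<kappa>, \<open>m\<close>,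
  \<zeta>, \<tau> and only then \<open>r\<close>, all before \<open>N\<close> and the
  potential.\<close>

lemma split_window:
  assumes u: "window u" and \<delta>: "\<delta> > 0" and \<gamma>: "\<gamma> > 0"
  shows "\<exists>r N0. oscillating r \<and> (\<forall>N\<ge>N0.
    (\<forall>W. (\<forall>v\<in>X N. \<bar>W v\<bar> \<le> \<Lambda>) \<longrightarrow> real (card {\<phi>\<in>modes N W. \<bar>r (energy N W \<phi>)\<bar> < 3/5}) \<le> \<gamma> * real (card (X N))) \<and>
    (\<forall>V. \<exists>W. near N \<delta> V W \<and> real (card {n\<in>X N. \<bar>local_sum N W (\<lambda>x. u x * r x) n\<bar> > \<gamma>}) \<le> \<gamma> * real (card (X N))))"
proof -
  obtain u' where u': "C11 u u'" and u01: "\<And>x. 0 \<le> u x" "\<And>x. u x \<le> 1"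
    using u by (auto simp: window_def)
  obtain b where b: "b \<ge> 0" "\<And>x. \<bar>u' x\<bar> \<le> b"
    using u' by (auto simp: C11_def bounded_lipschitz_def)
  \<comment> \<open>The first bound feeds the near-maximiser argument with
    \<open>\<gamma> / 2\<close>, the second makes \<open>u' * R\<close> at most
    \<open>\<gamma> / 2\<close>.\<close>
  define \<kappa> where "\<kappa> = min ((\<gamma> / 2)\<^sup>2 * \<delta> / 24) (\<gamma> / 2 / (b + 1))"
  have \<kappa>: "\<kappa> > 0" using \<gamma> \<delta> b by (simp add: \<kappa>_def)
  have \<kappa>1: "\<kappa> \<le> (\<gamma> / 2)\<^sup>2 * \<delta> / 24" and "\<kappa> \<le> \<gamma> / 2 / (b + 1)"
    unfolding \<kappa>_def by linarith+
  then have \<kappa>2: "b * \<kappa> \<le> \<gamma> / 2" using b(1) \<kappa> by (simp add: field_simps)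
  obtain m where m: "\<And>\<tau>. \<tau> > 0 \<Longrightarrow> \<exists>R r r' P. C11 R r \<and> C11 r r' \<and> (\<forall>x. \<bar>R x\<bar> \<le> \<kappa>) \<and> (\<forall>x. \<bar>r x\<bar> \<le> 1) \<and>
    finite P \<and> card P \<le> m \<and> (\<forall>x. \<bar>x\<bar> \<le> K \<and> \<bar>r x\<bar> < 3/5 \<longrightarrow> (\<exists>p\<in>P. \<bar>x - p\<bar> \<le> \<tau>))"
    using C11_oscillation[OF \<kappa>, of K] by blast
  \<comment> \<open>The budget of one interval: at most \<open>m\<close> of them must be covered
    within \<gamma>.\<close>
  define \<zeta> where "\<zeta> = \<gamma> / (real m + 1)"
  have \<zeta>: "\<zeta> > 0" "real m * \<zeta> \<le> \<gamma>" using \<gamma> by (simp_all add: \<zeta>_def field_simps)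
  obtain \<tau> N0 where \<tau>: "\<tau> > 0" and few: "\<And>N W t. N \<ge> N0 \<Longrightarrow> (\<forall>v\<in>X N. \<bar>W v\<bar> \<le> \<Lambda>) \<Longrightarrow>
      real (card {\<phi>\<in>modes N W. \<bar>energy N W \<phi> - t\<bar> \<le> \<tau>}) \<le> \<zeta> * real (card (X N))"
    using few_energies_nearby[OF \<zeta>(1)] by blast
  obtain R r r' P where R: "C11 R r" "\<And>x. \<bar>R x\<bar> \<le> \<kappa>" and r: "C11 r r'" "\<And>x. \<bar>r x\<bar> \<le> 1"
    and P: "finite P" "card P \<le> m" "\<And>x. \<bar>x\<bar> \<le> K \<Longrightarrow> \<bar>r x\<bar> < 3/5 \<Longrightarrow> \<exists>p\<in>P. \<bar>x - p\<bar> \<le> \<tau>"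
    using m[OF \<tau>] by blast
  have osc: "oscillating r" using r by (auto simp: oscillating_def)
  have 1: "real (card {\<phi>\<in>modes N W. \<bar>r (energy N W \<phi>)\<bar> < 3/5}) \<le> \<gamma> * real (card (X N))"
    if N: "N \<ge> N0" and W: "\<forall>v\<in>X N. \<bar>W v\<bar> \<le> \<Lambda>" for N W
  proof -
    have "{\<phi>\<in>modes N W. \<bar>r (energy N W \<phi>)\<bar> < 3/5} \<subseteq> (\<Union>p\<in>P. {\<phi>\<in>modes N W. \<bar>energy N W \<phi> - p\<bar> \<le> \<tau>})"
      using P(3) energy_bounded[of N W] W by blast
    then have "card {\<phi>\<in>modes N W. \<bar>r (energy N W \<phi>)\<bar> < 3/5} \<le> (\<Sum>p\<in>P. card {\<phi>\<in>modes N W. \<bar>energy N W \<phi> - p\<bar> \<le> \<tau>})"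
      using P(1) by (intro order.trans[OF card_mono card_UN_le]) auto
    then have "real (card {\<phi>\<in>modes N W. \<bar>r (energy N W \<phi>)\<bar> < 3/5}) \<le> (\<Sum>p\<in>P. real (card {\<phi>\<in>modes N W. \<bar>energy N W \<phi> - p\<bar> \<le> \<tau>}))"
      unfolding of_nat_sum[symmetric] by (rule of_nat_mono)
    also have "\<dots> \<le> (\<Sum>p\<in>P. \<zeta> * real (card (X N)))"
      by (intro sum_mono few N W)
    also have "\<dots> \<le> real m * \<zeta> * real (card (X N))"
      using P(2) \<zeta>(1) by (simp add: mult_right_mono mult.assoc)
    also have "\<dots> \<le> \<gamma> * real (card (X N))" using \<zeta>(2) by (intro mult_right_mono) auto
    finally show ?thesis .
  qed
  have 2: "\<exists>W. near N \<delta> V W \<and> real (card {n\<in>X N. \<bar>local_sum N W (\<lambda>x. u x * r x) n\<bar> > \<gamma>}) \<le> \<gamma> * real (card (X N))" for N V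
  proof -
    have h: "C11 (\<lambda>x. u x * R x) (\<lambda>x. u x * r x + u' x * R x)" by (rule C11_mult[OF u' R(1)])
    obtain C where C: "\<And>x y. \<bar>u y * R y - u x * R x - (u x * r x + u' x * R x) * (y - x)\<bar> \<le> C * (y - x)\<^sup>2"
      using C11_taylor[OF h] by blast
    have "\<bar>u x * R x\<bar> \<le> (\<gamma> / 2)\<^sup>2 * \<delta> / 24" for x
    proof -
      have "\<bar>u x * R x\<bar> \<le> 1 * \<kappa>" unfolding abs_mult using u01[of x] R(2)[of x] by (intro mult_mono) auto
      then show ?thesis using \<kappa>1 by linarith
    qed
    from symmetric_kernel.local_sum_derivative_small[OF kernel this C _ \<delta>, of N V] \<gamma>
    obtain W where W: "near N \<delta> V W"
      and bad: "real (card {n\<in>X N. \<bar>local_sum N W (\<lambda>x. u x * r x + u' x * R x) n\<bar> > \<gamma> / 2}) \<le> \<gamma> / 2 * real (card (X N))"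
      by auto
    have u'R: "\<bar>u' x * R x\<bar> \<le> \<gamma> / 2" for x
    proof -
      have "\<bar>u' x * R x\<bar> \<le> b * \<kappa>" unfolding abs_mult using b R(2)[of x] by (intro mult_mono) auto
      then show ?thesis using \<kappa>2 by linarith
    qed
    have "{n\<in>X N. \<bar>local_sum N W (\<lambda>x. u x * r x) n\<bar> > \<gamma>}
        \<subseteq> {n\<in>X N. \<bar>local_sum N W (\<lambda>x. u x * r x + u' x * R x) n\<bar> > \<gamma> / 2}"
    proof clarify
      fix n assume n: "n \<in> X N" and *: "\<bar>local_sum N W (\<lambda>x. u x * r x) n\<bar> > \<gamma>"
      have "\<bar>local_sum N W (\<lambda>x. u' x * R x) n\<bar> \<le> \<gamma> / 2"
        by (rule symmetric_kernel.abs_local_sum_le[OF kernel n u'R])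
      then show "\<bar>local_sum N W (\<lambda>x. u x * r x + u' x * R x) n\<bar> > \<gamma> / 2"
        unfolding spectral_sum_add using * by linarith
    qed
    then have "card {n\<in>X N. \<bar>local_sum N W (\<lambda>x. u x * r x) n\<bar> > \<gamma>}
        \<le> card {n\<in>X N. \<bar>local_sum N W (\<lambda>x. u x * r x + u' x * R x) n\<bar> > \<gamma> / 2}"
      by (intro card_mono) auto
    moreover have "\<gamma> / 2 * real (card (X N)) \<le> \<gamma> * real (card (X N))" using \<gamma> by (intro mult_right_mono) auto
    ultimately show ?thesis using W bad by (intro exI[of _ W]) linarith
  qed
  show ?thesis using osc 1 2 by blast
qed

text \<open>The potential is first adjusted for \<open>S\<close>, then for \<open>u\<close> by a
  move so small that the splittings of \<open>S\<close> survive. The function for \<open>u\<close>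
  is therefore chosen after those for \<open>S\<close>, with an allowed move
  \<open>\<delta>'\<close> below their stability radius.\<close>

lemma split_windows:
  assumes S: "finite S" "\<And>u. u \<in> S \<Longrightarrow> window u" and \<delta>: "\<delta> > 0" and \<gamma>: "\<gamma> > 0"
  shows "\<exists>r N0. (\<forall>u\<in>S. oscillating (r u)) \<and> (\<forall>N\<ge>N0.
    (\<forall>W. (\<forall>v\<in>X N. \<bar>W v\<bar> \<le> \<Lambda>) \<longrightarrow>
      real (card {\<phi>\<in>modes N W. \<exists>u\<in>S. \<bar>r u (energy N W \<phi>)\<bar> < 3/5}) \<le> \<gamma> * real (card (X N))) \<and>
    (\<forall>V. \<exists>W. near N \<delta> V W \<and>
      real (card {n\<in>X N. \<exists>u\<in>S. \<bar>local_sum N W (\<lambda>x. u x * r u x) n\<bar> > \<gamma>}) \<le> \<gamma> * real (card (X N))))"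
  using S \<delta> \<gamma>
proof (induction S arbitrary: \<delta> \<gamma> rule: finite_induct)
  case empty
  show ?case
  proof (intro exI conjI allI impI)
    fix N :: nat and V :: "'a \<Rightarrow> real"
    show "near N \<delta> V V" using empty by simp
  qed (use empty in auto)
next
  case (insert u S)
  have "\<delta> / 2 > 0" "\<gamma> / 2 > 0" using insert.prems by auto
  moreover have "\<And>w. w \<in> S \<Longrightarrow> window w" using insert.prems by auto
  ultimately obtain r N1 where osc: "\<And>w. w \<in> S \<Longrightarrow> oscillating (r w)"
    and r1: "\<And>N W. N \<ge> N1 \<Longrightarrow> (\<forall>v\<in>X N. \<bar>W v\<bar> \<le> \<Lambda>) \<Longrightarrow>
      real (card {\<phi>\<in>modes N W. \<exists>w\<in>S. \<bar>r w (energy N W \<phi>)\<bar> < 3/5}) \<le> \<gamma> / 2 * real (card (X N))"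
    and r2: "\<And>N V. N \<ge> N1 \<Longrightarrow> \<exists>W. near N (\<delta> / 2) V W \<and>
      real (card {n\<in>X N. \<exists>w\<in>S. \<bar>local_sum N W (\<lambda>x. w x * r w x) n\<bar> > \<gamma> / 2}) \<le> \<gamma> / 2 * real (card (X N))"
    using insert.IH[of "\<delta> / 2" "\<gamma> / 2"] by blast
  define F where "F = (\<lambda>w x. w x * r w x) ` S"
  have F: "finite F" "\<And>f. f \<in> F \<Longrightarrow> bounded_lipschitz f"
    using insert.hyps(1) insert.prems(1) osc
    by (auto simp: F_def oscillating_def window_def C11_def intro!: bounded_lipschitz_mult)
  have \<gamma>4: "\<gamma> / 4 > 0" "\<gamma> / 2 > 0" using insert.prems by auto
  obtain \<eta> where \<eta>: "\<eta> > 0" and stable: "\<And>N W W'. near N \<eta> W W' \<Longrightarrow>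
      real (card {n\<in>X N. \<exists>f\<in>F. \<bar>local_sum N W' f n - local_sum N W f n\<bar> > \<gamma> / 2}) \<le> \<gamma> / 4 * real (card (X N))"
    using local_sums_stable[OF F \<gamma>4(2,1)] by blast
  define \<delta>' where "\<delta>' = min (\<delta> / 2) \<eta>"
  have \<delta>': "\<delta>' > 0" "\<delta>' \<le> \<eta>" "\<delta>' \<le> \<delta> / 2" using \<eta> insert.prems(2) by (auto simp: \<delta>'_def)
  have "window u" using insert.prems by auto
  from split_window[OF this \<delta>'(1) \<gamma>4(1)]
  obtain s N2 where s: "oscillating s"
    and s1: "\<And>N W. N \<ge> N2 \<Longrightarrow> (\<forall>v\<in>X N. \<bar>W v\<bar> \<le> \<Lambda>) \<Longrightarrow>
      real (card {\<phi>\<in>modes N W. \<bar>s (energy N W \<phi>)\<bar> < 3/5}) \<le> \<gamma> / 4 * real (card (X N))"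
    and s2: "\<And>N V. N \<ge> N2 \<Longrightarrow> \<exists>W. near N \<delta>' V W \<and>
      real (card {n\<in>X N. \<bar>local_sum N W (\<lambda>x. u x * s x) n\<bar> > \<gamma> / 4}) \<le> \<gamma> / 4 * real (card (X N))"
    by blast
  define r' where "r' = r(u := s)"
  have r': "r' u = s" "\<And>w. w \<in> S \<Longrightarrow> r' w = r w" using insert.hyps(2) by (auto simp: r'_def)
  have 1: "real (card {\<phi>\<in>modes N W. \<exists>w\<in>insert u S. \<bar>r' w (energy N W \<phi>)\<bar> < 3/5}) \<le> \<gamma> * real (card (X N))"
    if N: "N \<ge> max N1 N2" and W: "\<forall>v\<in>X N. \<bar>W v\<bar> \<le> \<Lambda>" for N W
  proof -
    have "real (card {\<phi>\<in>modes N W. \<exists>w\<in>insert u S. \<bar>r' w (energy N W \<phi>)\<bar> < 3/5})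
        \<le> \<gamma> / 2 * real (card (X N)) + \<gamma> / 4 * real (card (X N))"
      using N by (intro card_le_add2[OF _ _ _ r1[OF _ W] s1[OF _ W]]) (auto simp: r')
    moreover have "0 \<le> \<gamma> / 4 * real (card (X N))" using \<gamma>4 by auto
    ultimately show ?thesis by linarith
  qed
  have 2: "\<exists>W. near N \<delta> V W \<and>
      real (card {n\<in>X N. \<exists>w\<in>insert u S. \<bar>local_sum N W (\<lambda>x. w x * r' w x) n\<bar> > \<gamma>}) \<le> \<gamma> * real (card (X N))"
    if N: "N \<ge> max N1 N2" for N V
  proof -
    obtain W1 where W1: "near N (\<delta> / 2) V W1"
      and bad1: "real (card {n\<in>X N. \<exists>w\<in>S. \<bar>local_sum N W1 (\<lambda>x. w x * r w x) n\<bar> > \<gamma> / 2}) \<le> \<gamma> / 2 * real (card (X N))"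
      using r2[of N V] N by auto
    obtain W2 where W2: "near N \<delta>' W1 W2"
      and bad2: "real (card {n\<in>X N. \<bar>local_sum N W2 (\<lambda>x. u x * s x) n\<bar> > \<gamma> / 4}) \<le> \<gamma> / 4 * real (card (X N))"
      using s2[of N W1] N by auto
    have "near N \<eta> W1 W2" using W2 \<delta>'(2) by fastforce
    from stable[OF this]
    have bad3: "real (card {n\<in>X N. \<exists>f\<in>F. \<bar>local_sum N W2 f n - local_sum N W1 f n\<bar> > \<gamma> / 2}) \<le> \<gamma> / 4 * real (card (X N))" .
    have "{n\<in>X N. \<exists>w\<in>insert u S. \<bar>local_sum N W2 (\<lambda>x. w x * r' w x) n\<bar> > \<gamma>}
      \<subseteq> {n\<in>X N. \<exists>w\<in>S. \<bar>local_sum N W1 (\<lambda>x. w x * r w x) n\<bar> > \<gamma> / 2}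
        \<union> {n\<in>X N. \<bar>local_sum N W2 (\<lambda>x. u x * s x) n\<bar> > \<gamma> / 4}
        \<union> {n\<in>X N. \<exists>f\<in>F. \<bar>local_sum N W2 f n - local_sum N W1 f n\<bar> > \<gamma> / 2}" (is "?L \<subseteq> ?A \<union> ?B \<union> ?C")
    proof
      fix n assume "n \<in> ?L"
      then obtain w where n: "n \<in> X N" and w: "w \<in> insert u S"
        and big: "\<bar>local_sum N W2 (\<lambda>x. w x * r' w x) n\<bar> > \<gamma>" by auto
      show "n \<in> ?A \<union> ?B \<union> ?C"
      proof (cases "w = u")
        case True
        then show ?thesis using n big \<gamma>4 by (simp add: r')
      next
        case False
        then have wS: "w \<in> S" using w by simp
        then have wF: "(\<lambda>x. w x * r w x) \<in> F" by (auto simp: F_def)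
        from big have "\<bar>local_sum N W2 (\<lambda>x. w x * r w x) n\<bar> > \<gamma>" by (simp add: r'(2)[OF wS])
        then have "\<bar>local_sum N W1 (\<lambda>x. w x * r w x) n\<bar> > \<gamma> / 2 \<or>
            \<bar>local_sum N W2 (\<lambda>x. w x * r w x) n - local_sum N W1 (\<lambda>x. w x * r w x) n\<bar> > \<gamma> / 2"
          by linarith
        then show ?thesis using n wS wF by blast
      qed
    qed
    then have "real (card ?L) \<le> \<gamma> / 2 * real (card (X N)) + \<gamma> / 4 * real (card (X N)) + \<gamma> / 4 * real (card (X N))"
      by (rule card_le_add3[OF _ _ _ _ bad1 bad2 bad3]) auto
    moreover have "near N \<delta> V W2" by (rule near_trans[OF W1 W2]) (use \<delta>' in auto)
    ultimately show ?thesis by (intro exI[of _ W2]) (simp add: field_simps)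
  qed
  have "\<forall>w\<in>insert u S. oscillating (r' w)" using osc s r' by auto
  then show ?case using 1 2 by (intro exI[of _ r'] exI[of _ "max N1 N2"]) blast
qed

text \<open>\<open>S\<close> acts as a soft partition of the energy axis: most energies \<open>t\<close> are detected by some
  \<open>u \<in> S\<close> in the sense \<open>\<rho> \<le> u t\<close>, while at most sites no \<open>u \<in> S\<close> carries mass above \<open>x\<close>.\<close>

definition spreadable :: "real \<Rightarrow> real \<Rightarrow> bool" where
  "spreadable x \<rho> \<longleftrightarrow> (\<forall>\<delta>>0. \<forall>\<gamma>>0. \<exists>S N0. finite S \<and> (\<forall>u\<in>S. window u) \<and> (\<forall>N\<ge>N0.
    (\<forall>W. (\<forall>v\<in>X N. \<bar>W v\<bar> \<le> \<Lambda>) \<longrightarrow>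
      real (card {\<phi>\<in>modes N W. \<forall>u\<in>S. u (energy N W \<phi>) < \<rho>}) \<le> \<gamma> * real (card (X N))) \<and>
    (\<forall>V. \<exists>W. near N \<delta> V W \<and>
      real (card {n\<in>X N. \<exists>u\<in>S. local_sum N W u n > x}) \<le> \<gamma> * real (card (X N)))))"

text \<open>The single window 1 detects every energy, and each spectral measure has total mass
  1.\<close>

lemma spreadable_1: "spreadable 1 1"
  unfolding spreadable_def
proof (intro allI impI)
  fix \<delta> \<gamma> :: real assume pos: "\<delta> > 0" "\<gamma> > 0"
  have win: "window (\<lambda>_. 1)" using C11_const by (auto simp: window_def)
  have no: "\<not> local_sum N W (\<lambda>_. 1) n > 1" if "n \<in> X N" for N W n
    using symmetric_kernel.abs_local_sum_le[OF kernel that, of "\<lambda>_. 1" 1 W] by simp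
  have "{n\<in>X N. \<exists>u\<in>{\<lambda>_. 1}. local_sum N V u n > 1} = {}" for N V using no by auto
  then have "\<exists>W. near N \<delta> V W \<and>
      real (card {n\<in>X N. \<exists>u\<in>{\<lambda>_. 1}. local_sum N W u n > 1}) \<le> \<gamma> * real (card (X N))" for N V
    using pos by (intro exI[of _ V]) (simp del: Collect_empty_eq)
  moreover have "real (card {\<phi>\<in>modes N W. \<forall>u\<in>{\<lambda>_. 1 :: real}. u (energy N W \<phi>) < 1}) \<le> \<gamma> * real (card (X N))" for N W
    using pos by simp
  ultimately show "\<exists>S N0. finite S \<and> (\<forall>u\<in>S. window u) \<and> (\<forall>N\<ge>N0.
    (\<forall>W. (\<forall>v\<in>X N. \<bar>W v\<bar> \<le> \<Lambda>) \<longrightarrow>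
      real (card {\<phi>\<in>modes N W. \<forall>u\<in>S. u (energy N W \<phi>) < 1}) \<le> \<gamma> * real (card (X N))) \<and>
    (\<forall>V. \<exists>W. near N \<delta> V W \<and>
      real (card {n\<in>X N. \<exists>u\<in>S. local_sum N W u n > 1}) \<le> \<gamma> * real (card (X N))))"
    using win by (intro exI[of _ "{\<lambda>_. 1}"] exI[of _ 0]) simp
qed

text \<open>Each window \<open>u\<close> is replaced by \<open>u * (1 + r) / 2\<close> and
  \<open>u * (1 - r) / 2\<close>. Where \<open>\<bar>r\<bar> \<ge> 3/5\<close>, one of the two
  factors is at least 4/5, so detection loses no more than that.\<close>

lemma spreadable_step:
  assumes sp: "spreadable x \<rho>" and x: "x > 0" and \<rho>: "\<rho> \<ge> 0"
  shows "spreadable (3/5 * x) (4/5 * \<rho>)"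
  unfolding spreadable_def
proof (intro allI impI)
  fix \<delta> \<gamma> :: real assume \<delta>: "\<delta> > 0" and \<gamma>: "\<gamma> > 0"
  have pos: "\<delta> / 2 > 0" "\<gamma> / 4 > 0" "x / 10 > 0" using \<delta> \<gamma> x by auto
  from sp[unfolded spreadable_def, THEN spec, THEN mp, OF pos(1), THEN spec, THEN mp, OF pos(2)]
  obtain S N1 where S: "finite S" "\<forall>u\<in>S. window u" and SN: "\<forall>N\<ge>N1.
    (\<forall>W. (\<forall>v\<in>X N. \<bar>W v\<bar> \<le> \<Lambda>) \<longrightarrow>
      real (card {\<phi>\<in>modes N W. \<forall>u\<in>S. u (energy N W \<phi>) < \<rho>}) \<le> \<gamma> / 4 * real (card (X N))) \<and>
    (\<forall>V. \<exists>W. near N (\<delta> / 2) V W \<and>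
      real (card {n\<in>X N. \<exists>u\<in>S. local_sum N W u n > x}) \<le> \<gamma> / 4 * real (card (X N)))"
    by (elim exE conjE) (rule that)
  note S = S(1) S(2)[rule_format]
  note S1 = SN[rule_format, THEN conjunct1, rule_format] and S2 = SN[rule_format, THEN conjunct2, rule_format]
  have "\<And>u. u \<in> S \<Longrightarrow> bounded_lipschitz u" using S(2) by (auto simp: window_def C11_def)
  from local_sums_stable[OF S(1) this pos(3,2)]
  obtain \<eta> where \<eta>: "\<eta> > 0" and stable: "\<And>N W W'. near N \<eta> W W' \<Longrightarrow>
      real (card {n\<in>X N. \<exists>f\<in>S. \<bar>local_sum N W' f n - local_sum N W f n\<bar> > x / 10}) \<le> \<gamma> / 4 * real (card (X N))"
    by blast
  define \<delta>' where "\<delta>' = min (\<delta> / 2) \<eta>"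
  have \<delta>': "\<delta>' > 0" "\<delta>' \<le> \<eta>" "\<delta>' \<le> \<delta> / 2" using \<eta> pos by (auto simp: \<delta>'_def)
  \<comment> \<open>The new mass is at most half of \<open>x + x / 10\<close> (old mass and
    instability) plus half of \<gamma>', hence at most \<open>3/5 * x\<close>.\<close>
  define \<gamma>' where "\<gamma>' = min (\<gamma> / 4) (x / 10)"
  have \<gamma>': "\<gamma>' > 0" "\<gamma>' \<le> \<gamma> / 4" "\<gamma>' \<le> x / 10" unfolding \<gamma>'_def using pos by auto
  obtain r N2 where osc: "\<And>u. u \<in> S \<Longrightarrow> oscillating (r u)"
    and r1: "\<And>N W. N \<ge> N2 \<Longrightarrow> (\<forall>v\<in>X N. \<bar>W v\<bar> \<le> \<Lambda>) \<Longrightarrow>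
      real (card {\<phi>\<in>modes N W. \<exists>u\<in>S. \<bar>r u (energy N W \<phi>)\<bar> < 3/5}) \<le> \<gamma>' * real (card (X N))"
    and r2: "\<And>N V. N \<ge> N2 \<Longrightarrow> \<exists>W. near N \<delta>' V W \<and>
      real (card {n\<in>X N. \<exists>u\<in>S. \<bar>local_sum N W (\<lambda>x. u x * r u x) n\<bar> > \<gamma>'}) \<le> \<gamma>' * real (card (X N))"
    using split_windows[OF S \<delta>'(1) \<gamma>'(1)] by blast
  \<comment> \<open>The sign is carried by \<open>s = \<plusminus>1/2\<close>; this linear form lets
    the local sum be split into those of \<open>u\<close> and of \<open>u * r\<close>.\<close>
  define half where "half s u t = 1/2 * u t + s * (u t * r u t)" for s :: real and u t
  define T where "T = half (1/2) ` S \<union> half (-1/2) ` S"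
  have r_le: "\<bar>r u t\<bar> \<le> 1" if "u \<in> S" for u t using osc[OF that] by (simp add: oscillating_def)
  have u01: "0 \<le> u t" "u t \<le> 1" if "u \<in> S" for u t using S(2)[OF that] by (auto simp: window_def)
  have half_eq: "half (1/2) u t = u t * ((1 + r u t) / 2)" "half (-1/2) u t = u t * ((1 - r u t) / 2)" for u t
    by (simp_all add: half_def field_simps)
  have half_window: "window (half s u)" if u: "u \<in> S" and s: "s = 1/2 \<or> s = -1/2" for s u
  proof -
    obtain u' where "C11 u u'" using S(2)[OF u] by (auto simp: window_def)
    moreover obtain r' where "C11 (r u) r'" using osc[OF u] by (auto simp: oscillating_def)
    then have "C11 (\<lambda>t. 1/2 + s * r u t) (\<lambda>t. s * r' t)" by (rule C11_affine)
    ultimately have "C11 (\<lambda>t. u t * (1/2 + s * r u t)) (\<lambda>t. u t * (s * r' t) + u' t * (1/2 + s * r u t))"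
      by (rule C11_mult)
    moreover have "half s u = (\<lambda>t. u t * (1/2 + s * r u t))" by (auto simp: half_def algebra_simps)
    moreover have "0 \<le> half s u t \<and> half s u t \<le> 1" for t
    proof -
      have "0 \<le> 1/2 + s * r u t" "1/2 + s * r u t \<le> 1"
        using s r_le[OF u, of t] by (elim disjE; hypsubst; linarith)+
      then have "0 \<le> u t * (1/2 + s * r u t)" "u t * (1/2 + s * r u t) \<le> 1"
        using u01[OF u, of t] by (auto intro: mult_le_one)
      then show ?thesis using \<open>half s u = _\<close> by simp
    qed
    ultimately show ?thesis unfolding window_def by auto
  qed
  have 1: "real (card {\<phi>\<in>modes N W. \<forall>w\<in>T. w (energy N W \<phi>) < 4/5 * \<rho>}) \<le> \<gamma> * real (card (X N))"
    if N: "N \<ge> max N1 N2" and W: "\<forall>v\<in>X N. \<bar>W v\<bar> \<le> \<Lambda>" for N W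
  proof -
    have "{\<phi>\<in>modes N W. \<forall>w\<in>T. w (energy N W \<phi>) < 4/5 * \<rho>}
      \<subseteq> {\<phi>\<in>modes N W. \<forall>u\<in>S. u (energy N W \<phi>) < \<rho>} \<union> {\<phi>\<in>modes N W. \<exists>u\<in>S. \<bar>r u (energy N W \<phi>)\<bar> < 3/5}"
    proof
      fix \<phi> assume \<phi>: "\<phi> \<in> {\<phi>\<in>modes N W. \<forall>w\<in>T. w (energy N W \<phi>) < 4/5 * \<rho>}"
      define t where "t = energy N W \<phi>"
      have False if u: "u \<in> S" and big: "u t \<ge> \<rho>" and rt: "\<bar>r u t\<bar> \<ge> 3/5" for u
      proof -
        have scale: "\<rho> * (4/5) \<le> u t * c" if "4/5 \<le> c" for c
          using big \<rho> that by (intro mult_mono) auto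
        have "(1 + r u t) / 2 \<ge> 4/5 \<or> (1 - r u t) / 2 \<ge> 4/5"
          using rt by (cases "r u t \<ge> 0") auto
        then have "\<rho> * (4/5) \<le> u t * ((1 + r u t) / 2) \<or> \<rho> * (4/5) \<le> u t * ((1 - r u t) / 2)"
          using scale by blast
        moreover have "half (1/2) u t < 4/5 * \<rho>" "half (-1/2) u t < 4/5 * \<rho>"
          using \<phi> u by (auto simp: T_def t_def)
        ultimately show False unfolding half_eq by linarith
      qed
      then show "\<phi> \<in> {\<phi>\<in>modes N W. \<forall>u\<in>S. u (energy N W \<phi>) < \<rho>} \<union> {\<phi>\<in>modes N W. \<exists>u\<in>S. \<bar>r u (energy N W \<phi>)\<bar> < 3/5}"
        using \<phi> unfolding t_def by (auto simp: not_less) (meson not_less)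
    qed
    then have "real (card {\<phi>\<in>modes N W. \<forall>w\<in>T. w (energy N W \<phi>) < 4/5 * \<rho>}) \<le> \<gamma> / 4 * real (card (X N)) + \<gamma>' * real (card (X N))"
      using N by (intro card_le_add2[OF _ _ _ S1[OF _ W[rule_format]] r1[OF _ W]]) auto
    also have "\<dots> \<le> \<gamma> * real (card (X N))"
      unfolding distrib_right[symmetric] using \<gamma>' pos by (intro mult_right_mono) auto
    finally show ?thesis .
  qed
  have 2: "\<exists>W. near N \<delta> V W \<and> real (card {n\<in>X N. \<exists>w\<in>T. local_sum N W w n > 3/5 * x}) \<le> \<gamma> * real (card (X N))"
    if N: "N \<ge> max N1 N2" for N V
  proof -
    obtain W1 where W1: "near N (\<delta> / 2) V W1"
      and bad1: "real (card {n\<in>X N. \<exists>u\<in>S. local_sum N W1 u n > x}) \<le> \<gamma> / 4 * real (card (X N))"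
      using S2[of N V] N by auto
    obtain W2 where W2: "near N \<delta>' W1 W2"
      and bad2: "real (card {n\<in>X N. \<exists>u\<in>S. \<bar>local_sum N W2 (\<lambda>x. u x * r u x) n\<bar> > \<gamma>'}) \<le> \<gamma>' * real (card (X N))"
      using r2[of N W1] N by auto
    have "near N \<eta> W1 W2" using W2 \<delta>'(2) by fastforce
    from stable[OF this]
    have bad3: "real (card {n\<in>X N. \<exists>f\<in>S. \<bar>local_sum N W2 f n - local_sum N W1 f n\<bar> > x / 10}) \<le> \<gamma> / 4 * real (card (X N))" .
    have "{n\<in>X N. \<exists>w\<in>T. local_sum N W2 w n > 3/5 * x}
      \<subseteq> {n\<in>X N. \<exists>u\<in>S. local_sum N W1 u n > x}
        \<union> {n\<in>X N. \<exists>u\<in>S. \<bar>local_sum N W2 (\<lambda>x. u x * r u x) n\<bar> > \<gamma>'}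
        \<union> {n\<in>X N. \<exists>f\<in>S. \<bar>local_sum N W2 f n - local_sum N W1 f n\<bar> > x / 10}" (is "?L \<subseteq> ?A \<union> ?B \<union> ?C")
    proof
      fix n assume "n \<in> ?L"
      then obtain u s where n: "n \<in> X N" and u: "u \<in> S" and s: "s = 1/2 \<or> s = -1/2"
        and big: "local_sum N W2 (half s u) n > 3/5 * x"
        unfolding T_def by blast
      have "local_sum N W2 (half s u) n = 1/2 * local_sum N W2 u n + s * local_sum N W2 (\<lambda>x. u x * r u x) n"
        unfolding half_def spectral_sum_add spectral_sum_cmult ..
      moreover have "s * local_sum N W2 (\<lambda>x. u x * r u x) n \<le> \<bar>local_sum N W2 (\<lambda>x. u x * r u x) n\<bar> / 2"
        using s by (elim disjE; hypsubst; linarith)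
      ultimately have "False" if "local_sum N W1 u n \<le> x" "\<bar>local_sum N W2 (\<lambda>x. u x * r u x) n\<bar> \<le> \<gamma>'"
          "\<bar>local_sum N W2 u n - local_sum N W1 u n\<bar> \<le> x / 10"
        using that big \<gamma>'(3) by linarith
      then have "local_sum N W1 u n > x \<or> \<bar>local_sum N W2 (\<lambda>x. u x * r u x) n\<bar> > \<gamma>' \<or>
          \<bar>local_sum N W2 u n - local_sum N W1 u n\<bar> > x / 10"
        unfolding not_le[symmetric] by blast
      then show "n \<in> ?A \<union> ?B \<union> ?C" using n u by blast
    qed
    then have "real (card ?L) \<le> \<gamma> / 4 * real (card (X N)) + \<gamma>' * real (card (X N)) + \<gamma> / 4 * real (card (X N))"
      by (rule card_le_add3[OF _ _ _ _ bad1 bad2 bad3]) auto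
    also have "\<dots> \<le> \<gamma> * real (card (X N))"
      unfolding distrib_right[symmetric] using \<gamma>' pos by (intro mult_right_mono) auto
    finally have "real (card ?L) \<le> \<gamma> * real (card (X N))" .
    moreover have "near N \<delta> V W2" by (rule near_trans[OF W1 W2]) (use \<delta>' in auto)
    ultimately show ?thesis by blast
  qed
  have "finite T" "\<forall>w\<in>T. window w" using S(1) half_window by (auto simp: T_def)
  then show "\<exists>S N0. finite S \<and> (\<forall>u\<in>S. window u) \<and> (\<forall>N\<ge>N0.
    (\<forall>W. (\<forall>v\<in>X N. \<bar>W v\<bar> \<le> \<Lambda>) \<longrightarrow>
      real (card {\<phi>\<in>modes N W. \<forall>u\<in>S. u (energy N W \<phi>) < 4/5 * \<rho>}) \<le> \<gamma> * real (card (X N))) \<and>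
    (\<forall>V. \<exists>W. near N \<delta> V W \<and>
      real (card {n\<in>X N. \<exists>u\<in>S. local_sum N W u n > 3/5 * x}) \<le> \<gamma> * real (card (X N))))"
    using 1 2 by (intro exI[of _ T] exI[of _ "max N1 N2"]) blast
qed

lemma spreadable_power: "spreadable ((3/5) ^ J) ((4/5) ^ J)"
proof (induction J)
  case 0
  then show ?case using spreadable_1 by simp
next
  case (Suc J)
  then show ?case using spreadable_step[OF Suc] by simp
qed

text \<open>A heavy atom at a detected energy makes some window heavy. At an undetected energy it is
  contained in the mass of the undetected modes, which are few. The margin in the bound on
  \<open>V\<close> keeps \<open>W\<close> within \<Lambda>, where the counting applies.\<close>

theorem delocalization:
  assumes \<epsilon>: "\<epsilon> > 0" and \<delta>: "\<delta> > 0"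
  shows "\<exists>N0. \<forall>N\<ge>N0. \<forall>V. (\<forall>v\<in>X N. \<bar>V v\<bar> \<le> \<Lambda> - \<delta>) \<longrightarrow> (\<exists>W. near N \<delta> V W \<and>
    real (card {n\<in>X N. \<exists>t. (\<Sum>\<phi>\<in>{\<phi>\<in>modes N W. energy N W \<phi> = t}. (\<phi> n)\<^sup>2) > \<epsilon>}) \<le> \<delta> * real (card (X N)))"
proof -
  obtain J where J: "(3/4 :: real) ^ J < \<epsilon>" using real_arch_pow_inv[OF \<epsilon>, of "3/4"] by auto
  define x :: real where "x = (3/5) ^ J"
  define \<rho> :: real where "\<rho> = (4/5) ^ J"
  have \<rho>: "\<rho> > 0" by (simp add: \<rho>_def)
  have x\<rho>: "x < \<rho> * \<epsilon>"
  proof -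
    have "x = \<rho> * (3/4) ^ J" by (simp add: x_def \<rho>_def power_mult_distrib[symmetric])
    then show ?thesis using J \<rho> by simp
  qed
  \<comment> \<open>Splits the budget \<delta> between sites with a heavy window (\<gamma>) and
    sites where undetected modes are heavy (\<open>\<gamma> / \<epsilon>\<close>).\<close>
  define \<gamma> where "\<gamma> = \<delta> / (1 + 1 / \<epsilon>)"
  have \<gamma>: "\<gamma> > 0" "\<gamma> + \<gamma> / \<epsilon> = \<delta>"
  proof -
    have pos: "1 + 1 / \<epsilon> > 0" using \<epsilon> by (simp add: add_pos_pos)
    then show "\<gamma> > 0" using \<delta> by (simp add: \<gamma>_def)
    have "\<gamma> + \<gamma> / \<epsilon> = \<gamma> * (1 + 1 / \<epsilon>)" by (simp add: distrib_left)
    then show "\<gamma> + \<gamma> / \<epsilon> = \<delta>" using pos by (simp add: \<gamma>_def)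
  qed
  from spreadable_power[of J, folded x_def \<rho>_def, unfolded spreadable_def, THEN spec, THEN mp, OF \<delta>, THEN spec, THEN mp, OF \<gamma>(1)]
  obtain S N0 where S: "finite S" "\<forall>u\<in>S. window u" and SN: "\<forall>N\<ge>N0.
    (\<forall>W. (\<forall>v\<in>X N. \<bar>W v\<bar> \<le> \<Lambda>) \<longrightarrow>
      real (card {\<phi>\<in>modes N W. \<forall>u\<in>S. u (energy N W \<phi>) < \<rho>}) \<le> \<gamma> * real (card (X N))) \<and>
    (\<forall>V. \<exists>W. near N \<delta> V W \<and>
      real (card {n\<in>X N. \<exists>u\<in>S. local_sum N W u n > x}) \<le> \<gamma> * real (card (X N)))"
    by (elim exE conjE) (rule that)
  note S = S(1) S(2)[rule_format]
  note S1 = SN[rule_format, THEN conjunct1, rule_format] and S2 = SN[rule_format, THEN conjunct2, rule_format]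
  show ?thesis
  proof (intro exI[of _ N0] allI impI)
    fix N :: nat and V :: "'a \<Rightarrow> real"
    assume N: "N \<ge> N0" and V: "\<forall>v\<in>X N. \<bar>V v\<bar> \<le> \<Lambda> - \<delta>"
    obtain W where W: "near N \<delta> V W"
      and bad: "real (card {n\<in>X N. \<exists>u\<in>S. local_sum N W u n > x}) \<le> \<gamma> * real (card (X N))"
      using S2[OF N] by blast
    define U where "U = {\<phi>\<in>modes N W. \<forall>u\<in>S. u (energy N W \<phi>) < \<rho>}"
    have basis: "eigenbasis (X N) (add_diag (A N) W) (modes N W) (energy N W)"
      by (rule symmetric_kernel.eigenbasis_modes[OF kernel])
    have "\<bar>W v\<bar> \<le> \<Lambda>" if "v \<in> X N" for v
    proof -
      have "\<bar>V v\<bar> \<le> \<Lambda> - \<delta>" "\<bar>W v - V v\<bar> \<le> \<delta>" using V W that by auto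
      then show ?thesis by linarith
    qed
    then have U: "real (card U) \<le> \<gamma> * real (card (X N))" unfolding U_def by (intro S1 N) auto
    have finU: "finite U" "U \<subseteq> modes N W" by (auto simp: U_def)
    \<comment> \<open>Markov's inequality: the modes in \<open>U\<close> have total mass
      \<open>card U\<close> over all sites.\<close>
    let ?E = "{n\<in>X N. (\<Sum>\<phi>\<in>U. (\<phi> n)\<^sup>2) > \<epsilon>}"
    have "real (card ?E) * \<epsilon> = (\<Sum>n\<in>?E. \<epsilon>)" by simp
    also have "\<dots> \<le> (\<Sum>n\<in>?E. \<Sum>\<phi>\<in>U. (\<phi> n)\<^sup>2)" by (intro sum_mono) auto
    also have "\<dots> \<le> (\<Sum>n\<in>X N. \<Sum>\<phi>\<in>U. (\<phi> n)\<^sup>2)" by (intro sum_mono2) (auto intro: sum_nonneg)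
    also have "\<dots> = (\<Sum>\<phi>\<in>U. \<Sum>n\<in>X N. (\<phi> n)\<^sup>2)" by (rule sum.swap)
    also have "\<dots> = real (card U)" using eigenbasis_norm[OF basis] finU(2) by (simp add: subset_iff)
    finally have "real (card ?E) \<le> \<gamma> / \<epsilon> * real (card (X N))" using U \<epsilon> by (simp add: field_simps)
    moreover have "{n\<in>X N. \<exists>t. (\<Sum>\<phi>\<in>{\<phi>\<in>modes N W. energy N W \<phi> = t}. (\<phi> n)\<^sup>2) > \<epsilon>}
        \<subseteq> {n\<in>X N. \<exists>u\<in>S. local_sum N W u n > x} \<union> ?E"
    proof
      fix n assume "n \<in> {n\<in>X N. \<exists>t. (\<Sum>\<phi>\<in>{\<phi>\<in>modes N W. energy N W \<phi> = t}. (\<phi> n)\<^sup>2) > \<epsilon>}"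
      then obtain t where n: "n \<in> X N"
        and atom: "(\<Sum>\<phi>\<in>{\<phi>\<in>modes N W. energy N W \<phi> = t}. (\<phi> n)\<^sup>2) > \<epsilon>" by auto
      let ?T = "{\<phi>\<in>modes N W. energy N W \<phi> = t}"
      show "n \<in> {n\<in>X N. \<exists>u\<in>S. local_sum N W u n > x} \<union> ?E"
      proof (cases "\<exists>u\<in>S. u t \<ge> \<rho>")
        case True
        then obtain u where u: "u \<in> S" "u t \<ge> \<rho>" by blast
        have "\<rho> * \<epsilon> \<le> u t * (\<Sum>\<phi>\<in>?T. (\<phi> n)\<^sup>2)" using u(2) \<rho> \<epsilon> atom by (intro mult_mono) auto
        also have "\<dots> = (\<Sum>\<phi>\<in>?T. u (energy N W \<phi>) * (\<phi> n)\<^sup>2)" by (simp add: sum_distrib_left)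
        also have "\<dots> \<le> local_sum N W u n"
          unfolding spectral_sum_def using S(2)[OF u(1)] by (intro sum_mono2) (auto simp: window_def)
        finally show ?thesis using x\<rho> n u(1) by force
      next
        case False
        then have "?T \<subseteq> U" by (auto simp: U_def not_le)
        then have "(\<Sum>\<phi>\<in>?T. (\<phi> n)\<^sup>2) \<le> (\<Sum>\<phi>\<in>U. (\<phi> n)\<^sup>2)" using finU(1) by (intro sum_mono2) auto
        then show ?thesis using n atom by simp
      qed
    qed
    ultimately have "real (card {n\<in>X N. \<exists>t. (\<Sum>\<phi>\<in>{\<phi>\<in>modes N W. energy N W \<phi> = t}. (\<phi> n)\<^sup>2) > \<epsilon>})
        \<le> \<gamma> * real (card (X N)) + \<gamma> / \<epsilon> * real (card (X N))"
      by (intro card_le_add2[OF _ _ _ bad]) auto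
    also have "\<dots> = \<delta> * real (card (X N))" unfolding distrib_right[symmetric] \<gamma>(2) ..
    finally show "\<exists>W. near N \<delta> V W \<and>
      real (card {n\<in>X N. \<exists>t. (\<Sum>\<phi>\<in>{\<phi>\<in>modes N W. energy N W \<phi> = t}. (\<phi> n)\<^sup>2) > \<epsilon>}) \<le> \<delta> * real (card (X N))"
      using W by blast
  qed
qed

end

section \<open>Counting energies by transfer across layers\<close>

text \<open>Gaussian elimination: the equation at \<open>y\<close> is used to eliminate an unknown
  \<open>b0\<close> that occurs in it.\<close>

lemma underdetermined_system:
  fixes a :: "'b \<Rightarrow> 'a \<Rightarrow> real"
  assumes "finite Y" "finite B" "card Y < card B"
  shows "\<exists>c. (\<exists>b\<in>B. c b \<noteq> 0) \<and> (\<forall>y\<in>Y. (\<Sum>b\<in>B. c b * a b y) = 0)"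
  using assms
proof (induction Y arbitrary: B a rule: finite_induct)
  case empty
  then obtain b where "b \<in> B" by fastforce
  then show ?case by (intro exI[of _ "\<lambda>_. 1"]) auto
next
  case (insert y Y)
  show ?case
  proof (cases "\<forall>b\<in>B. a b y = 0")
    case True
    have "card Y < card B" using insert by simp
    from insert.IH[OF insert.prems(1) this] True show ?thesis by auto
  next
    case False
    then obtain b0 where b0: "b0 \<in> B" "a b0 y \<noteq> 0" by blast
    define B' where "B' = B - {b0}"
    have B: "B = insert b0 B'" "b0 \<notin> B'" "finite B'" using b0 insert.prems by (auto simp: B'_def)
    have "card Y < card B'" using insert B by simp
    from insert.IH[OF B(3) this, of "\<lambda>b z. a b z - a b y / a b0 y * a b0 z"]
    obtain c where c: "\<exists>b\<in>B'. c b \<noteq> 0"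
      "\<And>z. z \<in> Y \<Longrightarrow> (\<Sum>b\<in>B'. c b * (a b z - a b y / a b0 y * a b0 z)) = 0" by blast
    \<comment> \<open>Back substitution for the eliminated unknown.\<close>
    define k where "k = - (\<Sum>b\<in>B'. c b * a b y) / a b0 y"
    define c' where "c' = c(b0 := k)"
    have sum: "(\<Sum>b\<in>B. c' b * a b z) = k * a b0 z + (\<Sum>b\<in>B'. c b * a b z)" for z
    proof -
      have "(\<Sum>b\<in>B'. c' b * a b z) = (\<Sum>b\<in>B'. c b * a b z)"
        using B(2) by (intro sum.cong) (auto simp: c'_def)
      then show ?thesis using B by (simp add: c'_def)
    qed
    have "(\<Sum>b\<in>B. c' b * a b y) = 0" unfolding sum k_def using b0(2) by simp
    moreover have "(\<Sum>b\<in>B. c' b * a b z) = 0" if "z \<in> Y" for z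
    proof -
      have "0 = (\<Sum>b\<in>B'. c b * a b z) - (\<Sum>b\<in>B'. c b * a b y) / a b0 y * a b0 z"
        using c(2)[OF that] by (simp add: right_diff_distrib sum_subtractf sum_distrib_right sum_divide_distrib mult.assoc)
      then show ?thesis unfolding sum k_def by simp
    qed
    moreover have "\<exists>b\<in>B. c' b \<noteq> 0" using c(1) B by (auto simp: c'_def)
    ultimately show ?thesis by (intro exI[of _ c']) auto
  qed
qed

text \<open>Transfer across layers: the row of \<open>s v\<close> expresses \<open>\<phi> v\<close> through values of \<open>\<phi>\<close> on strictly
  earlier layers, so \<open>\<phi>\<close> is controlled by the residual once it vanishes on the first \<open>q\<close> layers.\<close>

locale layered_kernel =
  fixes X :: "'a set" and G :: "'a \<Rightarrow> 'a \<Rightarrow> real" and p :: "'a \<Rightarrow> nat" and s :: "'a \<Rightarrow> 'a"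
    and q L D :: nat and C :: real
  assumes fin: "finite X"
    and p_less: "\<And>v. v \<in> X \<Longrightarrow> p v < L"
    and s_mem: "\<And>v. v \<in> X \<Longrightarrow> q \<le> p v \<Longrightarrow> s v \<in> X"
    and s_inj: "inj_on s {v\<in>X. q \<le> p v}"
    and G_s: "\<And>v. v \<in> X \<Longrightarrow> q \<le> p v \<Longrightarrow> G (s v) v = 1"
    and G_earlier: "\<And>v w. v \<in> X \<Longrightarrow> q \<le> p v \<Longrightarrow> w \<in> X \<Longrightarrow> w \<noteq> v \<Longrightarrow> G (s v) w \<noteq> 0 \<Longrightarrow> p w < p v"
    and G_le: "\<And>v w. v \<in> X \<Longrightarrow> w \<in> X \<Longrightarrow> \<bar>G v w\<bar> \<le> C"
    and row: "\<And>v. v \<in> X \<Longrightarrow> card {w\<in>X. G v w \<noteq> 0} \<le> D"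
    and column: "\<And>w. w \<in> X \<Longrightarrow> card {v\<in>X. G v w \<noteq> 0} \<le> D"
begin

text \<open>The sum of the two coefficients in the recursion over layers, namely
  \<open>1 + (1 + real D) * C\<^sup>2 * real D\<close> for the mass on earlier layers and
  \<open>1 + real D\<close> for the residual.\<close>

definition growth :: real where
  "growth = 1 + (1 + real D) + (1 + real D) * C\<^sup>2 * real D"

lemma growth_ge_1: "growth \<ge> 1"
  by (simp add: growth_def)

lemma square_le_residual:
  assumes v: "v \<in> X" "q \<le> p v"
  shows "(\<phi> v)\<^sup>2 \<le> (1 + real D) * ((kernel_op X G \<phi> (s v))\<^sup>2
    + C\<^sup>2 * (\<Sum>w\<in>{w\<in>X. w \<noteq> v \<and> G (s v) w \<noteq> 0}. (\<phi> w)\<^sup>2))"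
proof -
  define F where "F = {w\<in>X. w \<noteq> v \<and> G (s v) w \<noteq> 0}"
  have F: "finite F" "card F \<le> D" "F \<subseteq> X"
  proof -
    show "finite F" "F \<subseteq> X" using fin by (auto simp: F_def)
    have "card F \<le> card {w\<in>X. G (s v) w \<noteq> 0}" using fin by (intro card_mono) (auto simp: F_def)
    then show "card F \<le> D" using row[OF s_mem[OF v]] by linarith
  qed
  have "kernel_op X G \<phi> (s v) = (\<Sum>w\<in>insert v F. G (s v) w * \<phi> w)"
    unfolding kernel_op_def if_P[OF s_mem[OF v]]
    by (rule sum.mono_neutral_right) (use fin v(1) in \<open>auto simp: F_def\<close>)
  also have "\<dots> = \<phi> v + (\<Sum>w\<in>F. G (s v) w * \<phi> w)"
    using F G_s[OF v] by (subst sum.insert) (auto simp: F_def)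
  finally have eq: "\<phi> v = kernel_op X G \<phi> (s v) - (\<Sum>w\<in>F. G (s v) w * \<phi> w)" by simp
  define y where "y = (\<Sum>w\<in>F. G (s v) w * \<phi> w)"
  define x where "x = kernel_op X G \<phi> (s v)"
  have "y\<^sup>2 \<le> (\<Sum>w\<in>F. (G (s v) w * \<phi> w)\<^sup>2) * card F"
    unfolding y_def by (rule sum_squared_le_sum_of_squares)
  also have "\<dots> \<le> (\<Sum>w\<in>F. C\<^sup>2 * (\<phi> w)\<^sup>2) * real D"
  proof (intro mult_mono sum_mono)
    fix w assume "w \<in> F"
    then have "\<bar>G (s v) w\<bar> \<le> C" using G_le[OF s_mem[OF v]] F(3) by auto
    from power_mono[OF this, of 2] have "(G (s v) w)\<^sup>2 \<le> C\<^sup>2" by simp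
    then show "(G (s v) w * \<phi> w)\<^sup>2 \<le> C\<^sup>2 * (\<phi> w)\<^sup>2"
      unfolding power_mult_distrib by (rule mult_right_mono) simp
  qed (use F in \<open>auto intro: sum_nonneg\<close>)
  finally have y: "y\<^sup>2 \<le> C\<^sup>2 * (\<Sum>w\<in>F. (\<phi> w)\<^sup>2) * real D" by (simp add: sum_distrib_left)
  have "(x - y)\<^sup>2 \<le> (1 + real D) * (x\<^sup>2 + C\<^sup>2 * (\<Sum>w\<in>F. (\<phi> w)\<^sup>2))"
  proof (cases "D = 0")
    case True
    then show ?thesis using y by (simp add: sum_nonneg)
  next
    case False
    then have D: "real D > 0" by simp
    \<comment> \<open>The weight in the mixed term is chosen to cancel the factor \<open>D\<close>
      that Cauchy-Schwarz produced in the bound for \<open>y\<close>.\<close>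
    have "0 \<le> (sqrt (real D) * x + y / sqrt (real D))\<^sup>2" by simp
    also have "\<dots> = real D * x\<^sup>2 + 2 * x * y + y\<^sup>2 / real D"
      using D by (simp add: power2_sum power_mult_distrib power_divide)
    finally have "- 2 * x * y \<le> real D * x\<^sup>2 + y\<^sup>2 / real D" by simp
    moreover have "y\<^sup>2 / real D \<le> C\<^sup>2 * (\<Sum>w\<in>F. (\<phi> w)\<^sup>2)" using y D by (simp add: field_simps)
    ultimately show ?thesis using y unfolding power2_diff by (simp add: algebra_simps)
  qed
  then show ?thesis unfolding F_def[symmetric] x_def[symmetric] using eq by (simp add: x_def y_def)
qed

text \<open>Induction over layers: the mass on layer \<open>j\<close> is bounded by the residual and
  by the mass on earlier layers, so each layer costs at most one factor
  \<open>growth\<close>.\<close>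

lemma sum_squares_le_residual:
  assumes zero: "\<And>v. v \<in> X \<Longrightarrow> p v < q \<Longrightarrow> \<phi> v = 0"
  shows "(\<Sum>v\<in>X. (\<phi> v)\<^sup>2) \<le> growth ^ L * (\<Sum>v\<in>X. (kernel_op X G \<phi> v)\<^sup>2)"
proof -
  define \<Psi> where "\<Psi> = (\<Sum>v\<in>X. (kernel_op X G \<phi> v)\<^sup>2)"
  define S where "S j = (\<Sum>v\<in>{v\<in>X. p v < j}. (\<phi> v)\<^sup>2)" for j
  have \<Psi>: "\<Psi> \<ge> 0" by (simp add: \<Psi>_def sum_nonneg)
  have S: "S j \<le> growth ^ j * \<Psi>" for j
  proof (induction j)
    case 0
    show ?case using \<Psi> by (simp add: S_def)
  next
    case (Suc j)
    define Z where "Z = {v\<in>X. p v = j}"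
    have "{v\<in>X. p v < Suc j} = {v\<in>X. p v < j} \<union> Z" by (auto simp: Z_def less_Suc_eq)
    then have S_Suc: "S (Suc j) = S j + (\<Sum>v\<in>Z. (\<phi> v)\<^sup>2)"
      using fin by (simp add: S_def Z_def sum.union_disjoint disjoint_iff)
    have S0: "S j \<ge> 0" by (simp add: S_def sum_nonneg)
    have "(\<Sum>v\<in>Z. (\<phi> v)\<^sup>2) \<le> (1 + real D) * (\<Psi> + C\<^sup>2 * (real D * S j))"
    proof (cases "j < q")
      case True
      then have "(\<Sum>v\<in>Z. (\<phi> v)\<^sup>2) = 0" using zero by (intro sum.neutral) (auto simp: Z_def)
      then show ?thesis using \<Psi> S0 by simp
    next
      case False
      let ?F = "\<lambda>v. {w\<in>X. w \<noteq> v \<and> G (s v) w \<noteq> 0}"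
      have Z: "finite Z" "\<And>v. v \<in> Z \<Longrightarrow> v \<in> X \<and> q \<le> p v" using fin False by (auto simp: Z_def)
      have inj: "inj_on s Z" using s_inj Z(2) by (auto intro: inj_on_subset)
      have "(\<Sum>v\<in>Z. (\<phi> v)\<^sup>2) \<le> (\<Sum>v\<in>Z. (1 + real D) * ((kernel_op X G \<phi> (s v))\<^sup>2 + C\<^sup>2 * (\<Sum>w\<in>?F v. (\<phi> w)\<^sup>2)))"
        using Z(2) by (intro sum_mono square_le_residual) auto
      also have "\<dots> = (1 + real D) * ((\<Sum>v\<in>Z. (kernel_op X G \<phi> (s v))\<^sup>2) + C\<^sup>2 * (\<Sum>v\<in>Z. \<Sum>w\<in>?F v. (\<phi> w)\<^sup>2))"
        unfolding sum_distrib_left[symmetric] sum.distrib ..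
      also have "\<dots> \<le> (1 + real D) * (\<Psi> + C\<^sup>2 * (real D * S j))"
      proof (intro mult_left_mono add_mono)
        have "(\<Sum>v\<in>Z. (kernel_op X G \<phi> (s v))\<^sup>2) = (\<Sum>v\<in>s ` Z. (kernel_op X G \<phi> v)\<^sup>2)"
          using inj by (simp add: sum.reindex)
        also have "\<dots> \<le> \<Psi>" unfolding \<Psi>_def using Z s_mem fin by (intro sum_mono2) auto
        finally show "(\<Sum>v\<in>Z. (kernel_op X G \<phi> (s v))\<^sup>2) \<le> \<Psi>" .
        let ?J = "{w\<in>X. p w < j}"
        \<comment> \<open>Double counting: as \<open>s\<close> is injective and columns have at most
          \<open>D\<close> nonzero entries, each earlier site is used by at most \<open>D\<close>
          sites of \<open>Z\<close>.\<close>
        have "(\<Sum>v\<in>Z. \<Sum>w\<in>?F v. (\<phi> w)\<^sup>2) = (\<Sum>v\<in>Z. \<Sum>w\<in>?J. if w \<in> ?F v then (\<phi> w)\<^sup>2 else 0)"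
        proof (rule sum.cong[OF refl])
          fix v assume v: "v \<in> Z"
          have "?F v \<subseteq> ?J" using G_earlier[of v] Z(2)[OF v] v by (auto simp: Z_def)
          then have "?J \<inter> ?F v = ?F v" by blast
          then show "(\<Sum>w\<in>?F v. (\<phi> w)\<^sup>2) = (\<Sum>w\<in>?J. if w \<in> ?F v then (\<phi> w)\<^sup>2 else 0)"
            using fin sum.inter_restrict[of ?J "\<lambda>w. (\<phi> w)\<^sup>2" "?F v"] by simp
        qed
        also have "\<dots> = (\<Sum>w\<in>?J. \<Sum>v\<in>Z. if w \<in> ?F v then (\<phi> w)\<^sup>2 else 0)" by (rule sum.swap)
        also have "\<dots> = (\<Sum>w\<in>?J. real (card {v\<in>Z. w \<in> ?F v}) * (\<phi> w)\<^sup>2)"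
          using Z(1) by (simp add: sum.inter_filter[symmetric])
        also have "\<dots> \<le> (\<Sum>w\<in>?J. real D * (\<phi> w)\<^sup>2)"
        proof (intro sum_mono mult_right_mono)
          fix w assume w: "w \<in> ?J"
          have "card {v\<in>Z. w \<in> ?F v} = card (s ` {v\<in>Z. w \<in> ?F v})"
            using inj by (intro card_image[symmetric] inj_on_subset[OF inj]) auto
          also have "\<dots> \<le> card {v\<in>X. G v w \<noteq> 0}"
            using fin Z(2) s_mem by (intro card_mono) auto
          also have "\<dots> \<le> D" using column w by auto
          finally show "real (card {v\<in>Z. w \<in> ?F v}) \<le> real D" by simp
        qed simp
        also have "\<dots> = real D * S j" by (simp add: S_def sum_distrib_left)
        finally show "(\<Sum>v\<in>Z. \<Sum>w\<in>?F v. (\<phi> w)\<^sup>2) \<le> real D * S j" .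
      qed simp_all
      finally show ?thesis .
    qed
    then have "S (Suc j) \<le> (1 + (1 + real D) * C\<^sup>2 * real D) * S j + (1 + real D) * \<Psi>"
      unfolding S_Suc by (simp add: algebra_simps)
    also have "\<dots> \<le> (1 + (1 + real D) * C\<^sup>2 * real D) * (growth ^ j * \<Psi>) + (1 + real D) * (growth ^ j * \<Psi>)"
    proof (intro add_mono mult_left_mono Suc.IH)
      have "1 * \<Psi> \<le> growth ^ j * \<Psi>" using growth_ge_1 \<Psi> by (intro mult_right_mono one_le_power) auto
      then show "\<Psi> \<le> growth ^ j * \<Psi>" by simp
    qed auto
    also have "\<dots> = growth * (growth ^ j * \<Psi>)" by (simp add: growth_def algebra_simps)
    finally show ?case by (simp add: mult.assoc)
  qed
  have "{v\<in>X. p v < L} = X" using p_less by auto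
  then show ?thesis using S[of L] by (simp add: S_def \<Psi>_def)
qed

end

text \<open>If there were more such modes than sites on the first \<open>q\<close> layers, a
  nontrivial combination would vanish on those layers. Its residual is at most \<tau> times its
  norm, so the transfer estimate would force it to be zero.\<close>

lemma card_energies_nearby_le:
  assumes lk: "layered_kernel X (\<lambda>v w. K v w - of_bool (v = w) * t) p s q L D C"
    and B: "eigenbasis X K B e"
    and \<tau>: "\<tau> \<ge> 0" "layered_kernel.growth D C ^ L * \<tau>\<^sup>2 < 1"
  shows "card {\<phi>\<in>B. \<bar>e \<phi> - t\<bar> \<le> \<tau>} \<le> card {v\<in>X. p v < q}"
proof (rule ccontr)
  interpret layered_kernel X "\<lambda>v w. K v w - of_bool (v = w) * t" p s q L D C by (rule lk)
  define I where "I = {\<phi>\<in>B. \<bar>e \<phi> - t\<bar> \<le> \<tau>}"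
  assume "\<not> card {\<phi>\<in>B. \<bar>e \<phi> - t\<bar> \<le> \<tau>} \<le> card {v\<in>X. p v < q}"
  then have "card {v\<in>X. p v < q} < card I" by (simp add: I_def)
  moreover have I: "finite I" "I \<subseteq> B" using eigenbasis_finite[OF B] by (auto simp: I_def)
  ultimately obtain c where c: "\<exists>b\<in>I. c b \<noteq> 0" "\<And>v. v \<in> X \<Longrightarrow> p v < q \<Longrightarrow> (\<Sum>b\<in>I. c b * b v) = 0"
    using underdetermined_system[of "{v\<in>X. p v < q}" I "\<lambda>b v. b v"] fin by auto
  have norm: "(\<Sum>v\<in>X. (\<Sum>b\<in>I. k b * b v)\<^sup>2) = (\<Sum>b\<in>I. (k b)\<^sup>2)" for k
  proof -
    have "(\<Sum>v\<in>X. (\<Sum>b\<in>I. k b * b v)\<^sup>2) = inner_on X (\<lambda>v. \<Sum>b\<in>I. k b * b v) (\<lambda>v. \<Sum>b\<in>I. k b * b v)"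
      by (simp add: inner_on_def power2_eq_square)
    also have "\<dots> = (\<Sum>b\<in>I. \<Sum>b'\<in>I. k b * (k b' * inner_on X b b'))"
      by (simp add: inner_on_sum inner_on_simps sum_distrib_left mult.left_commute)
    also have "\<dots> = (\<Sum>b\<in>I. \<Sum>b'\<in>I. if b' = b then (k b)\<^sup>2 else 0)"
      using eigenbasis_inner[OF B] I(2) by (intro sum.cong refl) (auto simp: power2_eq_square subset_iff)
    finally show ?thesis using I(1) by simp
  qed
  define \<phi> where "\<phi> v = (\<Sum>b\<in>I. c b * b v)" for v
  have op: "kernel_op X (\<lambda>v w. K v w - of_bool (v = w) * t) \<phi> v = (\<Sum>b\<in>I. c b * (e b - t) * b v)"
    if v: "v \<in> X" for v
  proof -
    have "kernel_op X (\<lambda>v w. K v w - of_bool (v = w) * t) \<phi> v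
        = (\<Sum>w\<in>X. K v w * \<phi> w) - (\<Sum>w\<in>X. of_bool (v = w) * t * \<phi> w)"
      using v by (simp add: kernel_op_def left_diff_distrib sum_subtractf)
    also have "(\<Sum>w\<in>X. of_bool (v = w) * t * \<phi> w) = (\<Sum>w\<in>X. if w = v then t * \<phi> v else 0)"
      by (intro sum.cong) auto
    also have "\<dots> = t * \<phi> v" using v fin by simp
    also have "(\<Sum>w\<in>X. K v w * \<phi> w) = (\<Sum>b\<in>I. c b * (\<Sum>w\<in>X. K v w * b w))"
      unfolding \<phi>_def sum_distrib_left by (subst sum.swap) (simp add: mult.left_commute)
    also have "\<dots> = (\<Sum>b\<in>I. c b * (e b * b v))"
    proof (intro sum.cong refl)
      fix b assume "b \<in> I"
      then have "kernel_op X K b v = e b * b v" using B I(2) by (auto simp: eigenbasis_def)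
      then show "c b * (\<Sum>w\<in>X. K v w * b w) = c b * (e b * b v)" using v by (simp add: kernel_op_def)
    qed
    also have "t * \<phi> v = (\<Sum>b\<in>I. c b * (t * b v))"
      unfolding \<phi>_def sum_distrib_left by (simp add: mult.left_commute)
    finally show ?thesis
      unfolding sum_subtractf[symmetric] right_diff_distrib[symmetric] left_diff_distrib[symmetric] mult.assoc .
  qed
  have "(\<Sum>b\<in>I. (c b)\<^sup>2) = (\<Sum>v\<in>X. (\<phi> v)\<^sup>2)" unfolding \<phi>_def by (rule norm[symmetric])
  also have "\<dots> \<le> growth ^ L * (\<Sum>v\<in>X. (kernel_op X (\<lambda>v w. K v w - of_bool (v = w) * t) \<phi> v)\<^sup>2)"
    using c(2) by (intro sum_squares_le_residual) (simp add: \<phi>_def)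
  also have "(\<Sum>v\<in>X. (kernel_op X (\<lambda>v w. K v w - of_bool (v = w) * t) \<phi> v)\<^sup>2) = (\<Sum>b\<in>I. (c b * (e b - t))\<^sup>2)"
    using norm[of "\<lambda>b. c b * (e b - t)"] op by simp
  also have "(\<Sum>b\<in>I. (c b * (e b - t))\<^sup>2) \<le> \<tau>\<^sup>2 * (\<Sum>b\<in>I. (c b)\<^sup>2)"
    unfolding sum_distrib_left
  proof (intro sum_mono)
    fix b assume "b \<in> I"
    then have "\<bar>e b - t\<bar> \<le> \<tau>" by (simp add: I_def)
    from power_mono[OF this, of 2] have "(e b - t)\<^sup>2 \<le> \<tau>\<^sup>2" by simp
    then have "(c b)\<^sup>2 * (e b - t)\<^sup>2 \<le> (c b)\<^sup>2 * \<tau>\<^sup>2" by (rule mult_left_mono) simp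
    then show "(c b * (e b - t))\<^sup>2 \<le> \<tau>\<^sup>2 * (c b)\<^sup>2" by (simp add: power_mult_distrib mult.commute)
  qed
  finally have le: "(\<Sum>b\<in>I. (c b)\<^sup>2) \<le> growth ^ L * (\<tau>\<^sup>2 * (\<Sum>b\<in>I. (c b)\<^sup>2))"
    using growth_ge_1 by (simp add: mult_left_mono)
  obtain b where "b \<in> I" "c b \<noteq> 0" using c(1) by blast
  then have pos: "(\<Sum>b\<in>I. (c b)\<^sup>2) > 0"
    using I(1) by (intro sum_pos2[of I b]) auto
  have "growth ^ L * \<tau>\<^sup>2 * (\<Sum>b\<in>I. (c b)\<^sup>2) < 1 * (\<Sum>b\<in>I. (c b)\<^sup>2)"
    using \<tau>(2) pos by (rule mult_strict_right_mono)
  then show False using le by (simp add: mult.assoc)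
qed

section \<open>Range-r kernels on boxes\<close>

lemma graph_dist_le_iff: "graph_dist E u v \<le> enat r \<longleftrightarrow> (\<exists>n\<le>r. (u, v) \<in> E ^^ n)"
proof
  assume le: "graph_dist E u v \<le> enat r"
  show "\<exists>n\<le>r. (u, v) \<in> E ^^ n"
  proof (rule ccontr)
    assume "\<not> (\<exists>n\<le>r. (u, v) \<in> E ^^ n)"
    then have "enat (Suc r) \<le> graph_dist E u v"
      unfolding graph_dist_def by (intro INF_greatest) (auto simp: not_le Suc_le_eq)
    from order.trans[OF this le] show False by simp
  qed
next
  assume "\<exists>n\<le>r. (u, v) \<in> E ^^ n"
  then obtain n where n: "n \<le> r" "(u, v) \<in> E ^^ n" by blast
  then have "graph_dist E u v \<le> enat n" unfolding graph_dist_def by (intro INF_lower) simp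
  also have "\<dots> \<le> enat r" using n by simp
  finally show "graph_dist E u v \<le> enat r" .
qed

lemma lattice_box_edges_sym: "(u, v) \<in> lattice_box_edges d N \<Longrightarrow> (v, u) \<in> lattice_box_edges d N"
  by (auto simp: lattice_box_edges_def L2_set_def power2_commute)

lemma lattice_box_walk_sym:
  "(u, v) \<in> lattice_box_edges d N ^^ n \<Longrightarrow> (v, u) \<in> lattice_box_edges d N ^^ n"
proof (induction n arbitrary: v)
  case (Suc n)
  then obtain y where "(u, y) \<in> lattice_box_edges d N ^^ n" "(y, v) \<in> lattice_box_edges d N" by auto
  then show ?case using Suc.IH lattice_box_edges_sym by (meson relpow_Suc_I2)
qed auto

text \<open>Integers satisfy \<open>\<bar>x\<bar> \<le> x\<^sup>2\<close>, so Euclidean length 1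
  bounds the sum norm.\<close>

lemma lattice_box_edges_l1:
  assumes "(u, v) \<in> lattice_box_edges d N"
  shows "(\<Sum>i<d. \<bar>u i - v i\<bar>) \<le> 1"
proof -
  have "sqrt (\<Sum>i<d. (real_of_int (u i - v i))\<^sup>2) = 1"
    using assms by (simp add: lattice_box_edges_def L2_set_def)
  then have "real_of_int (\<Sum>i<d. (u i - v i)\<^sup>2) = 1" by simp
  then have "(\<Sum>i<d. (u i - v i)\<^sup>2) = 1" by linarith
  moreover have "(\<Sum>i<d. \<bar>u i - v i\<bar>) \<le> (\<Sum>i<d. (u i - v i)\<^sup>2)"
  proof (rule sum_mono)
    fix i
    have "\<bar>x\<bar> \<le> x\<^sup>2" for x :: int
    proof (cases "x = 0")
      case False
      then have "\<bar>x\<bar> * 1 \<le> \<bar>x\<bar> * \<bar>x\<bar>" by (intro mult_left_mono) auto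
      then show ?thesis by (simp add: power2_eq_square)
    qed simp
    then show "\<bar>u i - v i\<bar> \<le> (u i - v i)\<^sup>2" .
  qed
  ultimately show ?thesis by simp
qed

lemma lattice_box_walk_l1:
  "(u, v) \<in> lattice_box_edges d N ^^ n \<Longrightarrow> (\<Sum>i<d. \<bar>u i - v i\<bar>) \<le> int n"
proof (induction n arbitrary: v)
  case (Suc n)
  then obtain y where y: "(u, y) \<in> lattice_box_edges d N ^^ n" "(y, v) \<in> lattice_box_edges d N" by auto
  have "(\<Sum>i<d. \<bar>u i - v i\<bar>) \<le> (\<Sum>i<d. \<bar>u i - y i\<bar> + \<bar>y i - v i\<bar>)" by (intro sum_mono) simp
  then show ?case using Suc.IH[OF y(1)] lattice_box_edges_l1[OF y(2)] by (simp add: sum.distrib)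
qed auto

lemma lattice_box_iff:
  "v \<in> lattice_box d N \<longleftrightarrow> (\<forall>i<d. 1 \<le> v i \<and> v i \<le> int N) \<and> (\<forall>i\<ge>d. v i = undefined)"
  by (auto simp: lattice_box_def PiE_iff extensional_def)

lemma finite_lattice_box [simp]: "finite (lattice_box d N)"
  by (simp add: lattice_box_def finite_PiE)

lemma card_lattice_box: "card (lattice_box d N) = N ^ d"
  by (simp add: lattice_box_def card_PiE)

lemma lattice_box_shift_mem:
  assumes "v \<in> lattice_box d N" "0 < d" "1 \<le> k" "k \<le> int N"
  shows "v(0 := k) \<in> lattice_box d N"
  using assms by (auto simp: lattice_box_iff)

lemma lattice_box_straight_walk:
  assumes v: "v \<in> lattice_box d N" and d: "0 < d" and k: "v 0 + int k \<le> int N"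
  shows "(v, v(0 := v 0 + int k)) \<in> lattice_box_edges d N ^^ k"
  using k
proof (induction k)
  case (Suc k)
  have v0: "1 \<le> v 0" using v d by (simp add: lattice_box_iff)
  let ?a = "v(0 := v 0 + int k)" and ?b = "v(0 := v 0 + int (Suc k))"
  have "?a \<in> lattice_box d N" "?b \<in> lattice_box d N"
    using Suc.prems v0 by (intro lattice_box_shift_mem v d; simp)+
  moreover have "(\<Sum>i<d. (real_of_int (?a i - ?b i))\<^sup>2) = 1"
  proof -
    have "(\<Sum>i<d. (real_of_int (?a i - ?b i))\<^sup>2) = (\<Sum>i<d. if i = 0 then 1 else 0)"
      by (intro sum.cong) auto
    then show ?thesis using d by simp
  qed
  ultimately have "(?a, ?b) \<in> lattice_box_edges d N"
    unfolding lattice_box_edges_def L2_set_def by simp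
  moreover have "(v, ?a) \<in> lattice_box_edges d N ^^ k"
    by (rule Suc.IH) (use Suc.prems in simp)
  ultimately show ?case by (rule relpow_Suc_I[rotated])
qed simp

section \<open>The kernel of the range-r operator\<close>

definition box_nbr :: "nat \<Rightarrow> nat \<Rightarrow> nat \<Rightarrow> (nat \<Rightarrow> int) \<Rightarrow> (nat \<Rightarrow> int) \<Rightarrow> bool" where
  "box_nbr d r N v w \<longleftrightarrow> graph_dist (lattice_box_edges d N) w v \<le> enat r"

text \<open>The counted ball contains its centre, where the first summand equals 1. The diagonal
  entry is therefore minus the number of other sites in the ball, in agreement with the vanishing
  term \<open>v' = v\<close> of the operator.\<close>

definition box_kernel :: "nat \<Rightarrow> nat \<Rightarrow> nat \<Rightarrow> (nat \<Rightarrow> int) \<Rightarrow> (nat \<Rightarrow> int) \<Rightarrow> real" where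
  "box_kernel d r N v w = of_bool (box_nbr d r N v w)
     - of_bool (v = w) * real (card {w\<in>lattice_box d N. box_nbr d r N v w})"

lemma box_nbr_sym: "box_nbr d r N v w \<longleftrightarrow> box_nbr d r N w v"
  unfolding box_nbr_def graph_dist_le_iff using lattice_box_walk_sym by blast

lemma box_nbr_refl: "box_nbr d r N v v"
  unfolding box_nbr_def graph_dist_le_iff by (intro exI[of _ 0]) auto

lemma box_nbr_l1: "box_nbr d r N v w \<Longrightarrow> (\<Sum>i<d. \<bar>w i - v i\<bar>) \<le> int r"
  unfolding box_nbr_def graph_dist_le_iff using lattice_box_walk_l1 by fastforce

lemma box_nbr_coordinate:
  assumes "box_nbr d r N v w" "i < d"
  shows "\<bar>w i - v i\<bar> \<le> int r"
proof -
  have "\<bar>w i - v i\<bar> \<le> (\<Sum>i<d. \<bar>w i - v i\<bar>)" using assms(2) by (intro member_le_sum) auto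
  then show ?thesis using box_nbr_l1[OF assms(1)] by linarith
qed

text \<open>A shift by \<open>r\<close> in the first coordinate exhausts the distance in the sum
  norm, so no other coordinate can change. This uniqueness allows solving one row of the equation
  for the value at the extremal site.\<close>

lemma box_nbr_extremal:
  assumes nbr: "box_nbr d r N v w" and d: "0 < d" and w: "w \<in> lattice_box d N" and v: "v \<in> lattice_box d N"
    and ext: "w 0 = v 0 + int r"
  shows "w = v(0 := v 0 + int r)"
proof
  fix i
  show "w i = (v(0 := v 0 + int r)) i"
  proof (cases "i = 0 \<or> i \<ge> d")
    case True
    then show ?thesis using v w d ext by (auto simp: lattice_box_iff)
  next
    case False
    then have i: "i \<noteq> 0" "i < d" by auto
    have "(\<Sum>j\<in>{0, i}. \<bar>w j - v j\<bar>) \<le> (\<Sum>j<d. \<bar>w j - v j\<bar>)" using i d by (intro sum_mono2) auto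
    then have "\<bar>w 0 - v 0\<bar> + \<bar>w i - v i\<bar> \<le> int r" using i box_nbr_l1[OF nbr] by simp
    then show ?thesis using ext i by simp
  qed
qed

lemma card_box_nbr: "card {w\<in>lattice_box d N. box_nbr d r N v w} \<le> (2 * r + 1) ^ d"
proof -
  have "{w\<in>lattice_box d N. box_nbr d r N v w} \<subseteq> (\<Pi>\<^sub>E i\<in>{..<d}. {v i - int r..v i + int r})"
  proof
    fix w assume "w \<in> {w\<in>lattice_box d N. box_nbr d r N v w}"
    then have w: "w \<in> lattice_box d N" "box_nbr d r N v w" by auto
    have "w i \<in> {v i - int r..v i + int r}" if "i < d" for i
      using box_nbr_coordinate[OF w(2) that] by auto
    then show "w \<in> (\<Pi>\<^sub>E i\<in>{..<d}. {v i - int r..v i + int r})"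
      using w(1) by (auto simp: lattice_box_iff PiE_iff extensional_def)
  qed
  then have "card {w\<in>lattice_box d N. box_nbr d r N v w} \<le> card (\<Pi>\<^sub>E i\<in>{..<d}. {v i - int r..v i + int r})"
    by (intro card_mono finite_PiE) auto
  also have "\<dots> = (\<Prod>i<d. 2 * r + 1)"
    unfolding card_PiE[OF finite_lessThan] by (rule prod.cong) auto
  also have "\<dots> = (2 * r + 1) ^ d" by simp
  finally show ?thesis .
qed

lemma box_kernel_symmetric: "symmetric_kernel (lattice_box d N) (box_kernel d r N)"
  by unfold_locales (auto simp: box_kernel_def box_nbr_sym)

lemma sum_abs_box_kernel_le:
  assumes v: "v \<in> lattice_box d N" and W: "\<bar>W v\<bar> \<le> \<Lambda>"
  shows "(\<Sum>w\<in>lattice_box d N. \<bar>add_diag (box_kernel d r N) W v w\<bar>) \<le> 2 * real ((2 * r + 1) ^ d) + \<Lambda>"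
proof -
  let ?X = "lattice_box d N"
  let ?deg = "real (card {w\<in>?X. box_nbr d r N v w})"
  have "(\<Sum>w\<in>?X. \<bar>add_diag (box_kernel d r N) W v w\<bar>)
      \<le> (\<Sum>w\<in>?X. of_bool (box_nbr d r N v w) + (if w = v then ?deg + \<Lambda> else 0))"
  proof (rule sum_mono)
    fix w
    show "\<bar>add_diag (box_kernel d r N) W v w\<bar> \<le> of_bool (box_nbr d r N v w) + (if w = v then ?deg + \<Lambda> else 0)"
    proof (cases "w = v")
      case True
      have "\<bar>1 - ?deg + W v\<bar> \<le> 1 + ?deg + \<Lambda>" using W by linarith
      then show ?thesis using True by (simp add: add_diag_def box_kernel_def box_nbr_refl)
    qed (simp add: add_diag_def box_kernel_def)
  qed
  also have "\<dots> = ?deg + (?deg + \<Lambda>)"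
    using v by (simp add: sum.distrib of_bool_def sum.If_cases Int_def)
  also have "\<dots> \<le> 2 * real ((2 * r + 1) ^ d) + \<Lambda>"
    using of_nat_mono[OF card_box_nbr[of d N r v], where 'a = real] by linarith
  finally show ?thesis .
qed

text \<open>The eigenvalue equation is evaluated at a site where the eigenfunction is largest in
  absolute value.\<close>

lemma eigenvalue_le_row_sum:
  assumes X: "finite X" and B: "eigenbasis X K B e" and \<phi>: "\<phi> \<in> B"
    and row: "\<And>v. v \<in> X \<Longrightarrow> (\<Sum>w\<in>X. \<bar>K v w\<bar>) \<le> c"
  shows "\<bar>e \<phi>\<bar> \<le> c"
proof -
  have norm: "(\<Sum>v\<in>X. (\<phi> v)\<^sup>2) = 1" by (rule eigenbasis_norm[OF B \<phi>])
  then have ne: "X \<noteq> {}" by auto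
  obtain v where v: "v \<in> X" and max: "\<And>w. w \<in> X \<Longrightarrow> \<bar>\<phi> w\<bar> \<le> \<bar>\<phi> v\<bar>"
    using obtains_MAX[OF X ne, of "\<lambda>w. \<bar>\<phi> w\<bar>"] X by (metis Max_ge finite_imageI imageI)
  have pos: "\<bar>\<phi> v\<bar> > 0"
  proof (rule ccontr)
    assume "\<not> \<bar>\<phi> v\<bar> > 0"
    then have "\<phi> w = 0" if "w \<in> X" for w using max[OF that] by linarith
    then show False using norm by simp
  qed
  have "kernel_op X K \<phi> v = e \<phi> * \<phi> v" using B \<phi> by (simp add: eigenbasis_def)
  then have "\<bar>e \<phi>\<bar> * \<bar>\<phi> v\<bar> = \<bar>\<Sum>w\<in>X. K v w * \<phi> w\<bar>" using v by (simp add: kernel_op_def abs_mult)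
  also have "\<dots> \<le> (\<Sum>w\<in>X. \<bar>K v w\<bar> * \<bar>\<phi> v\<bar>)"
    using max by (intro order.trans[OF sum_abs] sum_mono) (auto simp: abs_mult intro: mult_left_mono)
  also have "\<dots> \<le> c * \<bar>\<phi> v\<bar>"
    unfolding sum_distrib_right[symmetric] using row[OF v] by (rule mult_right_mono) simp
  finally show ?thesis using pos by simp
qed

section \<open>Periodic layers orthogonal to the first axis\<close>

lemma layer_earlier:
  fixes x y :: int and q L :: nat
  assumes "0 < L" "0 \<le> y" "y < x" "x \<le> y + int q" "int q \<le> x mod int L"
  shows "y mod int L < x mod int L"
proof -
  \<comment> \<open>The residue of \<open>x\<close> is at least \<open>q\<close>, so going back by
    at most \<open>q\<close> does not cross a multiple of \<open>L\<close>.\<close>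
  have "x mod int L - (x - y) \<ge> 0" using assms by linarith
  moreover have "x mod int L - (x - y) < int L" using assms pos_mod_bound[of "int L" x] by linarith
  ultimately have "(x mod int L - (x - y)) mod int L = x mod int L - (x - y)" by (rule mod_pos_pos_trivial)
  moreover have "(x mod int L - (x - y)) mod int L = y mod int L" by (simp add: mod_simps)
  ultimately show ?thesis using assms by linarith
qed

text \<open>Counting modulo \<open>L\<close> makes the layers with index below \<open>q\<close> a
  sparse periodic family of slabs. The transfer restarts in every period, so its loss depends on
  \<open>L\<close> and not on \<open>N\<close>.\<close>

definition layer :: "nat \<Rightarrow> (nat \<Rightarrow> int) \<Rightarrow> nat" where
  "layer L v = nat ((v 0 - 1) mod int L)"

text \<open>The ball around \<open>v\<close> shifted back by \<open>r\<close> reaches the first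
  coordinate of \<open>v\<close> only at \<open>v\<close> itself; its other sites lie at most
  \<open>2 * r\<close> earlier, whence \<open>q = 2 * r\<close>.\<close>

lemma box_layered_kernel:
  assumes d: "0 < d" and r: "0 < r" and L: "0 < L"
    and W: "\<And>v. v \<in> lattice_box d N \<Longrightarrow> \<bar>W v\<bar> \<le> \<Lambda>" and t: "\<bar>t\<bar> \<le> T"
  shows "layered_kernel (lattice_box d N) (\<lambda>v w. add_diag (box_kernel d r N) W v w - of_bool (v = w) * t)
    (layer L) (\<lambda>v. v(0 := v 0 - int r)) (2 * r) L ((2 * r + 1) ^ d) (1 + real ((2 * r + 1) ^ d) + \<Lambda> + T)"
    (is "layered_kernel ?X ?G ?p ?s ?q L ?D ?C")
proof
  have G_nbr: "box_nbr d r N v w" if "?G v w \<noteq> 0" for v w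
    using that box_nbr_refl by (cases "v = w") (auto simp: add_diag_def box_kernel_def)
  have v0: "2 * int r \<le> (v 0 - 1) mod int L" if "?q \<le> ?p v" for v :: "nat \<Rightarrow> int"
    using that L by (simp add: layer_def le_nat_iff)
  have v0': "2 * int r \<le> v 0 - 1" if "v \<in> ?X" "?q \<le> ?p v" for v
  proof -
    have "1 \<le> v 0" using that d by (simp add: lattice_box_iff)
    then have "(v 0 - 1) mod int L \<le> v 0 - 1" by (intro zmod_le_nonneg_dividend) simp
    then show ?thesis using v0[OF that(2)] by linarith
  qed
  show "finite ?X" by simp
  show "?p v < L" for v using L by (simp add: layer_def nat_less_iff)
  show s_mem: "?s v \<in> ?X" if "v \<in> ?X" "?q \<le> ?p v" for v
  proof -
    have "v 0 \<le> int N" using that d by (simp add: lattice_box_iff)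
    then show ?thesis using v0'[OF that] that d by (intro lattice_box_shift_mem) auto
  qed
  show "inj_on ?s {v\<in>?X. ?q \<le> ?p v}"
  proof (rule inj_onI)
    fix v w assume eq: "?s v = ?s w"
    show "v = w"
    proof
      fix i show "v i = w i" using fun_cong[OF eq, of i] by (cases "i = 0") auto
    qed
  qed
  \<comment> \<open>As \<open>r\<close> is positive, the entry used for the transfer is off the
    diagonal, so it equals 1 whatever the potential and \<open>t\<close>.\<close>
  have ne: "?s v \<noteq> v" for v
  proof
    assume "?s v = v"
    from fun_cong[OF this, of 0] show False using r by simp
  qed
  show "?G (?s v) v = 1" if v: "v \<in> ?X" "?q \<le> ?p v" for v
  proof -
    have "v 0 \<le> int N" using v d by (simp add: lattice_box_iff)
    then have "(?s v, (?s v)(0 := (?s v) 0 + int r)) \<in> lattice_box_edges d N ^^ r"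
      by (intro lattice_box_straight_walk s_mem v d) simp
    then have "box_nbr d r N v (?s v)" unfolding box_nbr_def graph_dist_le_iff by auto
    then show ?thesis using ne[of v] by (simp add: add_diag_def box_kernel_def box_nbr_sym[of d r N v])
  qed
  show "?p w < ?p v" if v: "v \<in> ?X" "?q \<le> ?p v" and w: "w \<in> ?X" "w \<noteq> v" "?G (?s v) w \<noteq> 0" for v w
  proof -
    have nbr: "box_nbr d r N (?s v) w" by (rule G_nbr[OF w(3)])
    from box_nbr_coordinate[OF nbr d] have le: "\<bar>w 0 - (v 0 - int r)\<bar> \<le> int r" by simp
    have "w 0 \<noteq> v 0"
    proof
      assume "w 0 = v 0"
      then have "w = (?s v)(0 := (?s v) 0 + int r)"
        by (intro box_nbr_extremal[OF nbr d w(1) s_mem[OF v]]) simp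
      then show False using w(2) by simp
    qed
    moreover have "1 \<le> w 0" using w(1) d by (simp add: lattice_box_iff)
    ultimately have "(w 0 - 1) mod int L < (v 0 - 1) mod int L"
      using le L v0[OF v(2)] by (intro layer_earlier[where q = ?q]) auto
    then show ?thesis using v0[OF v(2)] r by (simp add: layer_def)
  qed
  show "\<bar>?G v w\<bar> \<le> ?C" if "v \<in> ?X" "w \<in> ?X" for v w
  proof -
    have "real (card {w\<in>?X. box_nbr d r N v w}) \<le> real ?D" using card_box_nbr by (rule of_nat_mono)
    moreover have "0 \<le> real (card {w\<in>?X. box_nbr d r N v w})" by simp
    ultimately have "\<bar>1 - real (card {w\<in>?X. box_nbr d r N v w}) + W v - t\<bar> \<le> ?C" "0 \<le> ?C - 1"
      using W[OF that(1)] t by linarith+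
    then show ?thesis
      by (cases "v = w") (auto simp: add_diag_def box_kernel_def box_nbr_refl)
  qed
  show "card {w\<in>?X. ?G v w \<noteq> 0} \<le> ?D" for v
  proof -
    have "card {w\<in>?X. ?G v w \<noteq> 0} \<le> card {w\<in>?X. box_nbr d r N v w}"
      using G_nbr by (intro card_mono) auto
    then show ?thesis using card_box_nbr[of d N r v] by linarith
  qed
  show "card {v\<in>?X. ?G v w \<noteq> 0} \<le> ?D" for w
  proof -
    have "card {v\<in>?X. ?G v w \<noteq> 0} \<le> card {v\<in>?X. box_nbr d r N w v}"
      using G_nbr box_nbr_sym by (intro card_mono) auto
    then show ?thesis using card_box_nbr[of d N r w] by linarith
  qed
qed

text \<open>A first coordinate is determined by its residue and its period, and the last period may
  be incomplete; hence \<open>N div L + 1\<close>.\<close>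

lemma card_first_layers:
  assumes d: "0 < d" and L: "0 < L"
  shows "card {v\<in>lattice_box d N. layer L v < q} \<le> q * (N div L + 1) * N ^ (d - 1)"
proof -
  define T where "T = {x\<in>{1..int N}. nat ((x - 1) mod int L) < q}"
  have "card T \<le> card ({..<q} \<times> {..N div L})"
  proof (rule card_inj_on_le)
    let ?f = "\<lambda>x. (nat ((x - 1) mod int L), nat ((x - 1) div int L))"
    show "inj_on ?f T"
    proof (rule inj_onI)
      fix x y assume x: "x \<in> T" and y: "y \<in> T" and eq: "?f x = ?f y"
      have pos: "0 \<le> (z - 1) mod int L" "0 \<le> (z - 1) div int L" if "z \<in> T" for z
        using that L by (auto simp: T_def pos_imp_zdiv_nonneg_iff)
      have "(x - 1) mod int L = (y - 1) mod int L" "(x - 1) div int L = (y - 1) div int L"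
        using eq pos[OF x] pos[OF y] by (simp_all add: eq_nat_nat_iff)
      then have "x - 1 = y - 1" by (metis mult_div_mod_eq)
      then show "x = y" by simp
    qed
    show "?f ` T \<subseteq> {..<q} \<times> {..N div L}"
    proof (rule image_subsetI)
      fix x assume x: "x \<in> T"
      have "(x - 1) div int L \<le> int N div int L" using x L by (intro zdiv_mono1) (auto simp: T_def)
      then have "nat ((x - 1) div int L) \<le> N div L" by (simp add: nat_le_iff zdiv_int)
      then show "?f x \<in> {..<q} \<times> {..N div L}" using x by (simp add: T_def)
    qed
  qed simp
  then have T: "card T \<le> q * (N div L + 1)" by (simp add: card_cartesian_product)
  have "{v\<in>lattice_box d N. layer L v < q} = (\<Pi>\<^sub>E i\<in>{..<d}. if i = 0 then T else {1..int N})"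
  proof (rule set_eqI)
    fix v :: "nat \<Rightarrow> int"
    have "(\<forall>i<d. v i \<in> (if i = 0 then T else {1..int N})) \<longleftrightarrow>
        (\<forall>i<d. v i \<in> {1..int N}) \<and> nat ((v 0 - 1) mod int L) < q" (is "?l \<longleftrightarrow> ?r")
    proof
      assume l: ?l
      then have "v 0 \<in> T" using d by auto
      then have "v i \<in> {1..int N}" if "i < d" for i
        using l[rule_format, OF that] by (cases "i = 0") (auto simp: T_def)
      then show ?r using \<open>v 0 \<in> T\<close> by (simp add: T_def)
    next
      assume ?r
      then show ?l using d by (auto simp: T_def)
    qed
    then show "v \<in> {v\<in>lattice_box d N. layer L v < q} \<longleftrightarrow> v \<in> (\<Pi>\<^sub>E i\<in>{..<d}. if i = 0 then T else {1..int N})"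
      unfolding lattice_box_def layer_def PiE_iff mem_Collect_eq lessThan_iff by blast
  qed
  then have "card {v\<in>lattice_box d N. layer L v < q} = (\<Prod>i<d. card (if i = 0 then T else {1..int N}))"
    by (simp add: card_PiE)
  also have "\<dots> = card T * (\<Prod>i\<in>{..<d} - {0}. card (if i = 0 then T else {1..int N}))"
    using d by (subst prod.remove[of _ 0]) auto
  also have "(\<Prod>i\<in>{..<d} - {0}. card (if i = 0 then T else {1..int N})) = (\<Prod>i\<in>{..<d} - {0}. N)"
    by (intro prod.cong) auto
  also have "\<dots> = N ^ (d - 1)" using d by (simp add: card_Diff_singleton)
  finally show ?thesis using T by simp
qed

text \<open>The seed layers have density about \<open>2 * r / L\<close>, so \<zeta> determines
  \<open>L\<close>; the loss over \<open>L\<close> layers then determines \<tau>.\<close>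

lemma box_kernel_family:
  assumes d: "0 < d" and r: "0 < r" and \<Lambda>: "\<Lambda> \<ge> 0"
  shows "kernel_family (lattice_box d) (box_kernel d r) \<Lambda> (2 * real ((2 * r + 1) ^ d) + \<Lambda>)"
proof (rule kernel_family.intro)
  define D where "D = (2 * r + 1) ^ d"
  define K where "K = 2 * real D + \<Lambda>"
  let ?X = "lattice_box d"
  let ?modes = "\<lambda>N. symmetric_kernel.modes (?X N) (box_kernel d r N)"
  let ?energy = "\<lambda>N. symmetric_kernel.energy (?X N) (box_kernel d r N)"
  note basis = symmetric_kernel.eigenbasis_modes[OF box_kernel_symmetric]
  show "symmetric_kernel (?X N) (box_kernel d r N)" for N by (rule box_kernel_symmetric)
  show bound: "\<bar>?energy N W \<phi>\<bar> \<le> 2 * real ((2 * r + 1) ^ d) + \<Lambda>"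
    if W: "\<And>v. v \<in> ?X N \<Longrightarrow> \<bar>W v\<bar> \<le> \<Lambda>" and \<phi>: "\<phi> \<in> ?modes N W" for N W \<phi>
    by (rule eigenvalue_le_row_sum[OF _ basis \<phi>]) (simp, rule sum_abs_box_kernel_le, assumption, rule W)
  show "\<exists>\<tau>>0. \<exists>N0. \<forall>N\<ge>N0. \<forall>W t. (\<forall>v\<in>?X N. \<bar>W v\<bar> \<le> \<Lambda>) \<longrightarrow>
      real (card {\<phi>\<in>?modes N W. \<bar>?energy N W \<phi> - t\<bar> \<le> \<tau>}) \<le> \<zeta> * real (card (?X N))"
    if \<zeta>: "\<zeta> > 0" for \<zeta> :: real
  proof -
    \<comment> \<open>For \<open>N \<ge> L\<close> the incomplete period at most doubles the
      density, so \<open>4 * r / L \<le> \<zeta>\<close> suffices.\<close>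
    define L where "L = nat \<lceil>4 * r / \<zeta>\<rceil> + 1"
    have L: "0 < L" "4 * real r / \<zeta> \<le> real L" unfolding L_def by (simp, linarith)
    define C where "C = 1 + real D + \<Lambda> + (K + 1)"
    define a where "a = layered_kernel.growth D C ^ L"
    have a: "a \<ge> 1"
    proof -
      \<comment> \<open>\<open>growth\<close> depends only on \<open>D\<close> and \<open>C\<close>,
        so any instance of the locale shows that it is at least 1.\<close>
      have "layered_kernel (?X 1) (\<lambda>v w. add_diag (box_kernel d r 1) (\<lambda>_. 0) v w - of_bool (v = w) * 0)
          (layer L) (\<lambda>v. v(0 := v 0 - int r)) (2 * r) L D C"
        unfolding D_def C_def using d r L \<Lambda> by (intro box_layered_kernel) (auto simp: K_def)
      then have "layered_kernel.growth D C \<ge> 1" by (rule layered_kernel.growth_ge_1)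
      then show ?thesis unfolding a_def by (rule one_le_power)
    qed
    define \<tau> where "\<tau> = 1 / (2 * a)"
    have \<tau>: "\<tau> > 0" "\<tau> \<le> 1" "a * \<tau>\<^sup>2 < 1"
      using a by (auto simp: \<tau>_def power2_eq_square field_simps)
    show ?thesis
    proof (intro exI[of _ \<tau>] exI[of _ L] conjI allI impI)
      show "\<tau> > 0" by (rule \<tau>)
      fix N W and t :: real
      assume N: "L \<le> N" and W: "\<forall>v\<in>?X N. \<bar>W v\<bar> \<le> \<Lambda>"
      show "real (card {\<phi>\<in>?modes N W. \<bar>?energy N W \<phi> - t\<bar> \<le> \<tau>}) \<le> \<zeta> * real (card (?X N))"
      \<comment> \<open>An interval that contains an energy has its centre bounded by
        \<open>K + 1\<close>. This bounds the entries of the shifted kernel uniformly in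
        \<open>t\<close>.\<close>
      proof (cases "{\<phi>\<in>?modes N W. \<bar>?energy N W \<phi> - t\<bar> \<le> \<tau>} = {}")
        case True
        show ?thesis unfolding True using \<zeta> by simp
      next
        case False
        then obtain \<phi> where \<phi>: "\<phi> \<in> ?modes N W" "\<bar>?energy N W \<phi> - t\<bar> \<le> \<tau>" by blast
        have "\<bar>?energy N W \<phi>\<bar> \<le> K" unfolding K_def D_def using W by (intro bound \<phi>(1)) auto
        then have t: "\<bar>t\<bar> \<le> K + 1" using \<phi>(2) \<tau>(2) by linarith
        have "layered_kernel (?X N) (\<lambda>v w. add_diag (box_kernel d r N) W v w - of_bool (v = w) * t)
          (layer L) (\<lambda>v. v(0 := v 0 - int r)) (2 * r) L D C"
          unfolding D_def C_def using d r L W t by (intro box_layered_kernel) auto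
        from card_energies_nearby_le[OF this basis, of \<tau>] \<tau>
        have "card {\<phi>\<in>?modes N W. \<bar>?energy N W \<phi> - t\<bar> \<le> \<tau>} \<le> card {v\<in>?X N. layer L v < 2 * r}"
          by (simp add: a_def)
        also have "\<dots> \<le> 2 * r * (N div L + 1) * N ^ (d - 1)" by (rule card_first_layers[OF d L(1)])
        finally have "real (card {\<phi>\<in>?modes N W. \<bar>?energy N W \<phi> - t\<bar> \<le> \<tau>})
            \<le> real (2 * r * (N div L + 1) * N ^ (d - 1))" by (rule of_nat_mono)
        also have "\<dots> = 2 * real r * (real (N div L) + 1) * real N ^ (d - 1)" by (simp add: algebra_simps)
        also have "\<dots> \<le> \<zeta> * real N * real N ^ (d - 1)"
        proof (rule mult_right_mono)
          have "1 \<le> real N / real L" using N L(1) by (simp add: field_simps)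
          moreover have "real (N div L) \<le> real N / real L" by (rule of_nat_div_le_of_nat)
          ultimately have "2 * real r * (real (N div L) + 1) \<le> 2 * real r * (2 * (real N / real L))"
            by (intro mult_left_mono) auto
          also have "\<dots> = 4 * real r / real L * real N" by simp
          also have "\<dots> \<le> \<zeta> * real N"
            using L \<zeta> by (intro mult_right_mono) (auto simp: field_simps)
          finally show "2 * real r * (real (N div L) + 1) \<le> \<zeta> * real N" .
        qed simp
        also have "\<dots> = \<zeta> * real (card (?X N))"
          using power_minus_mult[OF d, of "real N"] by (simp add: card_lattice_box mult.assoc mult.commute)
        finally show ?thesis .
      qed
    qed
  qed
qed

section \<open>Spectral measures\<close>

text \<open>The bridge from real kernels to complex operators: a real eigenbasis also expands
  complex functions, and its vectors with eigenvalue \<open>t\<close> span the complex eigenspace of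
  \<open>t\<close>.\<close>

locale real_operator =
  fixes X :: "'a set" and K :: "'a \<Rightarrow> 'a \<Rightarrow> real" and B :: "('a \<Rightarrow> real) set"
    and e :: "('a \<Rightarrow> real) \<Rightarrow> real" and H :: "('a \<Rightarrow> complex) \<Rightarrow> ('a \<Rightarrow> complex)"
  assumes fin: "finite X"
    and sym: "\<And>v w. v \<in> X \<Longrightarrow> w \<in> X \<Longrightarrow> K v w = K w v"
    and basis: "eigenbasis X K B e"
    and H: "\<And>\<phi>. H \<phi> = (\<lambda>v. if v \<in> X then \<Sum>w\<in>X. of_real (K v w) * \<phi> w else 0)"
begin

definition coefficient :: "('a \<Rightarrow> complex) \<Rightarrow> ('a \<Rightarrow> real) \<Rightarrow> complex" where
  "coefficient \<theta> b = (\<Sum>v\<in>X. of_real (b v) * \<theta> v)"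

lemma finite_B: "finite B"
  by (rule eigenbasis_finite[OF basis])

lemma basis_outside: "b \<in> B \<Longrightarrow> v \<notin> X \<Longrightarrow> b v = 0"
  using basis by (simp add: eigenbasis_def)

lemma basis_eigen: "b \<in> B \<Longrightarrow> v \<in> X \<Longrightarrow> (\<Sum>w\<in>X. K v w * b w) = e b * b v"
  using basis by (auto simp: eigenbasis_def kernel_op_def fun_eq_iff split: if_splits)

lemma expansion:
  assumes v: "v \<in> X"
  shows "\<theta> v = (\<Sum>b\<in>B. coefficient \<theta> b * of_real (b v))"
proof -
  have "(\<Sum>b\<in>B. coefficient \<theta> b * of_real (b v)) = (\<Sum>b\<in>B. \<Sum>w\<in>X. \<theta> w * of_real (b w * b v))"
    unfolding coefficient_def sum_distrib_right by (simp add: mult_ac)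
  also have "\<dots> = (\<Sum>w\<in>X. \<theta> w * of_real (\<Sum>b\<in>B. b w * b v))"
    by (subst sum.swap) (simp add: sum_distrib_left)
  also have "\<dots> = (\<Sum>w\<in>X. if w = v then \<theta> v else 0)"
    using eigenbasis_complete[OF basis] v by (intro sum.cong) auto
  finally show ?thesis using v fin by simp
qed

text \<open>Eigenvectors of a symmetric kernel for different eigenvalues are orthogonal.\<close>

lemma coefficient_eigenspace:
  assumes \<theta>: "\<theta> \<in> eigenspace X H t" and b: "b \<in> B" and ne: "e b \<noteq> t"
  shows "coefficient \<theta> b = 0"
proof -
  have eig: "(\<Sum>w\<in>X. of_real (K v w) * \<theta> w) = of_real t * \<theta> v" if "v \<in> X" for v
  proof -
    have "H \<theta> v = of_real t * \<theta> v" using \<theta> by (simp add: eigenspace_def)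
    then show ?thesis using that by (simp add: H)
  qed
  have "of_real t * coefficient \<theta> b = (\<Sum>v\<in>X. of_real (b v) * (\<Sum>w\<in>X. of_real (K v w) * \<theta> w))"
    using eig by (simp add: coefficient_def sum_distrib_left mult.left_commute)
  also have "\<dots> = (\<Sum>v\<in>X. \<Sum>w\<in>X. of_real (K w v * b v) * \<theta> w)"
    unfolding sum_distrib_left using sym by (intro sum.cong refl) (simp add: mult_ac)
  also have "\<dots> = (\<Sum>w\<in>X. of_real (\<Sum>v\<in>X. K w v * b v) * \<theta> w)"
    by (subst sum.swap) (simp add: sum_distrib_right)
  also have "\<dots> = of_real (e b) * coefficient \<theta> b"
    using basis_eigen[OF b] by (simp add: coefficient_def sum_distrib_left mult.assoc)
  finally show ?thesis using ne by simp
qed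

lemma eigenspace_expansion:
  assumes \<theta>: "\<theta> \<in> eigenspace X H t" and v: "v \<in> X"
  shows "\<theta> v = (\<Sum>b\<in>{b\<in>B. e b = t}. coefficient \<theta> b * of_real (b v))"
proof -
  have "\<theta> v = (\<Sum>b\<in>B. coefficient \<theta> b * of_real (b v))" by (rule expansion[OF v])
  also have "\<dots> = (\<Sum>b\<in>{b\<in>B. e b = t}. coefficient \<theta> b * of_real (b v))"
    using finite_B coefficient_eigenspace[OF \<theta>] by (intro sum.mono_neutral_right) auto
  finally show ?thesis .
qed

lemma combination_eigenspace:
  "(\<lambda>v. \<Sum>b\<in>{b\<in>B. e b = t}. c b * of_real (b v)) \<in> eigenspace X H t"
proof -
  have "(\<Sum>w\<in>X. of_real (K v w) * (\<Sum>b\<in>{b\<in>B. e b = t}. c b * of_real (b w)))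
      = of_real t * (\<Sum>b\<in>{b\<in>B. e b = t}. c b * of_real (b v))" if v: "v \<in> X" for v
  proof -
    have "(\<Sum>w\<in>X. of_real (K v w) * (\<Sum>b\<in>{b\<in>B. e b = t}. c b * of_real (b w)))
        = (\<Sum>b\<in>{b\<in>B. e b = t}. c b * of_real (\<Sum>w\<in>X. K v w * b w))"
      unfolding sum_distrib_left by (subst sum.swap) (simp add: sum_distrib_left mult_ac)
    also have "\<dots> = (\<Sum>b\<in>{b\<in>B. e b = t}. of_real t * (c b * of_real (b v)))"
      using basis_eigen v by (intro sum.cong refl) (auto simp: mult_ac)
    finally show ?thesis by (simp add: sum_distrib_left)
  qed
  then show ?thesis
    using basis_outside by (auto simp: eigenspace_def ell2_def H fun_eq_iff intro!: sum.neutral)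
qed

lemma eigenspace_diff:
  assumes "\<phi> \<in> eigenspace X H t" "\<psi> \<in> eigenspace X H t"
  shows "(\<lambda>v. \<phi> v - \<psi> v) \<in> eigenspace X H t"
proof -
  have "H (\<lambda>v. \<phi> v - \<psi> v) = (\<lambda>v. H \<phi> v - H \<psi> v)"
    by (auto simp: H right_diff_distrib sum_subtractf)
  then show ?thesis using assms by (auto simp: eigenspace_def ell2_def right_diff_distrib)
qed

lemma spectrum_eq: "spectrum X H = e ` B"
proof
  show "spectrum X H \<subseteq> e ` B"
  proof
    fix t assume "t \<in> spectrum X H"
    then obtain \<theta> where \<theta>: "\<theta> \<in> eigenspace X H t" "\<theta> \<noteq> (\<lambda>_. 0)" by (auto simp: spectrum_def)
    then obtain v where v: "\<theta> v \<noteq> 0" by auto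
    then have "v \<in> X" using \<theta>(1) by (auto simp: eigenspace_def ell2_def)
    from eigenspace_expansion[OF \<theta>(1) this] v have "{b\<in>B. e b = t} \<noteq> {}" by (metis sum.empty)
    then show "t \<in> e ` B" by auto
  qed
  show "e ` B \<subseteq> spectrum X H"
  proof
    fix t assume "t \<in> e ` B"
    then obtain b where b: "b \<in> B" "e b = t" by auto
    have "(\<lambda>v. \<Sum>b'\<in>{b'\<in>B. e b' = t}. of_bool (b' = b) * of_real (b' v)) \<in> eigenspace X H t"
      by (rule combination_eigenspace)
    also have "(\<lambda>v. \<Sum>b'\<in>{b'\<in>B. e b' = t}. of_bool (b' = b) * of_real (b' v)) = (\<lambda>v. of_real (b v) :: complex)"
    proof
      fix v
      have "(\<Sum>b'\<in>{b'\<in>B. e b' = t}. of_bool (b' = b) * of_real (b' v) :: complex)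
          = (\<Sum>b'\<in>{b'\<in>B. e b' = t}. if b' = b then of_real (b v) else 0)" by (intro sum.cong) auto
      then show "(\<Sum>b'\<in>{b'\<in>B. e b' = t}. of_bool (b' = b) * of_real (b' v)) = (of_real (b v) :: complex)"
        using b finite_B by simp
    qed
    finally have "(\<lambda>v. of_real (b v)) \<in> eigenspace X H t" .
    moreover have "(\<lambda>v. of_real (b v) :: complex) \<noteq> (\<lambda>_. 0)"
    proof
      assume "(\<lambda>v. of_real (b v) :: complex) = (\<lambda>_. 0)"
      then have "b v = 0" for v by (auto dest: fun_cong[of _ _ v])
      then show False using eigenbasis_norm[OF basis b(1)] by simp
    qed
    ultimately show "t \<in> spectrum X H" by (auto simp: spectrum_def)
  qed
qed

lemma eigenprojection_delta:
  assumes x: "x \<in> X"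
  shows "eigenprojection X H t (indicator {x}) = (\<lambda>v. \<Sum>b\<in>{b\<in>B. e b = t}. of_real (b x) * of_real (b v))"
    (is "_ = ?\<psi>")
  unfolding eigenprojection_def
proof (rule the_equality)
  have orth: "ell2_inner X \<theta> (\<lambda>v. indicator {x} v - ?\<psi> v) = 0" if \<theta>: "\<theta> \<in> eigenspace X H t" for \<theta>
  proof -
    have "ell2_inner X \<theta> (\<lambda>v. indicator {x} v - ?\<psi> v)
        = (\<Sum>v\<in>X. cnj (\<theta> v) * indicator {x} v) - (\<Sum>v\<in>X. cnj (\<theta> v) * ?\<psi> v)"
      by (simp add: ell2_inner_def right_diff_distrib sum_subtractf)
    also have "(\<Sum>v\<in>X. cnj (\<theta> v) * indicator {x} v) = (\<Sum>v\<in>X. if v = x then cnj (\<theta> x) else 0)"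
      by (intro sum.cong) auto
    also have "\<dots> = cnj (\<theta> x)" using x fin by simp
    also have "(\<Sum>v\<in>X. cnj (\<theta> v) * ?\<psi> v) = (\<Sum>b\<in>{b\<in>B. e b = t}. cnj (coefficient \<theta> b) * of_real (b x))"
    proof -
      have "cnj (coefficient \<theta> b) = (\<Sum>v\<in>X. cnj (\<theta> v) * of_real (b v))" for b
        by (simp add: coefficient_def mult.commute)
      then show ?thesis
        unfolding sum_distrib_left by (subst sum.swap) (simp add: sum_distrib_left sum_distrib_right mult_ac)
    qed
    also have "\<dots> = cnj (\<theta> x)" unfolding eigenspace_expansion[OF \<theta> x] by simp
    finally show ?thesis by simp
  qed
  show \<psi>: "?\<psi> \<in> eigenspace X H t \<and> (\<forall>\<theta>\<in>eigenspace X H t. ell2_inner X \<theta> (\<lambda>v. indicator {x} v - ?\<psi> v) = 0)"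
    using combination_eigenspace[where t = t and c = "\<lambda>b. of_real (b x)"] orth by blast
  fix \<psi>' assume \<psi>': "\<psi>' \<in> eigenspace X H t \<and> (\<forall>\<theta>\<in>eigenspace X H t. ell2_inner X \<theta> (\<lambda>v. indicator {x} v - \<psi>' v) = 0)"
  \<comment> \<open>Uniqueness for the definite description: the difference of two candidates lies
    in the eigenspace and is orthogonal to it, hence to itself.\<close>
  define \<theta> where "\<theta> v = \<psi>' v - ?\<psi> v" for v
  have \<theta>: "\<theta> \<in> eigenspace X H t" using \<psi> \<psi>' unfolding \<theta>_def by (intro eigenspace_diff) auto
  have "ell2_inner X \<theta> \<theta> = ell2_inner X \<theta> (\<lambda>v. indicator {x} v - ?\<psi> v) - ell2_inner X \<theta> (\<lambda>v. indicator {x} v - \<psi>' v)"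
    unfolding ell2_inner_def sum_subtractf[symmetric] by (intro sum.cong) (auto simp: \<theta>_def algebra_simps)
  also have "\<dots> = 0" using orth[OF \<theta>] \<psi>' \<theta> by simp
  finally have "of_real (\<Sum>v\<in>X. (cmod (\<theta> v))\<^sup>2) = (0 :: complex)"
    unfolding ell2_inner_def of_real_sum complex_norm_square by (simp add: mult.commute)
  then have "(\<Sum>v\<in>X. (cmod (\<theta> v))\<^sup>2) = 0" by (simp only: of_real_eq_0_iff)
  then have "\<theta> v = 0" if "v \<in> X" for v using that fin by (simp add: sum_nonneg_eq_0_iff)
  moreover have "\<theta> v = 0" if "v \<notin> X" for v using \<theta> that by (simp add: eigenspace_def ell2_def)
  ultimately show "\<psi>' = ?\<psi>" unfolding \<theta>_def by fastforce
qed

lemma inner_fun_calc: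
  assumes x: "x \<in> X"
  shows "ell2_inner X (indicator {x}) (fun_calc X H g (indicator {x})) = (\<Sum>b\<in>B. g (e b) * of_real ((b x)\<^sup>2))"
proof -
  have "ell2_inner X (indicator {x}) (fun_calc X H g (indicator {x}))
      = (\<Sum>v\<in>X. if v = x then fun_calc X H g (indicator {x}) x else 0)"
    unfolding ell2_inner_def by (intro sum.cong) auto
  also have "\<dots> = fun_calc X H g (indicator {x}) x" using x fin by simp
  also have "\<dots> = (\<Sum>t\<in>e ` B. \<Sum>b\<in>{b\<in>B. e b = t}. g (e b) * of_real ((b x)\<^sup>2))"
    unfolding fun_calc_def spectrum_eq eigenprojection_delta[OF x] sum_distrib_left
    by (intro sum.cong refl) (auto simp: power2_eq_square)
  also have "\<dots> = (\<Sum>b\<in>B. g (e b) * of_real ((b x)\<^sup>2))"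
    using finite_B by (rule sum.image_gen[symmetric])
  finally show ?thesis .
qed

text \<open>The witness puts mass \<open>(b x)\<^sup>2\<close> at the energy of each basis vector,
  with masses adding up at degenerate energies.\<close>

lemma is_spectral_measure_exists:
  assumes x: "x \<in> X"
  shows "is_spectral_measure X H x (distr (point_measure B (\<lambda>b. ennreal ((b x)\<^sup>2))) borel e)" (is "is_spectral_measure X H x ?\<sigma>")
  unfolding is_spectral_measure_def
proof (intro conjI allI impI)
  let ?P = "point_measure B (\<lambda>b. ennreal ((b x)\<^sup>2))"
  have e: "e \<in> measurable ?P borel" by (simp add: measurable_def space_point_measure sets_point_measure)
  have "emeasure ?P (space ?P) \<noteq> \<infinity>"
    using finite_B by (simp add: space_point_measure emeasure_point_measure_finite)
  then have "finite_measure ?P" by (rule finite_measureI)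
  then show "finite_measure ?\<sigma>" using e by (rule finite_measure.finite_measure_distr)
  show "sets ?\<sigma> = sets borel" by simp
  fix g :: "real \<Rightarrow> complex" assume "g \<in> borel_measurable borel \<and> bounded (range g)"
  then have "(\<integral>t. g t \<partial>?\<sigma>) = (\<integral>b. g (e b) \<partial>?P)" using e by (intro integral_distr) auto
  also have "\<dots> = (\<Sum>b\<in>B. (b x)\<^sup>2 *\<^sub>R g (e b))"
    using finite_B by (simp add: lebesgue_integral_point_measure_finite)
  also have "\<dots> = ell2_inner X (indicator {x}) (fun_calc X H g (indicator {x}))"
    unfolding inner_fun_calc[OF x] by (simp add: scaleR_conv_of_real mult.commute)
  finally show "ell2_inner X (indicator {x}) (fun_calc X H g (indicator {x})) = (\<integral>t. g t \<partial>?\<sigma>)" ..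
qed

text \<open>Indicators of Borel sets are admissible test functions, so the defining identity gives
  the measure of every Borel set directly. This also yields uniqueness.\<close>

lemma measure_is_spectral_measure:
  assumes x: "x \<in> X" and \<sigma>: "is_spectral_measure X H x \<sigma>" and A: "A \<in> sets borel"
  shows "measure \<sigma> A = (\<Sum>b\<in>{b\<in>B. e b \<in> A}. (b x)\<^sup>2)"
proof -
  interpret finite_measure \<sigma> using \<sigma> by (simp add: is_spectral_measure_def)
  have A\<sigma>: "A \<in> sets \<sigma>" using \<sigma> A by (simp add: is_spectral_measure_def)
  have "(\<lambda>t. indicator A t :: complex) \<in> borel_measurable borel" using A by simp
  moreover have "bounded (range (\<lambda>t. indicator A t :: complex))"
    by (intro boundedI[of _ 1]) (auto simp: indicator_def)
  ultimately have "(\<integral>t. indicator A t \<partial>\<sigma>)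
      = ell2_inner X (indicator {x}) (fun_calc X H (\<lambda>t. indicator A t) (indicator {x}))"
    using \<sigma> by (simp add: is_spectral_measure_def)
  also have "\<dots> = (\<Sum>b\<in>B. indicator A (e b) * of_real ((b x)\<^sup>2))" by (rule inner_fun_calc[OF x])
  also have "\<dots> = of_real (\<Sum>b\<in>B. if e b \<in> A then (b x)\<^sup>2 else 0)"
    unfolding of_real_sum by (intro sum.cong) (auto simp: indicator_def)
  also have "(\<Sum>b\<in>B. if e b \<in> A then (b x)\<^sup>2 else 0) = (\<Sum>b\<in>{b\<in>B. e b \<in> A}. (b x)\<^sup>2)"
    using finite_B by (simp add: sum.inter_filter)
  finally have 1: "(\<integral>t. indicator A t \<partial>\<sigma>) = (of_real (\<Sum>b\<in>{b\<in>B. e b \<in> A}. (b x)\<^sup>2) :: complex)" .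
  have "(\<integral>t. indicator A t \<partial>\<sigma>) = (of_real (measure \<sigma> A) :: complex)"
  proof -
    have "(\<integral>t. of_real (indicator A t) \<partial>\<sigma>) = (of_real (\<integral>t. indicator A t \<partial>\<sigma>) :: complex)"
      by (rule integral_complex_of_real)
    then show ?thesis using A\<sigma> by (simp add: of_real_indicator)
  qed
  from trans[OF this[symmetric] 1] show ?thesis by (rule of_real_eq_iff[THEN iffD1])
qed

lemma measure_spectral_measure_singleton:
  assumes x: "x \<in> X"
  shows "measure (spectral_measure X H x) {t} = (\<Sum>b\<in>{b\<in>B. e b = t}. (b x)\<^sup>2)"
proof -
  have "\<sigma> = \<sigma>'" if "is_spectral_measure X H x \<sigma>" "is_spectral_measure X H x \<sigma>'" for \<sigma> \<sigma>'
  proof (rule measure_eqI)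
    show "sets \<sigma> = sets \<sigma>'" using that by (simp add: is_spectral_measure_def)
    fix A assume "A \<in> sets \<sigma>"
    then have "A \<in> sets borel" using that by (simp add: is_spectral_measure_def)
    then have "measure \<sigma> A = measure \<sigma>' A" using measure_is_spectral_measure[OF x] that by simp
    then show "emeasure \<sigma> A = emeasure \<sigma>' A"
      using that by (simp add: is_spectral_measure_def finite_measure.emeasure_eq_measure)
  qed
  then have "is_spectral_measure X H x (spectral_measure X H x)"
    unfolding spectral_measure_def using is_spectral_measure_exists[OF x] by (metis the_equality)
  from measure_is_spectral_measure[OF x this, of "{t}"] show ?thesis by simp
qed

end

section \<open>Application to the operators on boxes\<close>

lemma schrodinger_box_kernel:
  "schrodinger (lattice_box d N) (lattice_box_edges d N) r W \<phi>
    = (\<lambda>v. if v \<in> lattice_box d N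
        then \<Sum>w\<in>lattice_box d N. of_real (add_diag (box_kernel d r N) W v w) * \<phi> w else 0)"
proof
  fix v
  let ?X = "lattice_box d N"
  let ?Y = "{w\<in>?X. box_nbr d r N v w}"
  show "schrodinger ?X (lattice_box_edges d N) r W \<phi> v = (if v \<in> ?X
      then \<Sum>w\<in>?X. of_real (add_diag (box_kernel d r N) W v w) * \<phi> w else 0)"
  proof (cases "v \<in> ?X")
    case True
    have "(\<Sum>w\<in>?X. of_real (add_diag (box_kernel d r N) W v w) * \<phi> w)
        = (\<Sum>w\<in>?X. (if box_nbr d r N v w then \<phi> w else 0)
            + (if w = v then (of_real (W v) - of_nat (card ?Y)) * \<phi> v else 0))"
      by (intro sum.cong) (auto simp: add_diag_def box_kernel_def algebra_simps)
    also have "\<dots> = (\<Sum>w\<in>?Y. \<phi> w) + (of_real (W v) - of_nat (card ?Y)) * \<phi> v"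
      using True by (simp add: sum.distrib sum.inter_filter)
    also have "\<dots> = (\<Sum>w\<in>?Y. \<phi> w - \<phi> v) + of_real (W v) * \<phi> v"
      by (simp add: sum_subtractf algebra_simps)
    finally show ?thesis using True by (simp add: schrodinger_def box_nbr_def)
  qed (simp add: schrodinger_def)
qed

lemma measure_spectral_measure_box:
  assumes n: "n \<in> lattice_box d N"
  shows "measure (spectral_measure (lattice_box d N) (schrodinger (lattice_box d N) (lattice_box_edges d N) r W) n) {t}
    = (\<Sum>\<phi>\<in>{\<phi>\<in>symmetric_kernel.modes (lattice_box d N) (box_kernel d r N) W.
        symmetric_kernel.energy (lattice_box d N) (box_kernel d r N) W \<phi> = t}. (\<phi> n)\<^sup>2)"
proof -
  interpret real_operator "lattice_box d N" "add_diag (box_kernel d r N) W"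
    "symmetric_kernel.modes (lattice_box d N) (box_kernel d r N) W"
    "symmetric_kernel.energy (lattice_box d N) (box_kernel d r N) W"
    "schrodinger (lattice_box d N) (lattice_box_edges d N) r W"
  proof (unfold_locales, goal_cases)
    case (2 v w)
    then show ?case
      using symmetric_kernel.sym[OF box_kernel_symmetric[of d N r]] by (auto simp: add_diag_def)
  qed (simp_all add: schrodinger_box_kernel symmetric_kernel.eigenbasis_modes[OF box_kernel_symmetric])
  show ?thesis by (rule measure_spectral_measure_singleton[OF n])
qed

theorem corollary3p1p3:
  fixes r d :: nat and lam \<epsilon> \<delta> :: real
  assumes "r \<ge> 1" and "d \<ge> 1" and "lam > 0" and "\<epsilon> > 0" and "\<delta> > 0"
  shows "\<exists>N0::nat. \<forall>N::nat. N \<ge> 1 \<and> N ^ d > N0 \<longrightarrow>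
    (\<forall>V \<in> lattice_box d N \<rightarrow> {-lam..lam}. \<exists>W \<in> lattice_box d N \<rightarrow> {-lam..lam}.
       (SUP v\<in>lattice_box d N. \<bar>V v - W v\<bar>) < \<delta> \<and>
       real (card {n \<in> lattice_box d N. \<not> (\<exists>t. measure
           (spectral_measure (lattice_box d N) (schrodinger (lattice_box d N) (lattice_box_edges d N) r W) n) {t} > \<epsilon>)})
         \<ge> (1 - \<delta>) * real (N ^ d))"
proof -
  have d: "0 < d" and r: "0 < r" and lam: "0 \<le> lam" using assms by auto
  \<comment> \<open>The potential moves twice by at most \<eta>, so the total
    \<open>2 * \<eta> \<le> \<delta> / 2\<close> leaves room for the strict inequality;
    \<open>\<eta> \<le> lam\<close> makes the contraction factor below nonnegative.\<close>
  define \<eta> where "\<eta> = min (\<delta> / 4) (lam / 2)"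
  have \<eta>: "\<eta> > 0" "\<eta> \<le> \<delta> / 4" "\<eta> \<le> lam" using assms by (auto simp: \<eta>_def)
  interpret kernel_family "lattice_box d" "box_kernel d r" lam "2 * real ((2 * r + 1) ^ d) + lam"
    by (rule box_kernel_family[OF d r lam])
  obtain n0 where n0: "\<And>N V. N \<ge> n0 \<Longrightarrow> (\<forall>v\<in>lattice_box d N. \<bar>V v\<bar> \<le> lam - \<eta>) \<Longrightarrow> \<exists>W. near N \<eta> V W \<and>
      real (card {n\<in>lattice_box d N. \<exists>t. (\<Sum>\<phi>\<in>{\<phi>\<in>modes N W. energy N W \<phi> = t}. (\<phi> n)\<^sup>2) > \<epsilon>})
        \<le> \<eta> * real (card (lattice_box d N))"
    using delocalization[OF \<open>\<epsilon> > 0\<close> \<eta>(1)] by blast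
  show ?thesis
  \<comment> \<open>With this threshold the condition on \<open>N ^ d\<close> yields
    \<open>N \<ge> n0\<close>.\<close>
  proof (intro exI[of _ "n0 ^ d"] allI impI ballI)
    fix N :: nat and V :: "(nat \<Rightarrow> int) \<Rightarrow> real"
    let ?X = "lattice_box d N"
    assume N: "N \<ge> 1 \<and> N ^ d > n0 ^ d" and V: "V \<in> ?X \<rightarrow> {-lam..lam}"
    have "N \<ge> n0" using N power_mono[of N n0 d] by (meson le0 not_le less_imp_le)
    \<comment> \<open>Contracting towards 0 creates the margin \<eta>, so that the later
      perturbation cannot leave the interval from \<open>-lam\<close> to \<open>lam\<close>.\<close>
    define V' where "V' v = (1 - \<eta> / lam) * V v" for v
    have V': "\<bar>V' v\<bar> \<le> lam - \<eta>" "\<bar>V' v - V v\<bar> \<le> \<eta>" if "v \<in> ?X" for v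
    proof -
      have Vv: "\<bar>V v\<bar> \<le> lam" using V that by (auto simp: abs_le_iff Pi_iff)
      have "\<bar>V' v\<bar> = (1 - \<eta> / lam) * \<bar>V v\<bar>" using \<eta> assms by (simp add: V'_def abs_mult)
      also have "\<dots> \<le> (1 - \<eta> / lam) * lam" using Vv \<eta> assms by (intro mult_left_mono) auto
      finally show "\<bar>V' v\<bar> \<le> lam - \<eta>" using assms by (simp add: algebra_simps)
      have "V' v - V v = - (\<eta> / lam * V v)" by (simp add: V'_def algebra_simps)
      then have "\<bar>V' v - V v\<bar> = \<eta> / lam * \<bar>V v\<bar>" using \<eta> assms by (simp add: abs_mult)
      also have "\<dots> \<le> \<eta> / lam * lam" using Vv \<eta> assms by (intro mult_left_mono) auto
      finally show "\<bar>V' v - V v\<bar> \<le> \<eta>" using assms by simp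
    qed
    obtain W where W: "near N \<eta> V' W"
      and bad: "real (card {n\<in>?X. \<exists>t. (\<Sum>\<phi>\<in>{\<phi>\<in>modes N W. energy N W \<phi> = t}. (\<phi> n)\<^sup>2) > \<epsilon>})
        \<le> \<eta> * real (card ?X)"
      using n0[OF \<open>N \<ge> n0\<close>, of V'] V'(1) by blast
    let ?atom = "\<lambda>n. \<exists>t. measure (spectral_measure ?X (schrodinger ?X (lattice_box_edges d N) r W) n) {t} > \<epsilon>"
    show "\<exists>W\<in>?X \<rightarrow> {-lam..lam}. (SUP v\<in>?X. \<bar>V v - W v\<bar>) < \<delta> \<and>
       real (card {n\<in>?X. \<not> (\<exists>t. measure (spectral_measure ?X (schrodinger ?X (lattice_box_edges d N) r W) n) {t} > \<epsilon>)})
         \<ge> (1 - \<delta>) * real (N ^ d)"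
    proof (intro bexI[of _ W] conjI)
      show "W \<in> ?X \<rightarrow> {-lam..lam}"
      proof
        fix v assume "v \<in> ?X"
        then have "\<bar>W v - V' v\<bar> \<le> \<eta>" "\<bar>V' v\<bar> \<le> lam - \<eta>" using W V'(1) by auto
        then show "W v \<in> {-lam..lam}" by auto
      qed
      have "?X \<noteq> {}" using N card_lattice_box[of d N] by (metis card.empty not_one_le_zero power_eq_0_iff)
      then have "(SUP v\<in>?X. \<bar>V v - W v\<bar>) \<le> 2 * \<eta>"
      proof (rule cSUP_least)
        fix v assume "v \<in> ?X"
        then have "\<bar>W v - V' v\<bar> \<le> \<eta>" "\<bar>V' v - V v\<bar> \<le> \<eta>" using W V'(2) by auto
        then show "\<bar>V v - W v\<bar> \<le> 2 * \<eta>" by linarith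
      qed
      then show "(SUP v\<in>?X. \<bar>V v - W v\<bar>) < \<delta>" using \<eta> \<open>\<delta> > 0\<close> by linarith
      have "{n\<in>?X. \<exists>t. (\<Sum>\<phi>\<in>{\<phi>\<in>modes N W. energy N W \<phi> = t}. (\<phi> n)\<^sup>2) > \<epsilon>} = {n\<in>?X. ?atom n}"
        using measure_spectral_measure_box by (intro Collect_cong conj_cong refl) simp
      with bad have "real (card {n\<in>?X. ?atom n}) \<le> \<eta> * real (card ?X)" by simp
      also have "\<dots> \<le> \<delta> * real (card ?X)" using \<eta> \<open>\<delta> > 0\<close> by (intro mult_right_mono) auto
      finally have "real (card {n\<in>?X. ?atom n}) \<le> \<delta> * real (card ?X)" .
      moreover have "card ?X = card {n\<in>?X. ?atom n} + card {n\<in>?X. \<not> ?atom n}"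
        by (subst card_Un_disjoint[symmetric]) (auto intro!: arg_cong[where f = card])
      ultimately show "real (card {n\<in>?X. \<not> ?atom n}) \<ge> (1 - \<delta>) * real (N ^ d)"
        by (simp add: card_lattice_box[symmetric] algebra_simps del: of_nat_power)
    qed
  qed
qed

end
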